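(* Let $T$ be a sublinear operator, and let $\mathcal B$ be a matrix Muckenhoupt basis in $\mathbb R^n$ (with associated functions $K_t$, $1<t<\infty$). Fix $s$ with $1\le s<\infty$. Suppose that for some $p_0,q_0$ with $1\le p_0\le q_0\le\infty$, where $\frac1{p_0}-\frac1{q_0}=\frac1{s'}$ and $r_0=\frac{q_0}{s}$, there exists a positive increasing function $N_{p_0,q_0}$ such that for every matrix weight $W_0$ with $W_0^s\in\mathcal A_{r_0,\mathcal B}$, $$\left(\int_{\mathbb R^n}|W_0(x)Tf(x)|^{q_0}\,dx\right)^{\frac1{q_0}}\le N_{p_0,q_0}\big([W_0^s]_{\mathcal A_{r_0,\mathcal B}}\big)\left(\int_{\mathbb R^n}|W_0(x)f(x)|^{p_0}\,dx\right)^{\frac1{p_0}}.$$ Then for all $p,q$ such that $1<p\le q<\infty$, $\frac1p-\frac1q=\frac1{p_0}-\frac1{q_0}$, with $r=\frac qs$, and for all matrix weights $W$ with $W^s\in\mathcal A_{r,\mathcal B}$, $$\left(\int_{\mathbb R^n}|W(x)Tf(x)|^{q}\,dx\right)^{\frac1q}\le N_{p,q}(\mathcal B,p_0,q_0,p,q,[W^s]_{\mathcal A_{r,\mathcal B}})\left(\int_{\mathbb R^n}|W(x)f(x)|^{p}\,dx\right)^{\frac1p},$$ where $$N_{p,q}(\mathcal B,p_0,q_0,p,q,[W^s]_{\mathcal A_{r,\mathcal B}})=C(d,p_0,q_0,p,q)\,N_{p_0,q_0}\Big(C(d,p_0,q_0)\,K_{r'}\big([W^{-s}]_{\mathcal A_{r',\mathcal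 B}}\big)^{\frac1{r_0}}K_r\big([W^s]_{\mathcal A_{r,\mathcal B}}\big)^{\frac1{r_0'}}\Big),$$ with constants $C(\cdot)$ depending only on the listed parameters.
   Context: For $1\le t\le\infty$, $t'$ is the conjugate exponent, $\frac1t+\frac1{t'}=1$, with $\frac1\infty=0$; integral expressions with exponent $\infty$ are read as essential suprema, and $r_0=\infty$ if $q_0=\infty$. $|v|$ is the Euclidean norm of $v\in\mathbb R^d$, and $|A|_{\mathrm{op}}=\sup_{|v|=1}|Av|$. Matrix weight: a measurable function $W$ on $\mathbb R^n$ with values in the $d\times d$ real symmetric positive semidefinite matrices, with entries finite a.e. and $W(x)$ invertible for a.e. $x$. Powers $W^t$ are defined by diagonalization: if $W=U^{*}\mathrm{diag}(\lambda_i)U$ with $U$ orthogonal, then $W^t=U^{*}\mathrm{diag}(\lambda_i^t)U$. Basis: a collection $\mathcal B$ of nonempty open subsets of $\mathbb R^n$ of finite measure. Classes $\mathcal A_{r,\mathcal B}$: for $1<r<\infty$, $W\in\mathcal A_{r,\mathcal B}$ if $$[W]_{\mathcal A_{r,\mathcal B}}=\sup_{B\in\mathcal B}\left(\frac1{|B|}\int_B\left(\frac1{|B|}\int_B|W(x)W^{-1}(y)|_{\mathrm{op}}^{r'}\,dy\right)^{\frac r{r'}}dx\right)^{\frac1r}<\infty;$$ $W\in\mathcal A_{1,\mathcal B}$ if $[W]_{\mathcal A_{1,\mathcal B}}=\sup_{B\in\mathcal B}\operatorname{ess\,sup}_{x\in B}\frac1{|B|}\int_B|W^{-1}(x)W(y)|_{\mathrm{op}}\,dy<\infty$;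 $W\in\mathcal A_{\infty,\mathcal B}$ if $[W]_{\mathcal A_{\infty,\mathcal B}}=\sup_{B\in\mathcal B}\operatorname{ess\,sup}_{x\in B}\frac1{|B|}\int_B|W(x)W^{-1}(y)|_{\mathrm{op}}\,dy<\infty$. Christ–Goldberg maximal operator: $M_{W,\mathcal B}f(x)=\sup_{B\in\mathcal B}\frac1{|B|}\int_B|W(x)W^{-1}(y)f(y)|\,dy\cdot\chi_B(x)$ for $f:\mathbb R^n\to\mathbb R^d$. Matrix Muckenhoupt basis: a basis $\mathcal B$ such that (in every dimension $d\ge1$) for every $1<p<\infty$ there is an increasing function $K_p$ (which may also depend on $d,n,p$) such that for every matrix weight $W\in\mathcal A_{p,\mathcal B}$, $M_{W,\mathcal B}:L^p(\mathbb R^n,\mathbb R^d)\to L^p(\mathbb R^n)$ with $$\|M_{W,\mathcal B}f\|_{L^p(\mathbb R^n)}\le K_p([W]_{\mathcal A_{p,\mathcal B}})\|f\|_{L^p(\mathbb R^n,\mathbb R^d)}.$$ $T$ maps measurable functions $f:\mathbb R^n\to\mathbb R^d$ in its domain (a vector space of such functions) to measurable functions $Tf:\mathbb R^n\to\mathbb R^d$. Sublinear means $|T(f+g)(x)|\le|Tf(x)|+|Tg(x)|$ and $|T(\alpha f)(x)|=|\alpha||Tf(x)|$ for a.e. $x$, all $f,g$ in the domain and $\alpha\in\mathbb R$. The inequalities are understood for all $f$ in the domain (trivial when the right-hand side is infinite). *)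

theory Defs
  imports
    "HOL-Probability.Essential_Supremum"
    "Jordan_Normal_Form.Matrix"
begin

unbundle no vec_syntax

text \<open>
  Both dimensions are natural numbers, so that they can be quantified inside formulas: the
  constants in the main result may depend on d but not on n, and a matrix Muckenhoupt basis is
  required to satisfy its estimate in every dimension d. Points of R^n are extensional functions
  on \<open>{..<n}\<close>; vectors in R^d and d by d matrices are those of Jordan_Normal_Form.
\<close>

type_synonym pt = "nat \<Rightarrow> real"
type_synonym rvec = "real Matrix.vec"
type_synonym rmat = "real Matrix.mat"

definition leb :: "nat \<Rightarrow> pt measure" where
  "leb n = completion (Pi\<^sub>M {..<n} (\<lambda>_. lborel))"


subsection \<open>Exponents and norms\<close>

text \<open>Extended real division satisfies \<open>1 / 0 = \<infinity>\<close> and \<open>1 / \<infinity> = 0\<close>, so this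
  covers the endpoints 1 and \<open>\<infinity>\<close>.\<close>

definition conj_exp :: "ereal \<Rightarrow> ereal" where
  "conj_exp t = 1 / (1 - 1 / t)"

text \<open>Only used for positive exponents \<open>a\<close>.\<close>

definition ennpow :: "ennreal \<Rightarrow> real \<Rightarrow> ennreal" where
  "ennpow x a = (if x = \<infinity> then \<infinity> else ennreal (enn2real x powr a))"

definition Lnorm :: "pt measure \<Rightarrow> ereal \<Rightarrow> (pt \<Rightarrow> ennreal) \<Rightarrow> ennreal" where
  "Lnorm M t g =
     (if t = \<infinity> then esssup M g
      else ennpow (\<integral>\<^sup>+x. ennpow (g x) (real_of_ereal t) \<partial>M) (1 / real_of_ereal t))"

definition avg :: "pt measure \<Rightarrow> pt set \<Rightarrow> (pt \<Rightarrow> ennreal) \<Rightarrow> ennreal" where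
  "avg M B g = (\<integral>\<^sup>+x\<in>B. g x \<partial>M) / emeasure M B"

definition vnorm :: "rvec \<Rightarrow> real" where
  "vnorm v = sqrt (scalar_prod v v)"

definition opnorm :: "rmat \<Rightarrow> ennreal" where
  "opnorm A = (SUP v \<in> {v \<in> carrier_vec (dim_col A). vnorm v = 1}. ennreal (vnorm (A *\<^sub>v v)))"


subsection \<open>Matrix weights\<close>

definition psd :: "nat \<Rightarrow> rmat \<Rightarrow> bool" where
  "psd d A \<longleftrightarrow> A \<in> carrier_mat d d \<and> transpose_mat A = A \<and>
     (\<forall>v \<in> carrier_vec d. 0 \<le> scalar_prod v (A *\<^sub>v v))"

text \<open>For positive semidefinite \<open>A\<close> the result does not depend on the diagonalization.
  A zero eigenvalue is sent to 0 (as \<open>0 powr t = 0\<close>) also for negative \<open>t\<close>; for a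
  matrix weight this concerns a null set only.\<close>

definition mat_powr :: "rmat \<Rightarrow> real \<Rightarrow> rmat" where
  "mat_powr A t =
     (let d = dim_row A in
      THE B. \<exists>U l. U \<in> carrier_mat d d \<and> transpose_mat U * U = 1\<^sub>m d \<and>
        A = transpose_mat U * mat_diag d l * U \<and>
        B = transpose_mat U * mat_diag d (\<lambda>i. l i powr t) * U)"

definition matrix_weight :: "nat \<Rightarrow> nat \<Rightarrow> (pt \<Rightarrow> rmat) \<Rightarrow> bool" where
  "matrix_weight n d W \<longleftrightarrow>
     (\<forall>x \<in> space (leb n). psd d (W x)) \<and>
     (\<forall>i<d. \<forall>j<d. (\<lambda>x. W x $$ (i, j)) \<in> borel_measurable (leb n)) \<and>
     (AE x in leb n. invertible_mat (W x))"

definition weight_powr :: "(pt \<Rightarrow> rmat) \<Rightarrow> real \<Rightarrow> pt \<Rightarrow> rmat" where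
  "weight_powr W t = (\<lambda>x. mat_powr (W x) t)"

definition basis :: "nat \<Rightarrow> pt set set \<Rightarrow> bool" where
  "basis n \<B> \<longleftrightarrow>
     (\<forall>B \<in> \<B>. B \<noteq> {} \<and> openin (product_topology (\<lambda>_. euclideanreal) {..<n}) B \<and>
        emeasure (leb n) B < \<infinity>)"

definition A_const :: "nat \<Rightarrow> pt set set \<Rightarrow> ereal \<Rightarrow> (pt \<Rightarrow> rmat) \<Rightarrow> ennreal" where
  "A_const n \<B> r W =
     (if r = 1 then
        (SUP B\<in>\<B>. esssup (restrict_space (leb n) B)
           (\<lambda>x. avg (leb n) B (\<lambda>y. opnorm (mat_powr (W x) (-1) * W y))))
      else if r = \<infinity> then
        (SUP B\<in>\<B>. esssup (restrict_space (leb n) B)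
           (\<lambda>x. avg (leb n) B (\<lambda>y. opnorm (W x * mat_powr (W y) (-1)))))
      else
        (SUP B\<in>\<B>. ennpow
           (avg (leb n) B (\<lambda>x. ennpow
              (avg (leb n) B (\<lambda>y. ennpow (opnorm (W x * mat_powr (W y) (-1)))
                                           (real_of_ereal (conj_exp r))))
              (real_of_ereal (r / conj_exp r))))
           (real_of_ereal (1 / r))))"

definition A_class :: "nat \<Rightarrow> nat \<Rightarrow> pt set set \<Rightarrow> ereal \<Rightarrow> (pt \<Rightarrow> rmat) set" where
  "A_class n d \<B> r = {W. matrix_weight n d W \<and> A_const n \<B> r W < \<infinity>}"


subsection \<open>Muckenhoupt bases and sublinear operators\<close>

definition vec_fun :: "nat \<Rightarrow> nat \<Rightarrow> (pt \<Rightarrow> rvec) set" where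
  "vec_fun n d = {f. (\<forall>x \<in> space (leb n). f x \<in> carrier_vec d) \<and>
     (\<forall>i<d. (\<lambda>x. f x $ i) \<in> borel_measurable (leb n))}"

definition CG_max :: "nat \<Rightarrow> pt set set \<Rightarrow> (pt \<Rightarrow> rmat) \<Rightarrow> (pt \<Rightarrow> rvec) \<Rightarrow> pt \<Rightarrow> ennreal" where
  "CG_max n \<B> W f x =
     (SUP B\<in>\<B>. avg (leb n) B (\<lambda>y. ennreal (vnorm (W x *\<^sub>v (mat_powr (W y) (-1) *\<^sub>v f y)))) *
        indicator B x)"

text \<open>\<open>K d t\<close> is the increasing function associated with the dimension \<open>d\<close> and the
  exponent \<open>t\<close>.\<close>

definition matrix_Muckenhoupt_basis ::
    "nat \<Rightarrow> pt set set \<Rightarrow> (nat \<Rightarrow> ereal \<Rightarrow> real \<Rightarrow> real) \<Rightarrow> bool" where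
  "matrix_Muckenhoupt_basis n \<B> K \<longleftrightarrow> basis n \<B> \<and>
     (\<forall>d t. 1 \<le> d \<and> 1 < t \<and> t < \<infinity> \<longrightarrow>
        mono_on {0..} (K d t) \<and> (\<forall>c\<ge>0. 0 \<le> K d t c) \<and>
        (\<forall>W \<in> A_class n d \<B> t. \<forall>f \<in> vec_fun n d.
           Lnorm (leb n) t (\<lambda>x. ennreal (vnorm (f x))) < \<infinity> \<longrightarrow>
           CG_max n \<B> W f \<in> borel_measurable (leb n) \<and>
           Lnorm (leb n) t (CG_max n \<B> W f)
             \<le> ennreal (K d t (enn2real (A_const n \<B> t W))) *
                Lnorm (leb n) t (\<lambda>x. ennreal (vnorm (f x)))))"

definition sublinear_operator ::
    "nat \<Rightarrow> nat \<Rightarrow> (pt \<Rightarrow> rvec) set \<Rightarrow> ((pt \<Rightarrow> rvec) \<Rightarrow> pt \<Rightarrow> rvec) \<Rightarrow> bool" where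
  "sublinear_operator n d D T \<longleftrightarrow>
     D \<subseteq> vec_fun n d \<and> (\<lambda>_. 0\<^sub>v d) \<in> D \<and>
     (\<forall>f\<in>D. \<forall>g\<in>D. (\<lambda>x. f x + g x) \<in> D) \<and>
     (\<forall>f\<in>D. \<forall>\<alpha>. (\<lambda>x. \<alpha> \<cdot>\<^sub>v f x) \<in> D) \<and>
     (\<forall>f\<in>D. T f \<in> vec_fun n d) \<and>
     (\<forall>f\<in>D. \<forall>g\<in>D. AE x in leb n.
        vnorm (T (\<lambda>x. f x + g x) x) \<le> vnorm (T f x) + vnorm (T g x)) \<and>
     (\<forall>f\<in>D. \<forall>\<alpha>. AE x in leb n.
        vnorm (T (\<lambda>x. \<alpha> \<cdot>\<^sub>v f x) x) = \<bar>\<alpha>\<bar> * vnorm (T f x))"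

definition wnorm :: "nat \<Rightarrow> (pt \<Rightarrow> rmat) \<Rightarrow> ereal \<Rightarrow> (pt \<Rightarrow> rvec) \<Rightarrow> ennreal" where
  "wnorm n W t f = Lnorm (leb n) t (\<lambda>x. ennreal (vnorm (W x *\<^sub>v f x)))"

end

theory Submission
  imports Defs "Jordan_Normal_Form.Schur_Decomposition"
begin

text \<open>
  Write \<open>V = W\<^sup>s\<close>, a weight in \<open>A_r\<close>. Every weight used in the argument is a scalar function
  times \<open>W\<close>. This is why the theorem reduces to Rubio de Francia's algorithm for scalar functions:
  the matrices enter only through the kernel \<open>|V(x) V(y)\<^sup>-\<^sup>1|\<close>.

  The averages over \<open>B\<close> of this kernel against a scalar \<open>h\<close> are bounded by the maximal functions of
  the vector functions \<open>h e\<^sub>i\<close>, whose \<open>L\<^sup>r\<close> norms are controlled by \<open>K\<^sub>r\<close>. Summing the iterates of this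
  operator (\<open>rubio_de_francia\<close>) gives a majorant \<open>H\<^sub>1\<close> of a given \<open>h\<^sub>1\<close>, of comparable norm, for which
  \<open>V / H\<^sub>1\<close> is in \<open>A_\<infinity>\<close> with constant about \<open>K\<^sub>r\<close>. The inverse weight is in \<open>A_r'\<close>
  (\<open>dual_weight_class\<close>), so that the same algorithm gives a majorant \<open>H\<^sub>2\<close> of a given \<open>h\<^sub>2\<close> for which
  \<open>H\<^sub>2 V\<close> is in \<open>A\<^sub>1\<close> with constant about \<open>K\<^sub>r'\<close>. With \<open>\<theta> = 1 / r\<^sub>0\<close>, the geometric mean
  \<open>H\<^sub>2\<^sup>\<theta> H\<^sub>1\<^sup>\<theta>\<^sup>-\<^sup>1 V\<close> of the two is then in the class with exponent \<open>r\<^sub>0\<close>, with the product of the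
  corresponding powers of the constants as its bound (\<open>reverse_factorization\<close>). It is the \<open>s\<close>-th power of
  \<open>W\<^sub>0 = H\<^sub>2\<^sup>\<alpha> H\<^sub>1\<^sup>-\<^sup>\<beta> W\<close>, where \<open>\<alpha> = 1 / q\<^sub>0\<close> and \<open>\<beta> = 1 / s - \<alpha>\<close>.

  Take \<open>h\<^sub>1\<close> to be \<open>|W f|\<^sup>p\<^sup>/\<^sup>r\<close>, normalized, and \<open>h\<^sub>2\<close> a function of norm one in \<open>L\<^sup>r'\<close>, against which
  \<open>|W T f|\<^sup>s\<close> is integrated. Hoelder's inequality bounds this integral by the norm of \<open>W\<^sub>0 T f\<close> in
  \<open>L\<close> with exponent \<open>q\<^sub>0\<close> (\<open>target_bound\<close>), and the norm of \<open>W\<^sub>0 f\<close> in \<open>L\<close> with exponent \<open>p\<^sub>0\<close> by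
  that of \<open>W f\<close> in \<open>L\<^sup>p\<close> (\<open>source_bound\<close>). The hypothesis for \<open>W\<^sub>0\<close> joins the two, and the
  supremum over \<open>h\<^sub>2\<close> is the norm of \<open>W T f\<close> in \<open>L\<^sup>q\<close> to the power \<open>s\<close>.

  What is not scalar is the exchange of the two averages in the constants of the classes. In
  \<open>dual_weight_class\<close> and in \<open>reverse_factorization\<close> one variable of the kernel has to be integrated
  while the other is kept. For this the norm \<open>v \<mapsto> (\<integral>\<^sub>B (H |V v|)\<^sup>a)\<^sup>1\<^sup>/\<^sup>a\<close> is replaced by \<open>|Q v|\<close> for a
  matrix \<open>Q\<close>, which costs a constant depending on \<open>d\<close> only and factors the kernel into a function of
  \<open>x\<close> times a function of \<open>y\<close> (\<open>weight_reducing_matrix\<close>). Such a \<open>Q\<close> is the inverse of a matrix with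
  columns in the unit ball and nearly maximal determinant (\<open>near_extremal_basis\<close>).
\<close>

section \<open>Real symmetric matrices and their powers\<close>

text \<open>The characteristic polynomial has a complex root. Symmetry makes the root real, so
  that the real and the imaginary part of a complex eigenvector satisfy the eigenvalue equation
  separately, and one of them is nonzero.\<close>

lemma real_symmetric_eigenvector:
  fixes A :: rmat
  assumes A: "A \<in> carrier_mat d d" and sym: "transpose_mat A = A" and d: "0 < d"
  obtains v \<mu> where "v \<in> carrier_vec d" "v \<noteq> 0\<^sub>v d" "A *\<^sub>v v = \<mu> \<cdot>\<^sub>v v"
proof -
  define Ac where "Ac = map_mat complex_of_real A"
  have Ac: "Ac \<in> carrier_mat d d" using A by (simp add: Ac_def)
  obtain as where as: "char_poly Ac = (\<Prod> a \<leftarrow> as. [:- a, 1:])" "length as = d"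
    using char_poly_factorized[OF Ac] by blast
  then obtain k where k: "poly (char_poly Ac) k = 0"
    using d by (cases as) auto
  then have "eigenvalue Ac k" using eigenvalue_root_char_poly[OF Ac] by blast
  then obtain v where v: "v \<in> carrier_vec d" "v \<noteq> 0\<^sub>v d" "Ac *\<^sub>v v = k \<cdot>\<^sub>v v"
    using Ac by (auto simp: eigenvalue_def eigenvector_def)
  define a where "a = vec d (\<lambda>i. Re (v $ i))"
  define b where "b = vec d (\<lambda>i. Im (v $ i))"
  have ab: "a \<in> carrier_vec d" "b \<in> carrier_vec d" by (auto simp: a_def b_def)
  have comp: "(\<Sum>j<d. complex_of_real (A $$ (i,j)) * v $ j) = k * v $ i" if i: "i < d" for i
  proof -
    have "(Ac *\<^sub>v v) $ i = (\<Sum>j<d. complex_of_real (A $$ (i,j)) * v $ j)"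
      using A Ac v(1) i by (auto simp: scalar_prod_def Ac_def lessThan_atLeast0 intro!: sum.cong)
    then show ?thesis using v i by simp
  qed
  have Aa: "(A *\<^sub>v a) $ i = Re k * a $ i - Im k * b $ i" if i: "i < d" for i
  proof -
    have "(A *\<^sub>v a) $ i = (\<Sum>j<d. A $$ (i,j) * Re (v $ j))"
      using A i by (simp add: scalar_prod_def a_def lessThan_atLeast0)
    also have "\<dots> = Re (k * v $ i)" by (subst comp[OF i, symmetric]) simp
    finally show ?thesis using i by (simp add: a_def b_def)
  qed
  have Ab: "(A *\<^sub>v b) $ i = Im k * a $ i + Re k * b $ i" if i: "i < d" for i
  proof -
    have "(A *\<^sub>v b) $ i = (\<Sum>j<d. A $$ (i,j) * Im (v $ j))"
      using A i by (simp add: scalar_prod_def b_def lessThan_atLeast0)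
    also have "\<dots> = Im (k * v $ i)" by (subst comp[OF i, symmetric]) simp
    finally show ?thesis using i by (simp add: a_def b_def)
  qed
  \<comment> \<open>The eigenvalue is real: \<open>b \<bullet> A a = a \<bullet> A b\<close> by symmetry.\<close>
  have "b \<bullet> (A *\<^sub>v a) = a \<bullet> (A *\<^sub>v b)"
  proof -
    have "b \<bullet> (A *\<^sub>v a) = (transpose_mat A *\<^sub>v b) \<bullet> a"
      using A ab by (metis sym transpose_vec_mult_scalar)
    also have "\<dots> = a \<bullet> (A *\<^sub>v b)" using A ab sym
      by (metis comm_scalar_prod mult_mat_vec_carrier)
    finally show ?thesis .
  qed
  then have "(\<Sum>i<d. b $ i * (Re k * a $ i - Im k * b $ i)) =
             (\<Sum>i<d. a $ i * (Im k * a $ i + Re k * b $ i))"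
    using A ab Aa Ab by (simp add: scalar_prod_def lessThan_atLeast0)
  then have "Im k * (\<Sum>i<d. (a $ i)^2 + (b $ i)^2) = 0"
    by (simp add: algebra_simps sum.distrib sum_subtractf sum_distrib_left power2_eq_square)
  moreover have "(\<Sum>i<d. (a $ i)^2 + (b $ i)^2) \<noteq> 0"
  proof
    assume "(\<Sum>i<d. (a $ i)^2 + (b $ i)^2) = 0"
    then have "\<forall>i\<in>{..<d}. (a $ i)^2 + (b $ i)^2 = 0"
      by (subst (asm) sum_nonneg_eq_0_iff) auto
    then have "v = 0\<^sub>v d" using v(1) by (auto intro!: eq_vecI simp: a_def b_def complex_eq_iff)
    then show False using v by simp
  qed
  ultimately have im: "Im k = 0" by simp
  have "A *\<^sub>v a = Re k \<cdot>\<^sub>v a" "A *\<^sub>v b = Re k \<cdot>\<^sub>v b"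
    using Aa Ab im A ab by (auto intro!: eq_vecI)
  moreover have "a \<noteq> 0\<^sub>v d \<or> b \<noteq> 0\<^sub>v d"
  proof (rule ccontr)
    assume "\<not> ?thesis"
    then have "a $ i = 0 \<and> b $ i = 0" if "i < d" for i using that by simp
    then have "v = 0\<^sub>v d" using v(1) by (auto intro!: eq_vecI simp: a_def b_def complex_eq_iff)
    then show False using v by simp
  qed
  ultimately show ?thesis using that ab by blast
qed

text \<open>Gram-Schmidt, applied to a basis that begins with \<open>v\<close>, followed by a
  normalization of the columns.\<close>

lemma orthogonal_completion:
  fixes v :: rvec
  assumes v: "v \<in> carrier_vec d" "v \<noteq> 0\<^sub>v d"
  obtains W c where "W \<in> carrier_mat d d" "transpose_mat W * W = 1\<^sub>m d" "col W 0 = c \<cdot>\<^sub>v v" "c \<noteq> 0"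
proof -
  interpret cof_vec_space d "TYPE(real)" .
  define b where "b = basis_completion v"
  define ws where "ws = gram_schmidt d b"
  note bc = basis_completion[OF v, folded b_def]
  have d: "d \<noteq> 0" using v by (metis carrier_vecD eq_vecI index_zero_vec(2) less_nat_zero_code)
  obtain vs where bv: "b = v # vs" using bc(6,7) d by (cases b) auto
  have ws: "set ws \<subseteq> carrier_vec d" "corthogonal ws" "length ws = d"
    using gram_schmidt_result[OF bc(2,4,5) refl, folded ws_def] bc(6) by auto
  have hd: "hd ws = v" using gram_schmidt_hd[OF v(1), of vs, folded bv] by (simp add: ws_def)
  have wsi: "ws ! i \<in> carrier_vec d" if "i < d" for i using ws that by (metis nth_mem subsetD)
  have orth: "(ws ! i \<bullet> ws ! j = 0) = (i \<noteq> j)" if "i < d" "j < d" for i j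
    using corthogonalD[OF ws(2), of i j] that ws(3) by simp
  define nn where "nn i = 1 / vnorm (ws ! i)" for i
  have pos: "0 < ws ! i \<bullet> ws ! i" if "i < d" for i
  proof -
    have "0 \<le> ws ! i \<bullet> ws ! i" by (auto simp: scalar_prod_def intro: sum_nonneg)
    then show ?thesis using orth[OF that that] by linarith
  qed
  define W where "W = mat d d (\<lambda>(i,j). nn j * ws ! j $ i)"
  have W: "W \<in> carrier_mat d d" by (simp add: W_def)
  have colW: "col W j = nn j \<cdot>\<^sub>v (ws ! j)" if "j < d" for j
    using that wsi[OF that] by (auto simp: W_def intro!: eq_vecI)
  have "transpose_mat W * W = 1\<^sub>m d"
  proof (rule eq_matI)
    fix i j assume "i < dim_row (1\<^sub>m d :: rmat)" "j < dim_col (1\<^sub>m d :: rmat)"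
    then have ij: "i < d" "j < d" by auto
    have "(transpose_mat W * W) $$ (i,j) = col W i \<bullet> col W j" using ij W by simp
    also have "\<dots> = nn i * nn j * (ws ! i \<bullet> ws ! j)"
      unfolding colW[OF ij(1)] colW[OF ij(2)] using wsi[OF ij(1)] wsi[OF ij(2)]
      by (simp add: smult_scalar_prod_distrib[of _ d] scalar_prod_smult_distrib[of _ d])
    also have "\<dots> = (1\<^sub>m d :: rmat) $$ (i,j)"
      using orth[OF ij] pos ij by (auto simp: abs_of_pos nn_def vnorm_def real_sqrt_mult[symmetric])
    finally show "(transpose_mat W * W) $$ (i,j) = (1\<^sub>m d :: rmat) $$ (i,j)" .
  qed (use W in auto)
  moreover have "col W 0 = nn 0 \<cdot>\<^sub>v v" using colW[of 0] d hd ws(3)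
    by (metis hd_conv_nth list.size(3) not_gr_zero)
  moreover have "nn 0 \<noteq> 0" using pos[of 0] d by (simp add: nn_def vnorm_def)
  ultimately show ?thesis using W that by blast
qed

definition diagonalizes :: "nat \<Rightarrow> rmat \<Rightarrow> (nat \<Rightarrow> real) \<Rightarrow> rmat \<Rightarrow> bool" where
  "diagonalizes d U l A \<longleftrightarrow> U \<in> carrier_mat d d \<and> transpose_mat U * U = 1\<^sub>m d \<and>
     A = transpose_mat U * mat_diag d l * U"

lemma mat_diag_carrier [simp]: "mat_diag d l \<in> carrier_mat d d"
  by (simp add: mat_diag_def)

text \<open>Induction on the dimension: an orthogonal matrix whose first column is an
  eigenvector conjugates \<open>A\<close> to a matrix whose first column, and by symmetry whose
  first row, vanishes off the diagonal.\<close>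

lemma real_spectral_theorem:
  fixes A :: rmat
  assumes "A \<in> carrier_mat d d" and "transpose_mat A = A"
  shows "\<exists>U l. diagonalizes d U l A"
  using assms
proof (induction d arbitrary: A)
  case 0
  show ?case by (rule exI[of _ "1\<^sub>m 0"], rule exI[of _ "\<lambda>_. 0"])
      (use 0 in \<open>auto simp: diagonalizes_def intro!: eq_matI\<close>)
next
  case (Suc d A)
  note A = Suc.prems(1)
  obtain v \<mu> where v: "v \<in> carrier_vec (Suc d)" "v \<noteq> 0\<^sub>v (Suc d)" "A *\<^sub>v v = \<mu> \<cdot>\<^sub>v v"
    using real_symmetric_eigenvector[OF Suc.prems] by auto
  obtain W c where W: "W \<in> carrier_mat (Suc d) (Suc d)" "transpose_mat W * W = 1\<^sub>m (Suc d)"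
    "col W 0 = c \<cdot>\<^sub>v v" "c \<noteq> 0"
    using orthogonal_completion[OF v(1,2)] by blast
  have WW: "W * transpose_mat W = 1\<^sub>m (Suc d)"
    using mat_mult_left_right_inverse[of "transpose_mat W" "Suc d" W] W by auto
  define A1 where "A1 = transpose_mat W * A * W"
  have A1: "A1 \<in> carrier_mat (Suc d) (Suc d)" using W A by (auto simp: A1_def)
  have as: "(X * Y) * Z = X * (Y * Z)" if "X \<in> carrier_mat (Suc d) (Suc d)"
    "Y \<in> carrier_mat (Suc d) (Suc d)" "Z \<in> carrier_mat (Suc d) (Suc d)" for X Y Z :: rmat
    using assoc_mult_mat[OF that] .
  have cm: "X * Y \<in> carrier_mat (Suc d) (Suc d)" "transpose_mat X \<in> carrier_mat (Suc d) (Suc d)"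
    if "X \<in> carrier_mat (Suc d) (Suc d)" "Y \<in> carrier_mat (Suc d) (Suc d)" for X Y :: rmat
    using that by auto
  have sym1: "transpose_mat A1 = A1"
    using W A Suc.prems(2) unfolding A1_def
    by (simp add: transpose_mult[of _ "Suc d" "Suc d" _ "Suc d"] assoc_mult_mat[of _ "Suc d" "Suc d" _ "Suc d" _ "Suc d"])
  have A1_0: "A1 $$ (i, 0) = (if i = 0 then \<mu> else 0)" if i: "i < Suc d" for i
  proof -
    have "A1 = transpose_mat W * (A * W)" using W A unfolding A1_def
      by (simp add: assoc_mult_mat[of _ "Suc d" "Suc d" _ "Suc d" _ "Suc d"])
    then have "A1 $$ (i, 0) = col W i \<bullet> col (A * W) 0" using i W A by simp
    also have "col (A * W) 0 = A *\<^sub>v col W 0" using col_mult2[OF A W(1), of 0] by simp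
    also have "A *\<^sub>v col W 0 = \<mu> \<cdot>\<^sub>v col W 0"
      using v A unfolding W(3) by (simp add: mult_mat_vec[OF A] smult_smult_assoc mult.commute)
    also have "col W i \<bullet> (\<mu> \<cdot>\<^sub>v col W 0) = \<mu> * (transpose_mat W * W) $$ (i, 0)"
      using i W(1) by simp
    also have "\<dots> = (if i = 0 then \<mu> else 0)" unfolding W(2) using i by simp
    finally show ?thesis .
  qed
  have A1_0': "A1 $$ (0, i) = (if i = 0 then \<mu> else 0)" if i: "i < Suc d" for i
    using A1_0[OF i] arg_cong[OF sym1, of "\<lambda>M. M $$ (0,i)"] i A1 by auto
  define A3 where "A3 = mat d d (\<lambda>(i,j). A1 $$ (Suc i, Suc j))"
  have A3: "A3 \<in> carrier_mat d d" by (simp add: A3_def)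
  have "transpose_mat A3 = A3"
  proof (rule eq_matI)
    fix i j assume "i < dim_row A3" "j < dim_col A3"
    then show "transpose_mat A3 $$ (i,j) = A3 $$ (i,j)"
      using arg_cong[OF sym1, of "\<lambda>M. M $$ (Suc i,Suc j)"] A1 by (auto simp: A3_def)
  qed (auto simp: A3_def)
  then obtain U3 l3 where "diagonalizes d U3 l3 A3" using Suc.IH[OF A3] by blast
  then have U3: "U3 \<in> carrier_mat d d" "transpose_mat U3 * U3 = 1\<^sub>m d"
    "A3 = transpose_mat U3 * mat_diag d l3 * U3" by (auto simp: diagonalizes_def)
  define l where "l i = (case i of 0 \<Rightarrow> \<mu> | Suc j \<Rightarrow> l3 j)" for i
  let ?b = "\<lambda>x Y. four_block_mat (x \<cdot>\<^sub>m 1\<^sub>m 1) (0\<^sub>m 1 d) (0\<^sub>m d 1) (Y :: rmat)"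
  have bt: "transpose_mat (?b x Y) = ?b x (transpose_mat Y)" if "Y \<in> carrier_mat d d" for x Y
    using that by (subst transpose_four_block_mat[of _ 1 1 _ d _ d]) (auto intro!: eq_matI)
  have bm: "?b x Y * ?b y Z = ?b (x*y) (Y * Z)" if "Y \<in> carrier_mat d d" "Z \<in> carrier_mat d d" for x y Y Z
    using that by (subst mult_four_block_mat[of _ 1 1 _ d _ d _ _ 1 _ d])
      (auto intro!: arg_cong2[where f="\<lambda>P Q. four_block_mat P _ _ Q"] eq_matI)
  have A1b: "A1 = ?b \<mu> A3"
  proof (rule eq_matI)
    fix i j assume "i < dim_row (?b \<mu> A3)" "j < dim_col (?b \<mu> A3)"
    then have ij: "i < Suc d" "j < Suc d" using A3 by auto
    then show "A1 $$ (i,j) = ?b \<mu> A3 $$ (i,j)"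
      using A1_0[OF ij(1)] A1_0'[OF ij(2)] A3 by (cases i; cases j) (auto simp: A3_def)
  qed (use A1 A3 in auto)
  have lb: "mat_diag (Suc d) l = ?b \<mu> (mat_diag d l3)"
  proof (rule eq_matI)
    fix i j assume "i < dim_row (?b \<mu> (mat_diag d l3))" "j < dim_col (?b \<mu> (mat_diag d l3))"
    then have ij: "i < Suc d" "j < Suc d" by (auto simp: mat_diag_def)
    then show "mat_diag (Suc d) l $$ (i,j) = ?b \<mu> (mat_diag d l3) $$ (i,j)"
      by (cases i; cases j) (auto simp: mat_diag_def l_def)
  qed (auto simp: mat_diag_def)
  define U where "U = ?b 1 U3 * transpose_mat W"
  have b1: "?b 1 U3 \<in> carrier_mat (Suc d) (Suc d)" "?b 1 (transpose_mat U3) \<in> carrier_mat (Suc d) (Suc d)"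
    using U3(1) by auto
  have Ut: "transpose_mat U = W * ?b 1 (transpose_mat U3)"
    unfolding U_def transpose_mult[OF b1(1) transpose_carrier_mat[THEN iffD2, OF W(1)]] bt[OF U3(1)] by simp
  have U: "U \<in> carrier_mat (Suc d) (Suc d)" using b1 W(1) by (auto simp: U_def)
  have b1I: "?b 1 (1\<^sub>m d) = 1\<^sub>m (Suc d)"
  proof -
    have "1 \<cdot>\<^sub>m 1\<^sub>m 1 = (1\<^sub>m 1 :: rmat)" by (rule eq_matI) auto
    then show ?thesis using four_block_one_mat[of 1 d] by simp
  qed
  have UU: "transpose_mat U * U = 1\<^sub>m (Suc d)"
  proof -
    have "transpose_mat U * U = W * (?b 1 (transpose_mat U3) * ?b 1 U3) * transpose_mat W"
      unfolding Ut unfolding U_def using W(1) b1 by (simp add: as cm)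
    also have "\<dots> = W * transpose_mat W"
      unfolding bm[OF transpose_carrier_mat[THEN iffD2, OF U3(1)] U3(1)] U3(2) mult_1_left b1I
      using W(1) by simp
    finally show ?thesis using WW by simp
  qed
  have "transpose_mat U * mat_diag (Suc d) l * U
      = W * (?b 1 (transpose_mat U3) * ?b \<mu> (mat_diag d l3) * ?b 1 U3) * transpose_mat W"
    unfolding lb Ut unfolding U_def using W(1) b1
    by (simp add: as cm four_block_carrier_mat[of _ 1 1 _ d d, simplified])
  also have "\<dots> = W * A1 * transpose_mat W"
    unfolding A1b U3(3) bm[OF transpose_carrier_mat[THEN iffD2, OF U3(1)] mat_diag_carrier]
      bm[OF mult_carrier_mat[OF transpose_carrier_mat[THEN iffD2, OF U3(1)] mat_diag_carrier] U3(1)]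
    by simp
  also have "\<dots> = (W * transpose_mat W) * A * (W * transpose_mat W)"
    unfolding A1_def using W(1) A by (simp add: as cm)
  also have "\<dots> = A" using WW A by simp
  finally show ?case unfolding diagonalizes_def using U UU by metis
qed


lemma diagonalizes_orthogonal:
  assumes "diagonalizes d U l A"
  shows "U \<in> carrier_mat d d" "transpose_mat U * U = 1\<^sub>m d" "U * transpose_mat U = 1\<^sub>m d"
    "A \<in> carrier_mat d d" "A = transpose_mat U * mat_diag d l * U"
proof -
  show *: "U \<in> carrier_mat d d" "transpose_mat U * U = 1\<^sub>m d"
    "A = transpose_mat U * mat_diag d l * U"
    using assms by (auto simp: diagonalizes_def)
  show "U * transpose_mat U = 1\<^sub>m d"
    using mat_mult_left_right_inverse[of "transpose_mat U" d U] * by auto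
  show "A \<in> carrier_mat d d" using * by auto
qed

lemma diag_conj_mult:
  fixes U :: rmat
  assumes "U \<in> carrier_mat d d" and "U * transpose_mat U = 1\<^sub>m d"
  shows "(transpose_mat U * mat_diag d l * U) * (transpose_mat U * mat_diag d m * U)
    = transpose_mat U * mat_diag d (\<lambda>i. l i * m i) * U"
proof -
  have as: "(X * Y) * Z = X * (Y * Z)" if "X \<in> carrier_mat d d"
    "Y \<in> carrier_mat d d" "Z \<in> carrier_mat d d" for X Y Z :: rmat
    using assoc_mult_mat[OF that] .
  have cm: "X * Y \<in> carrier_mat d d" "transpose_mat X \<in> carrier_mat d d"
    if "X \<in> carrier_mat d d" "Y \<in> carrier_mat d d" for X Y :: rmat
    using that by auto
  have "(transpose_mat U * mat_diag d l * U) * (transpose_mat U * mat_diag d m * U)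
    = transpose_mat U * (mat_diag d l * (U * transpose_mat U) * mat_diag d m) * U"
    using assms(1) by (simp add: as cm)
  also have "mat_diag d l * (U * transpose_mat U) * mat_diag d m = mat_diag d (\<lambda>i. l i * m i)"
    unfolding assms(2) by (simp add: right_mult_one_mat[of _ d d])
  finally show ?thesis .
qed

lemma diag_conj_cong:
  fixes U :: rmat
  shows
  "(\<And>i. i < d \<Longrightarrow> l i = m i) \<Longrightarrow> transpose_mat U * mat_diag d l * U = transpose_mat U * mat_diag d m * U"
proof -
  assume "\<And>i. i < d \<Longrightarrow> l i = m i"
  then have "mat_diag d l = mat_diag d m" by (auto simp: mat_diag_def intro!: eq_matI)
  then show ?thesis by simp
qed

text \<open>The functional calculus is well defined: two diagonalizations are intertwined by an
  orthogonal matrix whose nonzero entries link equal eigenvalues only.\<close>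

lemma mat_powr_diagonalizes:
  assumes "diagonalizes d U l A"
  shows "mat_powr A t = transpose_mat U * mat_diag d (\<lambda>i. l i powr t) * U"
proof -
  note U = diagonalizes_orthogonal[OF assms]
  have as: "(X * Y) * Z = X * (Y * Z)" if "X \<in> carrier_mat d d"
    "Y \<in> carrier_mat d d" "Z \<in> carrier_mat d d" for X Y Z :: rmat
    using assoc_mult_mat[OF that] .
  have cm: "X * Y \<in> carrier_mat d d" "transpose_mat X \<in> carrier_mat d d"
    if "X \<in> carrier_mat d d" "Y \<in> carrier_mat d d" for X Y :: rmat
    using that by auto
  have uniq: "transpose_mat U' * mat_diag d (\<lambda>i. l' i powr t) * U' = transpose_mat U * mat_diag d (\<lambda>i. l i powr t) * U"
    if "diagonalizes d U' l' A" for U' l'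
  proof -
    note U' = diagonalizes_orthogonal[OF that]
    define Q where "Q = U' * transpose_mat U"
    have Q: "Q \<in> carrier_mat d d" using U U' by (simp add: Q_def)
    have "Q * mat_diag d l = U' * A * transpose_mat U"
    proof -
      have "U' * A * transpose_mat U = Q * (mat_diag d l * (U * transpose_mat U))"
        unfolding U(5) Q_def using U(1) U'(1) by (simp add: as cm)
      then show ?thesis using U(3) by (simp add: right_mult_one_mat[of _ d d])
    qed
    also have "\<dots> = mat_diag d l' * Q"
    proof -
      have "U' * A * transpose_mat U = (U' * transpose_mat U') * (mat_diag d l' * Q)"
        unfolding U'(5) Q_def using U(1) U'(1) by (simp add: as cm)
      then show ?thesis using U'(3) cm[OF mat_diag_carrier[of d l'] Q] by (simp add: left_mult_one_mat[of _ d d])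
    qed
    finally have comm: "Q * mat_diag d l = mat_diag d l' * Q" .
    \<comment> \<open>A nonzero entry links equal eigenvalues only, hence also equal powers of
      them.\<close>
    have ent: "Q $$ (i,j) * l j = l' i * Q $$ (i,j)" if "i < d" "j < d" for i j
      using arg_cong[OF comm, of "\<lambda>M. M $$ (i,j)"] that Q
      by (simp add: mat_diag_mult_left[OF Q] mat_diag_mult_right[OF Q])
    have comm': "Q * mat_diag d (\<lambda>i. l i powr t) = mat_diag d (\<lambda>i. l' i powr t) * Q"
      unfolding mat_diag_mult_left[OF Q] mat_diag_mult_right[OF Q]
    proof (rule eq_matI)
      fix i j assume "i < dim_row (mat d d (\<lambda>(i, j). l' i powr t * Q $$ (i, j)))"
        "j < dim_col (mat d d (\<lambda>(i, j). l' i powr t * Q $$ (i, j)))"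
      then have ij: "i < d" "j < d" by auto
      then show "mat d d (\<lambda>(i, j). Q $$ (i, j) * l j powr t) $$ (i, j) =
        mat d d (\<lambda>(i, j). l' i powr t * Q $$ (i, j)) $$ (i, j)"
        using ent[OF ij] by (cases "Q $$ (i,j) = 0") auto
    qed auto
    have "transpose_mat U' * mat_diag d (\<lambda>i. l' i powr t) * U' * (transpose_mat U * U)
      = transpose_mat U' * (mat_diag d (\<lambda>i. l' i powr t) * Q) * U"
      unfolding Q_def using U(1) U'(1) by (simp add: as cm)
    also have "\<dots> = (transpose_mat U' * U') * (transpose_mat U * mat_diag d (\<lambda>i. l i powr t) * U)"
      unfolding comm'[symmetric] unfolding Q_def using U(1) U'(1) by (simp add: as cm)
    finally show ?thesis unfolding U(2) U'(2) using U(1) U'(1)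
      by (simp add: right_mult_one_mat[of _ d d] left_mult_one_mat[of _ d d])
  qed
  have dim: "dim_row A = d" using U(4) by simp
  show ?thesis unfolding mat_powr_def Let_def dim
  proof (rule the_equality)
    show "\<exists>U' l'. U' \<in> carrier_mat d d \<and> transpose_mat U' * U' = 1\<^sub>m d \<and>
      A = transpose_mat U' * mat_diag d l' * U' \<and>
      transpose_mat U * mat_diag d (\<lambda>i. l i powr t) * U = transpose_mat U' * mat_diag d (\<lambda>i. l' i powr t) * U'"
      using U by blast
  next
    fix B assume "\<exists>U' l'. U' \<in> carrier_mat d d \<and> transpose_mat U' * U' = 1\<^sub>m d \<and>
      A = transpose_mat U' * mat_diag d l' * U' \<and> B = transpose_mat U' * mat_diag d (\<lambda>i. l' i powr t) * U'"
    then show "B = transpose_mat U * mat_diag d (\<lambda>i. l i powr t) * U"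
      using uniq by (auto simp: diagonalizes_def)
  qed
qed

lemma diag_conj_form:
  fixes U :: rmat
  assumes U: "U \<in> carrier_mat d d" and v: "v \<in> carrier_vec d"
  shows "v \<bullet> ((transpose_mat U * mat_diag d l * U) *\<^sub>v v) = (\<Sum>i<d. l i * ((U *\<^sub>v v) $ i)^2)"
proof -
  have Uv: "U *\<^sub>v v \<in> carrier_vec d" using U v by simp
  have D: "mat_diag d l *\<^sub>v (U *\<^sub>v v) \<in> carrier_vec d" using Uv by (simp add: mult_mat_vec_carrier[of _ d d])
  have ent: "((mat_diag d l :: rmat) *\<^sub>v w) $ i = l i * w $ i" if w: "w \<in> carrier_vec d" and i: "i < d" for w :: rvec and i
  proof -
    have "(mat_diag d l *\<^sub>v w) $ i = (\<Sum>j<d. (if i = j then l j else 0) * w $ j)"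
      using w i by (auto simp: mat_diag_def scalar_prod_def lessThan_atLeast0 intro!: sum.cong)
    also have "\<dots> = (\<Sum>j<d. if i = j then l j * w $ j else 0)" by (intro sum.cong) auto
    finally show ?thesis using i by simp
  qed
  have "(transpose_mat U * mat_diag d l * U) *\<^sub>v v = transpose_mat U *\<^sub>v (mat_diag d l *\<^sub>v (U *\<^sub>v v))"
    using U v Uv by (simp add: assoc_mult_mat_vec[of _ d d _ d])
  then have "v \<bullet> ((transpose_mat U * mat_diag d l * U) *\<^sub>v v) = (transpose_mat U *\<^sub>v (mat_diag d l *\<^sub>v (U *\<^sub>v v))) \<bullet> v"
    using comm_scalar_prod[OF v mult_mat_vec_carrier[OF transpose_carrier_mat[THEN iffD2, OF U] D]] by simp
  also have "\<dots> = (mat_diag d l *\<^sub>v (U *\<^sub>v v)) \<bullet> (U *\<^sub>v v)"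
    using transpose_vec_mult_scalar[OF U v D] .
  also have "\<dots> = (\<Sum>i<d. l i * ((U *\<^sub>v v) $ i)^2)"
    using U Uv ent[OF Uv] by (simp add: scalar_prod_def lessThan_atLeast0 power2_eq_square mult.assoc del: index_mult_mat_vec)
  finally show ?thesis .
qed

text \<open>An eigenvalue is the value of the quadratic form at the corresponding row of
  \<open>U\<close>.\<close>

lemma psd_diagonalizes:
  assumes "psd d A"
  obtains U l where "diagonalizes d U l A" "\<And>i. i < d \<Longrightarrow> 0 \<le> l i"
proof -
  have A: "A \<in> carrier_mat d d" "transpose_mat A = A"
    "\<And>v. v \<in> carrier_vec d \<Longrightarrow> 0 \<le> v \<bullet> (A *\<^sub>v v)" using assms by (auto simp: psd_def)
  obtain U l where dl: "diagonalizes d U l A" using real_spectral_theorem[OF A(1,2)] by blast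
  note U = diagonalizes_orthogonal[OF dl]
  have "0 \<le> l i" if i: "i < d" for i
  proof -
    define v where "v = transpose_mat U *\<^sub>v unit_vec d i"
    have v: "v \<in> carrier_vec d" using U(1) by (simp add: v_def)
    have "U *\<^sub>v v = unit_vec d i" unfolding v_def using U(1,3)
      by (simp add: assoc_mult_mat_vec[of _ d d _ d, symmetric])
    then have "v \<bullet> (A *\<^sub>v v) = (\<Sum>j<d. if j = i then l j else 0)"
      unfolding U(5) diag_conj_form[OF U(1) v] using i by (intro sum.cong) (auto simp: unit_vec_def)
    then show ?thesis using A(3)[OF v] i by simp
  qed
  then show ?thesis using that dl by blast
qed

lemma psd_diag_conj:
  fixes U :: rmat
  assumes U: "U \<in> carrier_mat d d" and l: "\<And>i. i < d \<Longrightarrow> 0 \<le> l i"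
  shows "psd d (transpose_mat U * mat_diag d l * U)"
proof -
  have as: "(X * Y) * Z = X * (Y * Z)" if "X \<in> carrier_mat d d"
    "Y \<in> carrier_mat d d" "Z \<in> carrier_mat d d" for X Y Z :: rmat
    using assoc_mult_mat[OF that] .
  have cm: "X * Y \<in> carrier_mat d d" "transpose_mat X \<in> carrier_mat d d"
    if "X \<in> carrier_mat d d" "Y \<in> carrier_mat d d" for X Y :: rmat
    using that by auto
  have t: "transpose_mat (mat_diag d l) = mat_diag d l"
    by (rule eq_matI) (auto simp: mat_diag_def)
  have "transpose_mat (transpose_mat U * mat_diag d l * U) = transpose_mat U * mat_diag d l * U"
    using U by (simp add: t transpose_mult[of _ d d _ d] as cm)
  then show ?thesis unfolding psd_def using U l diag_conj_form[OF U]
    by (auto intro!: sum_nonneg simp del: assoc_mult_mat_vec)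
qed

lemma psd_mat_powr:
  assumes "psd d A" shows "psd d (mat_powr A t)"
proof -
  obtain U l where U: "diagonalizes d U l A" using psd_diagonalizes[OF assms] by blast
  show ?thesis unfolding mat_powr_diagonalizes[OF U]
    by (rule psd_diag_conj[OF diagonalizes_orthogonal(1)[OF U]]) simp
qed

lemma mat_powr_carrier: "psd d A \<Longrightarrow> mat_powr A t \<in> carrier_mat d d"
  using psd_mat_powr by (auto simp: psd_def)

lemma mat_powr_mat_powr:
  assumes "psd d A" shows "mat_powr (mat_powr A s) t = mat_powr A (s * t)"
proof -
  obtain U l where U: "diagonalizes d U l A" using psd_diagonalizes[OF assms] by blast
  then have "diagonalizes d U (\<lambda>i. l i powr s) (mat_powr A s)"
    using mat_powr_diagonalizes[OF U] by (simp add: diagonalizes_def)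
  from mat_powr_diagonalizes[OF this] show ?thesis
    using mat_powr_diagonalizes[OF U] by (simp add: powr_powr)
qed

lemma smult_diag_conj:
  fixes U :: rmat
  assumes "U \<in> carrier_mat d d"
  shows "c \<cdot>\<^sub>m (transpose_mat U * mat_diag d l * U) = transpose_mat U * mat_diag d (\<lambda>i. c * l i) * U"
proof -
  have "mat_diag d (\<lambda>i. c * l i) = c \<cdot>\<^sub>m mat_diag d l" by (rule eq_matI) (auto simp: mat_diag_def)
  moreover have "transpose_mat U * (c \<cdot>\<^sub>m mat_diag d l) * U = c \<cdot>\<^sub>m (transpose_mat U * mat_diag d l * U)"
    using assms by (simp add: mult_smult_distrib[of _ d d _ d] mult_smult_assoc_mat[of _ d d _ d])
  ultimately show ?thesis by simp
qed

lemma mat_powr_smult: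
  assumes "psd d A" and "0 \<le> c" shows "mat_powr (c \<cdot>\<^sub>m A) t = c powr t \<cdot>\<^sub>m mat_powr A t"
proof -
  obtain U l where U: "diagonalizes d U l A" "\<And>i. i < d \<Longrightarrow> 0 \<le> l i"
    using psd_diagonalizes[OF assms(1)] by blast
  note o = diagonalizes_orthogonal[OF U(1)]
  have "diagonalizes d U (\<lambda>i. c * l i) (c \<cdot>\<^sub>m A)"
    using o smult_diag_conj[OF o(1)] by (simp add: diagonalizes_def)
  from mat_powr_diagonalizes[OF this]
  have "mat_powr (c \<cdot>\<^sub>m A) t = transpose_mat U * mat_diag d (\<lambda>i. (c * l i) powr t) * U" .
  also have "\<dots> = transpose_mat U * mat_diag d (\<lambda>i. c powr t * l i powr t) * U"
    using U(2) assms(2) by (intro diag_conj_cong) (simp add: powr_mult)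
  finally show ?thesis using mat_powr_diagonalizes[OF U(1)] smult_diag_conj[OF o(1)] by simp
qed

lemma psd_smult:
  assumes "psd d A" "0 \<le> c" shows "psd d (c \<cdot>\<^sub>m A)"
proof -
  have A: "A \<in> carrier_mat d d" "transpose_mat A = A" using assms by (auto simp: psd_def)
  have "v \<bullet> (c \<cdot>\<^sub>m A *\<^sub>v v) = c * (v \<bullet> (A *\<^sub>v v))" if "v \<in> carrier_vec d" for v
  proof -
    have "(c \<cdot>\<^sub>m A) *\<^sub>v v = c \<cdot>\<^sub>v (A *\<^sub>v v)" using A that by (intro eq_vecI) auto
    then show ?thesis using A that by simp
  qed
  moreover have "transpose_mat (c \<cdot>\<^sub>m A) = c \<cdot>\<^sub>m A"
    using A(1) arg_cong[OF A(2), of "\<lambda>M. c \<cdot>\<^sub>m M"] by (auto intro!: eq_matI) (metis A(2) carrier_matD index_transpose_mat(1))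
  ultimately show ?thesis using assms by (auto simp: psd_def)
qed

text \<open>Invertibility excludes the eigenvalue 0, the only one at which \<open>powr\<close>
  with a negative exponent does not invert.\<close>

lemma psd_invertible_inverse:
  assumes "psd d A" and "invertible_mat A"
  shows "A * mat_powr A (-1) = 1\<^sub>m d" "mat_powr A (-1) * A = 1\<^sub>m d"
    "invertible_mat (mat_powr A t)"
proof -
  obtain U l where U: "diagonalizes d U l A" "\<And>i. i < d \<Longrightarrow> 0 \<le> l i"
    using psd_diagonalizes[OF assms(1)] by blast
  note o = diagonalizes_orthogonal[OF U(1)]
  obtain B where B: "inverts_mat A B" "inverts_mat B A"
    using assms(2) by (auto simp: invertible_mat_def)
  have Bd: "B \<in> carrier_mat d d" using B o(4)
    by (metis carrier_matD carrier_matI index_mult_mat(2,3) index_one_mat(2,3) inverts_mat_def)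
  have as: "(X * Y) * Z = X * (Y * Z)" if "X \<in> carrier_mat d d"
    "Y \<in> carrier_mat d d" "Z \<in> carrier_mat d d" for X Y Z :: rmat
    using assoc_mult_mat[OF that] .
  have cm: "X * Y \<in> carrier_mat d d" "transpose_mat X \<in> carrier_mat d d"
    if "X \<in> carrier_mat d d" "Y \<in> carrier_mat d d" for X Y :: rmat
    using that by auto
  have nz: "l i \<noteq> 0" if i: "i < d" for i
  proof
    assume l0: "l i = 0"
    have "1\<^sub>m d = U * (B * A) * transpose_mat U"
      using B(2) Bd o by (simp add: inverts_mat_def)
    also have "\<dots> = (U * B * transpose_mat U) * (mat_diag d l * (U * transpose_mat U))"
      unfolding o(5) using o(1) Bd by (simp add: as cm)
    also have "\<dots> = (U * B * transpose_mat U) * mat_diag d l"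
      using o(3) by (simp add: right_mult_one_mat[of _ d d])
    finally have "1\<^sub>m d = mat d d (\<lambda>(p,q). (U * B * transpose_mat U) $$ (p,q) * l q)"
      using o(1) Bd by (subst (asm) mat_diag_mult_right[of _ d d]) auto
    from arg_cong[OF this, of "\<lambda>M. M $$ (i,i)"] i l0 show False by simp
  qed
  have one: "transpose_mat U * mat_diag d (\<lambda>i. 1) * U = 1\<^sub>m d"
    using o by (simp add: mat_diag_one)
  note mm = diag_conj_mult[OF o(1,3)]
  have lp: "l i powr t * l i powr (-t) = 1" if "i < d" for i t
    using nz[OF that] by (simp add: powr_minus)
  have l1: "l i * l i powr (-1) = 1" if "i < d" for i
    using nz[OF that] U(2)[OF that] by (simp add: powr_minus)
  have *: "mat_powr A t * mat_powr A (-t) = 1\<^sub>m d" for t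
    unfolding mat_powr_diagonalizes[OF U(1)] mm
    unfolding one[symmetric] using lp by (intro diag_conj_cong)
  show "A * mat_powr A (-1) = 1\<^sub>m d" "mat_powr A (-1) * A = 1\<^sub>m d"
    unfolding mat_powr_diagonalizes[OF U(1)] unfolding o(5)
    unfolding mm unfolding one[symmetric] by (intro diag_conj_cong; use l1 in \<open>simp add: mult.commute\<close>)+
  have c: "dim_row (mat_powr A t) = d" "dim_col (mat_powr A t) = d" for t
    using mat_powr_carrier[OF assms(1), of t] by auto
  have "inverts_mat (mat_powr A t) (mat_powr A (-t))" "inverts_mat (mat_powr A (-t)) (mat_powr A t)"
    using *[of t] *[of "-t"] c by (simp_all add: inverts_mat_def)
  then show "invertible_mat (mat_powr A t)" unfolding invertible_mat_def using c by auto
qed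

section \<open>The entry norm and the operator norm\<close>

definition l1norm :: "rvec \<Rightarrow> real" where
  "l1norm v = (\<Sum>i<dim_vec v. \<bar>v $ i\<bar>)"

text \<open>A substitute for the operator norm, with which it agrees up to the factor
  \<open>d\<^sup>2\<close>: it is submultiplicative and invariant under transposition, and its
  measurability is evident.\<close>

definition entry_norm :: "rmat \<Rightarrow> real" where
  "entry_norm A = (\<Sum>j<dim_col A. \<Sum>i<dim_row A. \<bar>A $$ (i,j)\<bar>)"

lemma l1norm_nonneg [simp]: "0 \<le> l1norm v"
  by (simp add: l1norm_def sum_nonneg)

lemma entry_norm_nonneg [simp]: "0 \<le> entry_norm A"
  by (simp add: entry_norm_def sum_nonneg)

lemma entry_norm_cols: "entry_norm A = (\<Sum>j<dim_col A. l1norm (col A j))"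
  by (simp add: entry_norm_def l1norm_def)

lemma vnorm_nonneg [simp]: "0 \<le> vnorm v"
  by (simp add: vnorm_def scalar_prod_def sum_nonneg)

lemma vnorm_eq: "vnorm v = sqrt (\<Sum>i<dim_vec v. (v $ i)^2)"
  by (simp add: vnorm_def scalar_prod_def lessThan_atLeast0 power2_eq_square)

lemma vnorm_le_l1norm: "vnorm v \<le> l1norm v"
proof -
  have "(\<Sum>i<k. (v $ i)^2) \<le> (\<Sum>i<k. \<bar>v $ i\<bar>)^2" for k
  proof (induction k)
    case (Suc k)
    have "0 \<le> (\<Sum>i<k. \<bar>v $ i\<bar>) * \<bar>v $ k\<bar>" by (simp add: sum_nonneg)
    then have "0 \<le> 2 * (\<Sum>i<k. \<bar>v $ i\<bar>) * \<bar>v $ k\<bar>" by linarith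
    moreover have "(\<Sum>i<Suc k. \<bar>v $ i\<bar>)^2 = (\<Sum>i<k. \<bar>v $ i\<bar>)^2 + 2 * (\<Sum>i<k. \<bar>v $ i\<bar>) * \<bar>v $ k\<bar> + (v $ k)^2"
      by (simp add: power2_sum)
    moreover have "(\<Sum>i<Suc k. (v $ i)^2) = (\<Sum>i<k. (v $ i)^2) + (v $ k)^2" by simp
    ultimately show ?case using Suc by linarith
  qed simp
  then show ?thesis unfolding vnorm_eq l1norm_def
    by (intro real_le_lsqrt) (auto simp: sum_nonneg)
qed

lemma abs_entry_le_vnorm: "i < dim_vec v \<Longrightarrow> \<bar>v $ i\<bar> \<le> vnorm v"
  unfolding vnorm_eq
  by (rule real_le_rsqrt) (auto intro!: member_le_sum)

lemma l1norm_le_vnorm: "l1norm v \<le> dim_vec v * vnorm v"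
  unfolding l1norm_def using sum_bounded_above[of "{..<dim_vec v}" "\<lambda>i. \<bar>v $ i\<bar>" "vnorm v"]
  by (simp add: abs_entry_le_vnorm)

lemma entry_le_l1norm: "i < dim_vec v \<Longrightarrow> \<bar>v $ i\<bar> \<le> l1norm v"
  using abs_entry_le_vnorm vnorm_le_l1norm order_trans by blast

lemma mult_mat_vec_entry:
  assumes "A \<in> carrier_mat m d" "v \<in> carrier_vec d" "i < m"
  shows "(A *\<^sub>v v) $ i = (\<Sum>j<d. A $$ (i,j) * v $ j)"
  using assms by (auto simp: scalar_prod_def lessThan_atLeast0 intro!: sum.cong)

lemma l1norm_mult_le:
  assumes "A \<in> carrier_mat m d" "v \<in> carrier_vec d"
  shows "l1norm (A *\<^sub>v v) \<le> (\<Sum>j<d. l1norm (col A j) * \<bar>v $ j\<bar>)"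
proof -
  have "dim_vec (A *\<^sub>v v) = m" using assms by simp
  then have "l1norm (A *\<^sub>v v) = (\<Sum>i<m. \<bar>\<Sum>j<d. A $$ (i,j) * v $ j\<bar>)"
    unfolding l1norm_def by (simp add: mult_mat_vec_entry[OF assms] del: index_mult_mat_vec)
  also have "\<dots> \<le> (\<Sum>i<m. \<Sum>j<d. \<bar>A $$ (i,j)\<bar> * \<bar>v $ j\<bar>)"
    by (intro sum_mono order_trans[OF sum_abs]) (simp add: abs_mult)
  also have "\<dots> = (\<Sum>j<d. \<Sum>i<m. \<bar>A $$ (i,j)\<bar> * \<bar>v $ j\<bar>)" by (rule sum.swap)
  also have "\<dots> = (\<Sum>j<d. l1norm (col A j) * \<bar>v $ j\<bar>)"
    using assms by (auto simp: l1norm_def sum_distrib_right intro!: sum.cong)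
  finally show ?thesis .
qed

lemma l1norm_mult:
  assumes "A \<in> carrier_mat m d" "v \<in> carrier_vec d"
  shows "l1norm (A *\<^sub>v v) \<le> entry_norm A * l1norm v"
proof -
  have "l1norm (A *\<^sub>v v) \<le> (\<Sum>j<d. l1norm (col A j) * \<bar>v $ j\<bar>)" by (rule l1norm_mult_le[OF assms])
  also have "\<dots> \<le> (\<Sum>j<d. l1norm (col A j) * l1norm v)"
    using assms by (intro sum_mono mult_left_mono entry_le_l1norm) auto
  finally show ?thesis using assms by (simp add: entry_norm_cols sum_distrib_right)
qed

lemma entry_norm_mult:
  assumes "A \<in> carrier_mat l m" "B \<in> carrier_mat m d"
  shows "entry_norm (A * B) \<le> entry_norm A * entry_norm B"
proof -
  have "entry_norm (A * B) = (\<Sum>j<d. l1norm (A *\<^sub>v col B j))"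
    using assms by (auto simp: entry_norm_cols col_mult2[OF assms] intro!: sum.cong)
  also have "\<dots> \<le> (\<Sum>j<d. entry_norm A * l1norm (col B j))"
    using assms by (intro sum_mono l1norm_mult) auto
  finally show ?thesis using assms by (simp add: entry_norm_cols[of B] sum_distrib_left)
qed

lemma entry_norm_transpose [simp]: "entry_norm (transpose_mat A) = entry_norm A"
proof -
  have "entry_norm (transpose_mat A) = (\<Sum>j<dim_row A. \<Sum>i<dim_col A. \<bar>A $$ (j,i)\<bar>)"
    unfolding entry_norm_def by (auto intro!: sum.cong)
  then show ?thesis unfolding entry_norm_def by (subst sum.swap)
qed

lemma entry_norm_smult [simp]: "entry_norm (c \<cdot>\<^sub>m A) = \<bar>c\<bar> * entry_norm A"
  by (simp add: entry_norm_def sum_distrib_left abs_mult)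

lemma l1norm_smult [simp]: "l1norm (c \<cdot>\<^sub>v v) = \<bar>c\<bar> * l1norm v"
  by (simp add: l1norm_def sum_distrib_left abs_mult)

lemma vnorm_smult [simp]: "vnorm (c \<cdot>\<^sub>v v) = \<bar>c\<bar> * vnorm v"
  unfolding vnorm_eq by (simp add: power_mult_distrib sum_distrib_left[symmetric] real_sqrt_mult)

lemma opnorm_le_entry_norm: "opnorm A \<le> ennreal (entry_norm A)"
  unfolding opnorm_def
proof (rule SUP_least)
  fix v assume "v \<in> {v \<in> carrier_vec (dim_col A). vnorm v = 1}"
  then have v: "v \<in> carrier_vec (dim_col A)" "vnorm v = 1" by auto
  have "vnorm (A *\<^sub>v v) \<le> (\<Sum>j<dim_col A. l1norm (col A j) * \<bar>v $ j\<bar>)"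
    using vnorm_le_l1norm l1norm_mult_le[OF carrier_matI[OF refl refl] v(1)] order_trans by blast
  also have "\<dots> \<le> (\<Sum>j<dim_col A. l1norm (col A j) * 1)"
    using v abs_entry_le_vnorm[of _ v] by (intro sum_mono mult_left_mono) auto
  finally show "ennreal (vnorm (A *\<^sub>v v)) \<le> ennreal (entry_norm A)"
    by (intro ennreal_leI) (simp add: entry_norm_cols)
qed

lemma vnorm_col_le_opnorm:
  assumes "A \<in> carrier_mat m d" "j < d"
  shows "ennreal (vnorm (col A j)) \<le> opnorm A"
proof -
  have "vnorm (unit_vec d j) = 1" using assms(2)
    by (simp add: vnorm_def)
  moreover have "A *\<^sub>v unit_vec d j = col A j" using assms by (intro eq_vecI) (auto simp: scalar_prod_right_unit)
  ultimately show ?thesis unfolding opnorm_def using assms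
    by (intro SUP_upper2[of "unit_vec d j"]) auto
qed

lemma entry_norm_le_opnorm:
  assumes "A \<in> carrier_mat d d"
  shows "ennreal (entry_norm A) \<le> ennreal (real d ^ 2) * opnorm A"
proof -
  have fin: "opnorm A < \<infinity>" using opnorm_le_entry_norm[of A] by (simp add: order.strict_trans1)
  then obtain c where c: "opnorm A = ennreal c" "0 \<le> c" by (cases "opnorm A") auto
  have "l1norm (col A j) \<le> d * c" if "j < d" for j
  proof -
    have "vnorm (col A j) \<le> c" using vnorm_col_le_opnorm[OF assms that] c by simp
    moreover have "l1norm (col A j) \<le> d * vnorm (col A j)" using l1norm_le_vnorm[of "col A j"] assms by simp
    ultimately show ?thesis by (meson mult_left_mono of_nat_0_le_iff order_trans)
  qed
  then have "entry_norm A \<le> d * (d * c)"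
    using sum_bounded_above[of "{..<d}" "\<lambda>j. l1norm (col A j)" "d * c"] assms by (simp add: entry_norm_cols)
  then show ?thesis using c by (simp add: ennreal_mult[symmetric] power2_eq_square mult.assoc ennreal_leI)
qed

lemma entry_norm_pos:
  assumes "A \<in> carrier_mat m d" "i < m" "j < d" "A $$ (i,j) \<noteq> 0"
  shows "0 < entry_norm A"
proof -
  have "\<bar>A $$ (i,j)\<bar> \<le> l1norm (col A j)" using entry_le_l1norm[of i "col A j"] assms by simp
  also have "\<dots> \<le> entry_norm A" unfolding entry_norm_cols using assms
    by (intro member_le_sum) auto
  finally show ?thesis using assms(4) by linarith
qed

lemma entry_norm_pos_inverse:
  assumes "0 < d" "A \<in> carrier_mat d d" "B \<in> carrier_mat d d" "A * B = 1\<^sub>m d"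
  shows "0 < entry_norm A"
proof -
  have "0 < entry_norm (1\<^sub>m d :: rmat)" using assms(1) by (intro entry_norm_pos[of _ d d 0 0]) auto
  also have "\<dots> \<le> entry_norm A * entry_norm B" using entry_norm_mult[OF assms(2,3)] assms(4) by simp
  finally show ?thesis by (metis entry_norm_nonneg mult_zero_left order_less_le)
qed

section \<open>Measurability of matrix functions\<close>

definition rational_vecs :: "nat \<Rightarrow> rvec set" where
  "rational_vecs d = {v \<in> carrier_vec d. vnorm v \<noteq> 0 \<and> (\<forall>i<d. v $ i \<in> \<rat>)}"

lemma vnorm_mult_mat_vec:
  assumes "A \<in> carrier_mat m d" "v \<in> carrier_vec d"
  shows "vnorm (A *\<^sub>v v) = sqrt (\<Sum>i<m. (\<Sum>j<d. A $$ (i,j) * v $ j)^2)"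
proof -
  have "dim_vec (A *\<^sub>v v) = m" using assms by simp
  then show ?thesis unfolding vnorm_eq by (simp add: mult_mat_vec_entry[OF assms] del: index_mult_mat_vec)
qed

lemma countable_rational_vecs: "countable (rational_vecs d)"
proof -
  have "rational_vecs d \<subseteq> vec_of_list ` {xs. set xs \<subseteq> \<rat>}"
  proof
    fix v assume v: "v \<in> rational_vecs d"
    have vd: "dim_vec v = d" using v by (simp add: rational_vecs_def)
    have "v = vec_of_list (map (\<lambda>i. v $ i) [0..<d])"
      by (rule eq_vecI) (simp_all add: vd vec_of_list_index)
    moreover have "set (map (\<lambda>i. v $ i) [0..<d]) \<subseteq> \<rat>"
      using v by (auto simp: rational_vecs_def)
    ultimately show "v \<in> vec_of_list ` {xs. set xs \<subseteq> \<rat>}" by blast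
  qed
  moreover have "countable {xs :: real list. set xs \<subseteq> \<rat>}"
    using countable_lists[OF countable_rat] by (simp only: lists_eq_set)
  ultimately show ?thesis by (meson countable_image countable_subset)
qed

text \<open>The quotient \<open>|A v| / |v|\<close> is continuous in \<open>v\<close>. A
  supremum over a countable set makes the operator norm of a measurable matrix function
  measurable, without which the essential suprema in the endpoint classes would be infinite by
  convention.\<close>

lemma opnorm_rational:
  assumes A: "A \<in> carrier_mat m d"
  shows "opnorm A = (SUP v\<in>rational_vecs d. ennreal (vnorm (A *\<^sub>v v) / vnorm v))"
proof (rule antisym)
  have mv: "A *\<^sub>v (c \<cdot>\<^sub>v v) = c \<cdot>\<^sub>v (A *\<^sub>v v)" if "v \<in> carrier_vec d" for c v
    using mult_mat_vec[OF A that] .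
  show "(SUP v\<in>rational_vecs d. ennreal (vnorm (A *\<^sub>v v) / vnorm v)) \<le> opnorm A"
  proof (rule SUP_least)
    fix v assume v: "v \<in> rational_vecs d"
    have "vnorm (A *\<^sub>v v) / vnorm v = vnorm (A *\<^sub>v ((1 / vnorm v) \<cdot>\<^sub>v v))"
      using v by (simp add: mv rational_vecs_def)
    also have "ennreal \<dots> \<le> opnorm A"
      using v A unfolding opnorm_def by (intro SUP_upper) (auto simp: rational_vecs_def)
    finally show "ennreal (vnorm (A *\<^sub>v v) / vnorm v) \<le> opnorm A" .
  qed
next
  show "opnorm A \<le> (SUP v\<in>rational_vecs d. ennreal (vnorm (A *\<^sub>v v) / vnorm v))" (is "_ \<le> ?S")
    unfolding opnorm_def
  proof (rule SUP_least)
    fix v assume "v \<in> {v \<in> carrier_vec (dim_col A). vnorm v = 1}"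
    then have v: "v \<in> carrier_vec d" "vnorm v = 1" using A by auto
    have ex: "\<exists>q. q \<in> \<rat> \<and> v $ i < q \<and> q < v $ i + 1 / Suc k" for k i
      using Rats_dense_in_real[of "v $ i" "v $ i + 1 / Suc k"] by auto
    define q where "q k i = (SOME q. q \<in> \<rat> \<and> v $ i < q \<and> q < v $ i + 1 / Suc k)" for k i
    have q: "q k i \<in> \<rat>" "v $ i < q k i" "q k i < v $ i + 1 / Suc k" for k i
      using someI_ex[OF ex[of i k]] by (auto simp: q_def)
    have qlim: "(\<lambda>k. q k i) \<longlonglongrightarrow> v $ i" for i
    proof (rule real_tendsto_sandwich)
      show "(\<lambda>k. v $ i) \<longlonglongrightarrow> v $ i" by simp
      show "(\<lambda>k. v $ i + 1 / Suc k) \<longlonglongrightarrow> v $ i"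
        using tendsto_add[OF tendsto_const LIMSEQ_inverse_real_of_nat, of "v $ i"] by (simp add: inverse_eq_divide)
    qed (use q in \<open>auto intro!: always_eventually less_imp_le\<close>)
    define w where "w k = vec d (q k)" for k
    have w: "w k \<in> carrier_vec d" for k by (simp add: w_def)
    have lim1: "(\<lambda>k. vnorm (w k)) \<longlonglongrightarrow> vnorm v"
      unfolding vnorm_eq using v(1) by (auto simp: w_def intro!: tendsto_intros qlim)
    have av: "vnorm (A *\<^sub>v u) = sqrt (\<Sum>i<m. (\<Sum>j<d. A $$ (i,j) * u $ j)^2)" if "u \<in> carrier_vec d" for u
      using vnorm_mult_mat_vec[OF A that] .
    have lim2: "(\<lambda>k. vnorm (A *\<^sub>v w k)) \<longlonglongrightarrow> vnorm (A *\<^sub>v v)"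
      unfolding av[OF w] av[OF v(1)] by (auto simp: w_def intro!: tendsto_intros qlim)
    have "(\<lambda>k. ennreal (vnorm (A *\<^sub>v w k) / vnorm (w k))) \<longlonglongrightarrow> ennreal (vnorm (A *\<^sub>v v) / vnorm v)"
      using v(2) by (intro tendsto_intros lim1 lim2) auto
    moreover have "eventually (\<lambda>k. ennreal (vnorm (A *\<^sub>v w k) / vnorm (w k)) \<le> ?S) sequentially"
    proof -
      have "eventually (\<lambda>k. vnorm (w k) > 0) sequentially"
        using order_tendstoD(1)[OF lim1, of 0] v(2) by simp
      then show ?thesis
      proof eventually_elim
        case (elim k)
        then have "w k \<in> rational_vecs d" using q(1) by (auto simp: rational_vecs_def w_def)
        then show ?case by (intro SUP_upper)
      qed
    qed
    ultimately have "ennreal (vnorm (A *\<^sub>v v) / vnorm v) \<le> ?S"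
      by (rule tendsto_upperbound) simp
    then show "ennreal (vnorm (A *\<^sub>v v)) \<le> ?S" using v(2) by simp
  qed
qed

lemma measurable_opnorm:
  assumes "\<And>x. x \<in> space M \<Longrightarrow> A x \<in> carrier_mat d d"
    and [measurable]: "\<And>i j. i < d \<Longrightarrow> j < d \<Longrightarrow> (\<lambda>x. A x $$ (i,j)) \<in> borel_measurable M"
  shows "(\<lambda>x. opnorm (A x)) \<in> borel_measurable M"
proof -
  have "(\<lambda>x. SUP v\<in>rational_vecs d. ennreal (sqrt (\<Sum>i<d. (\<Sum>j<d. A x $$ (i,j) * v $ j)^2) / vnorm v)) \<in> borel_measurable M"
    by (rule borel_measurable_SUP[OF countable_rational_vecs]) measurable
  moreover have "opnorm (A x) = (SUP v\<in>rational_vecs d. ennreal (sqrt (\<Sum>i<d. (\<Sum>j<d. A x $$ (i,j) * v $ j)^2) / vnorm v))"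
    if x: "x \<in> space M" for x
  proof -
    note A = assms(1)[OF x]
    show ?thesis unfolding opnorm_rational[OF A]
    proof (rule SUP_cong[OF refl])
      fix v assume "v \<in> rational_vecs d"
      then have "v \<in> carrier_vec d" by (simp add: rational_vecs_def)
      then show "ennreal (vnorm (A x *\<^sub>v v) / vnorm v) = ennreal (sqrt (\<Sum>i<d. (\<Sum>j<d. A x $$ (i,j) * v $ j)^2) / vnorm v)"
        using vnorm_mult_mat_vec[OF A] by simp
    qed
  qed
  ultimately show ?thesis by (simp cong: measurable_cong)
qed

lemma measurable_entry_norm:
  assumes "\<And>x. x \<in> space M \<Longrightarrow> A x \<in> carrier_mat d d"
    and [measurable]: "\<And>i j. i < d \<Longrightarrow> j < d \<Longrightarrow> (\<lambda>x. A x $$ (i,j)) \<in> borel_measurable M"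
  shows "(\<lambda>x. entry_norm (A x)) \<in> borel_measurable M"
proof -
  have "(\<lambda>x. \<Sum>j<d. \<Sum>i<d. \<bar>A x $$ (i,j)\<bar>) \<in> borel_measurable M" by measurable
  moreover have "entry_norm (A x) = (\<Sum>j<d. \<Sum>i<d. \<bar>A x $$ (i,j)\<bar>)" if "x \<in> space M" for x
    using assms(1)[OF that] by (simp add: entry_norm_def)
  ultimately show ?thesis by (simp cong: measurable_cong)
qed

lemma measurable_vnorm:
  assumes "\<And>x. x \<in> space M \<Longrightarrow> v x \<in> carrier_vec d"
    and [measurable]: "\<And>i. i < d \<Longrightarrow> (\<lambda>x. v x $ i) \<in> borel_measurable M"
  shows "(\<lambda>x. vnorm (v x)) \<in> borel_measurable M" "(\<lambda>x. l1norm (v x)) \<in> borel_measurable M"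
proof -
  have "(\<lambda>x. sqrt (\<Sum>i<d. (v x $ i)^2)) \<in> borel_measurable M" "(\<lambda>x. \<Sum>i<d. \<bar>v x $ i\<bar>) \<in> borel_measurable M"
    by measurable
  moreover have "vnorm (v x) = sqrt (\<Sum>i<d. (v x $ i)^2)" "l1norm (v x) = (\<Sum>i<d. \<bar>v x $ i\<bar>)" if "x \<in> space M" for x
    using assms(1)[OF that] by (simp_all add: vnorm_eq l1norm_def)
  ultimately show "(\<lambda>x. vnorm (v x)) \<in> borel_measurable M" "(\<lambda>x. l1norm (v x)) \<in> borel_measurable M"
    by (simp_all cong: measurable_cong)
qed

lemma measurable_mult_mat_entry:
  fixes A B :: "'a \<Rightarrow> rmat"
  assumes "\<And>x. x \<in> space M \<Longrightarrow> A x \<in> carrier_mat d d" "\<And>x. x \<in> space M \<Longrightarrow> B x \<in> carrier_mat d d"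
    and [measurable]: "\<And>i j. i < d \<Longrightarrow> j < d \<Longrightarrow> (\<lambda>x. A x $$ (i,j)) \<in> borel_measurable M"
      "\<And>i j. i < d \<Longrightarrow> j < d \<Longrightarrow> (\<lambda>x. B x $$ (i,j)) \<in> borel_measurable M"
    and "i < d" "j < d"
  shows "(\<lambda>x. (A x * B x) $$ (i,j)) \<in> borel_measurable M"
proof -
  have "(\<lambda>x. \<Sum>k<d. A x $$ (i,k) * B x $$ (k,j)) \<in> borel_measurable M"
    by (intro borel_measurable_sum borel_measurable_times) (use assms(3-6) in auto)
  moreover have "(A x * B x) $$ (i,j) = (\<Sum>k<d. A x $$ (i,k) * B x $$ (k,j))" if "x \<in> space M" for x
    using assms(1,2)[OF that] assms(5,6) by (auto simp: scalar_prod_def lessThan_atLeast0 intro!: sum.cong)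
  ultimately show ?thesis by (simp cong: measurable_cong)
qed

lemma measurable_mult_mat_vec_entry:
  fixes A :: "'a \<Rightarrow> rmat"
  assumes "\<And>x. x \<in> space M \<Longrightarrow> A x \<in> carrier_mat d d" "\<And>x. x \<in> space M \<Longrightarrow> v x \<in> carrier_vec d"
    and [measurable]: "\<And>i j. i < d \<Longrightarrow> j < d \<Longrightarrow> (\<lambda>x. A x $$ (i,j)) \<in> borel_measurable M"
      "\<And>i. i < d \<Longrightarrow> (\<lambda>x. v x $ i) \<in> borel_measurable M"
    and "i < d"
  shows "(\<lambda>x. (A x *\<^sub>v v x) $ i) \<in> borel_measurable M"
proof -
  have "(\<lambda>x. \<Sum>k<d. A x $$ (i,k) * v x $ k) \<in> borel_measurable M"
    by (intro borel_measurable_sum borel_measurable_times) (use assms(3-5) in auto)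
  moreover have "(A x *\<^sub>v v x) $ i = (\<Sum>k<d. A x $$ (i,k) * v x $ k)" if "x \<in> space M" for x
    using mult_mat_vec_entry[OF assms(1)[OF that] assms(2)[OF that] assms(5)] .
  ultimately show ?thesis by (simp cong: measurable_cong)
qed

lemma measurable_det:
  fixes A :: "'a \<Rightarrow> rmat"
  assumes "\<And>x. x \<in> space M \<Longrightarrow> A x \<in> carrier_mat d d"
    and [measurable]: "\<And>i j. i < d \<Longrightarrow> j < d \<Longrightarrow> (\<lambda>x. A x $$ (i,j)) \<in> borel_measurable M"
  shows "(\<lambda>x. det (A x)) \<in> borel_measurable M"
proof -
  have "(\<lambda>x. \<Sum>p\<in>{p. p permutes {0..<d}}. signof p * (\<Prod>i=0..<d. A x $$ (i, p i))) \<in> borel_measurable M"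
  proof (intro borel_measurable_sum borel_measurable_times borel_measurable_const borel_measurable_prod)
    fix p i assume "p \<in> {p. p permutes {0..<d}}" "i \<in> {0..<d}"
    then have "i < d" "p i < d" by (auto dest: permutes_in_image)
    then show "(\<lambda>x. A x $$ (i, p i)) \<in> borel_measurable M" by measurable
  qed
  moreover have "det (A x) = (\<Sum>p\<in>{p. p permutes {0..<d}}. signof p * (\<Prod>i=0..<d. A x $$ (i, p i)))"
    if "x \<in> space M" for x
    using det_def'[OF assms(1)[OF that]] .
  ultimately show ?thesis by (simp cong: measurable_cong)
qed

text \<open>Cramer's rule for the equations solved by the columns of the inverse.\<close>

lemma inverse_entry_cramer:
  fixes A B :: rmat
  assumes "A \<in> carrier_mat d d" "B \<in> carrier_mat d d" "A * B = 1\<^sub>m d" "i < d" "j < d"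
  shows "B $$ (i,j) = det (replace_col A (unit_vec d j) i) / det A"
proof -
  have "A *\<^sub>v col B j = unit_vec d j"
    using col_mult2[OF assms(1,2,5)] assms(3,5) by simp
  then have "det (replace_col A (unit_vec d j) i) = col B j $ i * det A"
    using cramer_lemma_mat[OF assms(1), of "col B j" i] assms by simp
  moreover have "det A * det B = 1" using det_mult[OF assms(1,2)] assms(3) by simp
  ultimately show ?thesis using assms by auto
qed

section \<open>Lebesgue measure\<close>

hide_const (open) Order.top

lemma sigma_finite_leb: "sigma_finite_measure (leb n)"
proof -
  interpret product_sigma_finite "\<lambda>_::nat. lborel :: real measure" by standard
  interpret P: sigma_finite_measure "Pi\<^sub>M {..<n} (\<lambda>_. lborel :: real measure)"
    by (rule sigma_finite) simp
  obtain A where A: "countable A" "A \<subseteq> sets (Pi\<^sub>M {..<n} (\<lambda>_. lborel :: real measure))"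
    "\<Union>A = space (Pi\<^sub>M {..<n} (\<lambda>_. lborel :: real measure))"
    "\<forall>a\<in>A. emeasure (Pi\<^sub>M {..<n} (\<lambda>_. lborel :: real measure)) a \<noteq> \<infinity>"
    using P.sigma_finite_countable by blast
  show ?thesis
  proof
    show "\<exists>A. countable A \<and> A \<subseteq> sets (leb n) \<and> \<Union> A = space (leb n) \<and> (\<forall>a\<in>A. emeasure (leb n) a \<noteq> \<infinity>)"
      unfolding leb_def using A by (intro exI[of _ A]) (auto simp: subset_eq)
  qed
qed

text \<open>Completeness of the measure. It is needed for the inverse of a weight, which is
  determined by the entries of the weight only off a null set.\<close>

lemma measurable_AE_leb:
  assumes g: "g \<in> measurable (leb n) N" and f: "\<And>x. x \<in> space (leb n) \<Longrightarrow> f x \<in> space N"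
    and eq: "AE x in leb n. f x = g x"
  shows "f \<in> measurable (leb n) N"
proof (rule measurableI)
  fix A assume A: "A \<in> sets N"
  show "f -` A \<inter> space (leb n) \<in> sets (leb n)"
    unfolding leb_def
  proof (rule completion.in_sets_AE)
    show "g -` A \<inter> space (leb n) \<in> sets (completion (Pi\<^sub>M {..<n} (\<lambda>_. lborel)))"
      using measurable_sets[OF g A] by (simp add: leb_def)
    show "AE x in completion (Pi\<^sub>M {..<n} (\<lambda>_. lborel)).
        (x \<in> g -` A \<inter> space (leb n)) = (x \<in> f -` A \<inter> space (completion (Pi\<^sub>M {..<n} (\<lambda>_. lborel))))"
      using eq unfolding leb_def by eventually_elim auto
  qed auto
qed (use f in auto)

text \<open>An open set is a union of boxes with rational vertices, of which there are countably
  many.\<close>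

lemma openin_imp_sets_leb:
  assumes "openin (product_topology (\<lambda>_. euclideanreal) {..<n}) B"
  shows "B \<in> sets (leb n)"
proof -
  define box where "box c = PiE {..<n} (\<lambda>i. {fst (c i :: real \<times> real)<..<snd (c i)})" for c
  define CC where "CC = {c \<in> PiE {..<n} (\<lambda>_. \<rat> \<times> \<rat>). box c \<subseteq> B}"
  have "countable (PiE {..<n} (\<lambda>_. \<rat> \<times> \<rat> :: (real \<times> real) set))"
    by (intro countable_PiE countable_SIGMA countable_rat) auto
  then have cc: "countable CC" unfolding CC_def by (rule countable_subset[rotated]) auto
  have "B \<subseteq> (\<Union>c\<in>CC. box c)"
  proof
    fix x assume x: "x \<in> B"
    then have "\<exists>U. (\<forall>i<n. open (U i)) \<and> x \<in> PiE {..<n} U \<and> PiE {..<n} U \<subseteq> B"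
      using assms unfolding openin_product_topology_alt by (auto simp: Ball_def)
    then obtain U where U: "\<And>i. i < n \<Longrightarrow> open (U i)" "x \<in> PiE {..<n} U" "PiE {..<n} U \<subseteq> B"
      by blast
    have "\<exists>c. c \<in> \<rat> \<times> \<rat> \<and> x i \<in> {fst c<..<snd c} \<and> {fst c<..<snd c} \<subseteq> U i" if i: "i < n" for i
    proof -
      have "x i \<in> U i" using U(2) i by auto
      then obtain e where e: "e > 0" "ball (x i) e \<subseteq> U i" using U(1)[OF i] openE by blast
      obtain a where a: "a \<in> \<rat>" "x i - e < a" "a < x i" using Rats_dense_in_real[of "x i - e" "x i"] e by auto
      obtain b where b: "b \<in> \<rat>" "x i < b" "b < x i + e" using Rats_dense_in_real[of "x i" "x i + e"] e by auto
      have "{a<..<b} \<subseteq> U i" using e(2) a b by (auto simp: subset_eq dist_real_def)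
      then show ?thesis using a b by (intro exI[of _ "(a,b)"]) auto
    qed
    then obtain c where c: "\<And>i. i < n \<Longrightarrow> c i \<in> \<rat> \<times> \<rat> \<and> x i \<in> {fst (c i)<..<snd (c i)} \<and> {fst (c i)<..<snd (c i)} \<subseteq> U i"
      by metis
    define c' where "c' = restrict c {..<n}"
    have "box c' \<subseteq> PiE {..<n} U" unfolding box_def c'_def using c by (intro PiE_mono) auto
    then have "c' \<in> CC" using U(3) c by (auto simp: CC_def c'_def)
    moreover have "x \<in> box c'" using c U(2) unfolding box_def c'_def by (auto simp: PiE_iff)
    ultimately show "x \<in> (\<Union>c\<in>CC. box c)" by blast
  qed
  then have "B = (\<Union>c\<in>CC. box c)" by (auto simp: CC_def)
  moreover have "box c \<in> sets (leb n)" for c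
    unfolding leb_def box_def by (intro sets_completionI_sets sets_PiM_I_finite) auto
  ultimately show ?thesis using cc by auto
qed

section \<open>Powers of extended reals and averages\<close>

lemma ennpow_ennreal [simp]: "0 \<le> x \<Longrightarrow> ennpow (ennreal x) a = ennreal (x powr a)"
  by (simp add: ennpow_def)

lemma ennpow_top [simp]: "ennpow top a = top" "ennpow \<infinity> a = \<infinity>"
  by (simp_all add: ennpow_def infinity_ennreal_def)

lemma ennpow_zero [simp]: "ennpow 0 a = 0"
  by (simp add: ennpow_def)

lemma ennpow_one [simp]: "ennpow x 1 = x"
  by (cases x) auto

lemma ennpow_mono: "0 \<le> a \<Longrightarrow> x \<le> y \<Longrightarrow> ennpow x a \<le> ennpow y a"
  by (cases x; cases y) (auto simp: ennreal_leI powr_mono2 top_unique)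

lemma ennpow_mult: "ennpow (x * y) a = ennpow x a * ennpow y a"
proof (cases x)
  case (real r)
  show ?thesis
  proof (cases y)
    case (real s)
    then show ?thesis using \<open>x = ennreal r\<close> \<open>0 \<le> r\<close>
      by (simp add: ennreal_mult[symmetric] powr_mult)
  next
    case top
    then show ?thesis using real by (cases "r = 0") (auto simp: ennreal_mult_top)
  qed
next
  case top
  then show ?thesis by (cases "y = 0"; cases y) (auto simp: ennreal_top_mult)
qed

lemma ennpow_ennpow: "ennpow (ennpow x a) b = ennpow x (a * b)"
  by (cases x) (auto simp: powr_powr)

lemma ennpow_inverse: "a \<noteq> 0 \<Longrightarrow> ennpow (ennpow x a) (1 / a) = x"
  "a \<noteq> 0 \<Longrightarrow> ennpow (ennpow x (1 / a)) a = x"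
  by (simp_all add: ennpow_ennpow)

lemma ennpow_less_top_iff [simp]: "ennpow x a < top \<longleftrightarrow> x < top"
  by (cases x) auto

lemma ennpow_eq_0_iff [simp]: "ennpow x a = 0 \<longleftrightarrow> x = 0"
  by (cases x) auto

lemma measurable_ennpow [measurable]:
  assumes [measurable]: "f \<in> borel_measurable M"
  shows "(\<lambda>x. ennpow (f x) a) \<in> borel_measurable M"
  unfolding ennpow_def infinity_ennreal_def by measurable

lemma avg_mono_AE:
  assumes "AE x\<in>B in M. f x \<le> g x"
  shows "avg M B f \<le> avg M B g"
  unfolding avg_def
  by (intro divide_right_mono_ennreal nn_integral_mono_AE) (use assms in \<open>auto elim!: eventually_mono simp: indicator_def\<close>)

lemma avg_cmult:
  assumes "B \<in> sets M" "f \<in> borel_measurable M"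
  shows "avg M B (\<lambda>x. c * f x) = c * avg M B f"
proof -
  have "(\<integral>\<^sup>+x\<in>B. c * f x \<partial>M) = (\<integral>\<^sup>+x. c * (f x * indicator B x) \<partial>M)" by (simp add: mult.assoc)
  also have "\<dots> = c * (\<integral>\<^sup>+x\<in>B. f x \<partial>M)" using assms by (intro nn_integral_cmult) auto
  finally show ?thesis by (simp add: avg_def ennreal_times_divide)
qed

lemma avg_null:
  assumes "B \<in> sets M" "emeasure M B = 0"
  shows "avg M B f = 0"
proof -
  have "(\<integral>\<^sup>+x\<in>B. f x \<partial>M) = (\<integral>\<^sup>+x. 0 \<partial>M)"
    using AE_not_in[OF null_setsI[OF assms(2,1)]] by (intro nn_integral_cong_AE) (auto elim!: eventually_mono)
  then show ?thesis by (simp add: avg_def)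
qed

lemma avg_less_top_iff:
  assumes "emeasure M B \<noteq> 0" "emeasure M B < \<infinity>"
  shows "avg M B f < \<infinity> \<longleftrightarrow> (\<integral>\<^sup>+x\<in>B. f x \<partial>M) < \<infinity>"
  unfolding avg_def using assms
  by (cases "emeasure M B"; cases "(\<integral>\<^sup>+x\<in>B. f x \<partial>M)") (auto simp: divide_ennreal ennreal_top_divide)

lemma set_nn_integral_avg:
  assumes "emeasure M B \<noteq> 0" "emeasure M B < \<infinity>"
  shows "(\<integral>\<^sup>+x\<in>B. f x \<partial>M) = avg M B f * emeasure M B"
  unfolding avg_def using assms
  by (cases "emeasure M B"; cases "(\<integral>\<^sup>+x\<in>B. f x \<partial>M)")
    (auto simp: divide_ennreal ennreal_top_divide ennreal_mult[symmetric] ennreal_top_mult)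

section \<open>Near-extremal bases and reducing matrices\<close>

lemma nonsingular_inverse:
  fixes A :: rmat
  assumes A: "A \<in> carrier_mat d d" and "det A \<noteq> 0"
  obtains Q where "Q \<in> carrier_mat d d" "A * Q = 1\<^sub>m d" "Q * A = 1\<^sub>m d"
proof
  let ?Q = "(1 / det A) \<cdot>\<^sub>m adj_mat A"
  note adj = adj_mat[OF A]
  show "?Q \<in> carrier_mat d d" using adj by simp
  show "A * ?Q = 1\<^sub>m d" using adj A assms(2)
    by (simp add: mult_smult_distrib[OF A adj(1)]) (auto intro!: eq_matI)
  show "?Q * A = 1\<^sub>m d" using adj A assms(2)
    by (simp add: mult_smult_assoc_mat[OF adj(1) A]) (auto intro!: eq_matI)
qed

text \<open>A version of Auerbach's lemma. By Cramer's rule, a coordinate of \<open>v\<close> in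
  the basis of the columns of \<open>P\<close> is a quotient of two determinants of matrices
  with columns in \<open>S\<close>. It is bounded by 2 if \<open>P\<close> comes within a factor
  of 2 of the supremum of all such determinants; aiming at the supremum itself would require
  \<open>S\<close> to be compact.\<close>

lemma near_extremal_basis:
  fixes S :: "rvec set"
  assumes S: "S \<subseteq> carrier_vec d"
    and e: "0 < \<delta>" "\<And>i. i < d \<Longrightarrow> \<delta> \<cdot>\<^sub>v unit_vec d i \<in> S"
    and bd: "\<And>v i. v \<in> S \<Longrightarrow> i < d \<Longrightarrow> \<bar>v $ i\<bar> \<le> R"
  obtains P Q where "P \<in> carrier_mat d d" "Q \<in> carrier_mat d d" "P * Q = 1\<^sub>m d" "Q * P = 1\<^sub>m d"
    "\<And>j. j < d \<Longrightarrow> col P j \<in> S" "\<And>v k. v \<in> S \<Longrightarrow> k < d \<Longrightarrow> \<bar>(Q *\<^sub>v v) $ k\<bar> \<le> 2"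
proof -
  define X where "X = {A :: rmat. A \<in> carrier_mat d d \<and> (\<forall>j<d. col A j \<in> S)}"
  have detb: "\<bar>det A\<bar> \<le> (\<Sum>p\<in>{p. p permutes {0..<d}}. (\<Prod>i=0..<d. R))" if A: "A \<in> X" for A
  proof -
    have A1: "A \<in> carrier_mat d d" "\<And>j. j < d \<Longrightarrow> col A j \<in> S" using A by (auto simp: X_def)
    have ent: "\<bar>A $$ (i,j)\<bar> \<le> R" if "i < d" "j < d" for i j
      using bd[OF A1(2)[OF that(2)] that(1)] A1(1) that by simp
    have "\<bar>det A\<bar> \<le> (\<Sum>p\<in>{p. p permutes {0..<d}}. \<bar>signof p * (\<Prod>i=0..<d. A $$ (i, p i))\<bar>)"
      unfolding det_def'[OF A1(1)] by (rule sum_abs)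
    also have "\<dots> \<le> (\<Sum>p\<in>{p. p permutes {0..<d}}. (\<Prod>i=0..<d. R))"
    proof (rule sum_mono)
      fix p assume p: "p \<in> {p. p permutes {0..<d}}"
      have "\<bar>signof p * (\<Prod>i=0..<d. A $$ (i, p i))\<bar> = (\<Prod>i=0..<d. \<bar>A $$ (i, p i)\<bar>)"
        by (simp add: abs_mult abs_prod sign_def)
      also have "\<dots> \<le> (\<Prod>i=0..<d. R)"
        using p by (intro prod_mono conjI ent) (auto dest: permutes_in_image)
      finally show "\<bar>signof p * (\<Prod>i=0..<d. A $$ (i, p i))\<bar> \<le> (\<Prod>i=0..<d. R)" .
    qed
    finally show ?thesis .
  qed
  define \<sigma> where "\<sigma> = Sup ((\<lambda>A. \<bar>det A\<bar>) ` X)"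
  have bdd: "bdd_above ((\<lambda>A. \<bar>det A\<bar>) ` X)" using detb by (auto intro!: bdd_aboveI)
  have dX: "\<delta> \<cdot>\<^sub>m 1\<^sub>m d \<in> X"
  proof -
    have "col (\<delta> \<cdot>\<^sub>m 1\<^sub>m d) j = \<delta> \<cdot>\<^sub>v unit_vec d j" if "j < d" for j
      using that by (intro eq_vecI) auto
    then show ?thesis using e(2) by (auto simp: X_def)
  qed
  have "0 < \<bar>det (\<delta> \<cdot>\<^sub>m 1\<^sub>m d)\<bar>" using e(1) by simp
  also have "\<dots> \<le> \<sigma>" unfolding \<sigma>_def by (rule cSup_upper[OF imageI[OF dX] bdd])
  finally have "\<sigma> / 2 < \<sigma>" by simp
  then obtain P where P: "P \<in> X" "\<sigma> / 2 < \<bar>det P\<bar>"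
    unfolding \<sigma>_def using less_cSup_iff[OF _ bdd] dX by (metis (no_types, lifting) empty_iff imageE image_is_empty)
  have P1: "P \<in> carrier_mat d d" "\<And>j. j < d \<Longrightarrow> col P j \<in> S" using P by (auto simp: X_def)
  have det0: "det P \<noteq> 0" using P \<open>\<sigma> / 2 < \<sigma>\<close> by auto
  obtain Q where Q: "Q \<in> carrier_mat d d" "P * Q = 1\<^sub>m d" "Q * P = 1\<^sub>m d"
    using nonsingular_inverse[OF P1(1) det0] by blast
  have "\<bar>(Q *\<^sub>v v) $ k\<bar> \<le> 2" if v: "v \<in> S" and k: "k < d" for v k
  proof -
    have vc: "v \<in> carrier_vec d" using v S by auto
    have "P *\<^sub>v (Q *\<^sub>v v) = v" using assoc_mult_mat_vec[OF P1(1) Q(1) vc] Q(2) vc by simp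
    then have "det (replace_col P v k) = (Q *\<^sub>v v) $ k * det P"
      using cramer_lemma_mat[OF P1(1), of "Q *\<^sub>v v" k] Q(1) vc k by simp
    moreover have "replace_col P v k \<in> X"
    proof -
      have "col (replace_col P v k) j = (if j = k then v else col P j)" if "j < d" for j
        using that P1(1) vc k by (intro eq_vecI) (auto simp: replace_col_def)
      then show ?thesis using v P1 by (auto simp: X_def replace_col_def)
    qed
    then have "\<bar>det (replace_col P v k)\<bar> \<le> \<sigma>" unfolding \<sigma>_def using bdd by (intro cSup_upper) auto
    ultimately have "\<bar>(Q *\<^sub>v v) $ k\<bar> * \<bar>det P\<bar> \<le> 2 * \<bar>det P\<bar>" using P(2) by (simp add: abs_mult)
    then show ?thesis using det0 by simp
  qed
  then show ?thesis using that P1 Q by blast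
qed

text \<open>The average of \<open>|Y v|\<^sup>a\<close> is comparable to \<open>|Q
  v|\<^sup>a\<close>, with constants that do not depend on \<open>Y\<close>. The unit ball of
  the average is bounded because \<open>|v| \<le> |Z| |Y v|\<close> and because
  \<open>|Z|\<^sup>-\<^sup>a\<close> has a positive integral.\<close>

lemma reducing_matrix:
  fixes Y Z :: "'a \<Rightarrow> rmat"
  assumes a: "0 < a" and B: "B \<in> sets M" "emeasure M B \<noteq> 0" and d: "0 < d"
    and Y: "\<And>x. x \<in> space M \<Longrightarrow> Y x \<in> carrier_mat d d"
      "\<And>i j. i < d \<Longrightarrow> j < d \<Longrightarrow> (\<lambda>x. Y x $$ (i,j)) \<in> borel_measurable M"
    and Z: "\<And>x. x \<in> space M \<Longrightarrow> Z x \<in> carrier_mat d d"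
      "\<And>i j. i < d \<Longrightarrow> j < d \<Longrightarrow> (\<lambda>x. Z x $$ (i,j)) \<in> borel_measurable M"
    and ZY: "AE x\<in>B in M. Z x * Y x = 1\<^sub>m d"
    and fin: "\<And>i. i < d \<Longrightarrow> (\<integral>\<^sup>+x\<in>B. ennreal (l1norm (Y x *\<^sub>v unit_vec d i) powr a) \<partial>M) < \<infinity>"
  obtains P Q where "P \<in> carrier_mat d d" "Q \<in> carrier_mat d d" "P * Q = 1\<^sub>m d"
    "\<And>j. j < d \<Longrightarrow> (\<integral>\<^sup>+x\<in>B. ennreal (l1norm (Y x *\<^sub>v col P j) powr a) \<partial>M) \<le> 1"
    "\<And>v R k. v \<in> carrier_vec d \<Longrightarrow> 0 \<le> R \<Longrightarrow>
      (\<integral>\<^sup>+x\<in>B. ennreal (l1norm (Y x *\<^sub>v v) powr a) \<partial>M) \<le> ennreal (R powr a) \<Longrightarrow> k < d \<Longrightarrow> \<bar>(Q *\<^sub>v v) $ k\<bar> \<le> 2 * R"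
proof -
  define \<rho> where "\<rho> v = (\<integral>\<^sup>+x\<in>B. ennreal (l1norm (Y x *\<^sub>v v) powr a) \<partial>M)" for v
  note [measurable] = B(1)
  have meas: "(\<lambda>x. ennreal (l1norm (Y x *\<^sub>v v) powr a)) \<in> borel_measurable M" if v: "v \<in> carrier_vec d" for v
  proof -
    have "(\<lambda>x. l1norm (Y x *\<^sub>v v)) \<in> borel_measurable M"
    proof (rule measurable_vnorm(2)[of _ _ d])
      show "(\<lambda>x. (Y x *\<^sub>v v) $ i) \<in> borel_measurable M" if "i < d" for i
        using measurable_mult_mat_vec_entry[of M Y d "\<lambda>_. v" i] Y v that by auto
    qed (use Y v in \<open>auto intro!: mult_mat_vec_carrier\<close>)
    then show ?thesis by measurable
  qed
  have hom: "\<rho> (c \<cdot>\<^sub>v v) = ennreal (\<bar>c\<bar> powr a) * \<rho> v" if v: "v \<in> carrier_vec d" for c v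
  proof -
    have "\<rho> (c \<cdot>\<^sub>v v) = (\<integral>\<^sup>+x. ennreal (\<bar>c\<bar> powr a) * (ennreal (l1norm (Y x *\<^sub>v v) powr a) * indicator B x) \<partial>M)"
      unfolding \<rho>_def
    proof (rule nn_integral_cong)
      fix x assume "x \<in> space M"
      then have "Y x *\<^sub>v (c \<cdot>\<^sub>v v) = c \<cdot>\<^sub>v (Y x *\<^sub>v v)" using mult_mat_vec[OF Y(1) v] by simp
      then show "ennreal (l1norm (Y x *\<^sub>v (c \<cdot>\<^sub>v v)) powr a) * indicator B x =
        ennreal (\<bar>c\<bar> powr a) * (ennreal (l1norm (Y x *\<^sub>v v) powr a) * indicator B x)"
        by (simp add: powr_mult ennreal_mult mult.assoc)
    qed
    then show ?thesis unfolding \<rho>_def using meas[OF v] by (subst (asm) nn_integral_cmult) auto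
  qed
  define S where "S = {v \<in> carrier_vec d. \<rho> v \<le> 1}"
  \<comment> \<open>Where \<open>Z Y = 1\<close>, an entry of \<open>v\<close> is at most \<open>entry_norm Z\<close> times \<open>l1norm (Y v)\<close>.\<close>
  define \<kappa> where "\<kappa> = (\<integral>\<^sup>+x\<in>B. ennreal (entry_norm (Z x) powr - a) \<partial>M)"
  have mZ: "(\<lambda>x. entry_norm (Z x)) \<in> borel_measurable M" using Z by (rule measurable_entry_norm)
  have Fpos: "AE x\<in>B in M. 0 < entry_norm (Z x)"
    using ZY AE_space
  proof eventually_elim
    case (elim x)
    then show ?case using entry_norm_pos_inverse[OF d Z(1) Y(1)] by auto
  qed
  have "\<kappa> \<noteq> 0"
  proof
    assume "\<kappa> = 0"
    then have "AE x in M. ennreal (entry_norm (Z x) powr - a) * indicator B x = 0"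
      unfolding \<kappa>_def using mZ by (subst (asm) nn_integral_0_iff_AE) auto
    then have "AE x in M. x \<notin> B" using Fpos by eventually_elim (auto simp: indicator_def split: if_splits)
    then show False using B AE_iff_null_sets[OF B(1)] by auto
  qed
  then obtain k where k: "0 < k" "ennreal k \<le> \<kappa>"
  proof (cases \<kappa>)
    case (real r)
    then show ?thesis using that[of r] \<open>\<kappa> \<noteq> 0\<close> by (cases "r = 0") auto
  next
    case top
    then show ?thesis using that[of 1] by simp
  qed
  have low: "ennreal (\<bar>v $ i\<bar> powr a) * \<kappa> \<le> \<rho> v" if v: "v \<in> carrier_vec d" and i: "i < d" for v i
  proof -
    have "ennreal (\<bar>v $ i\<bar> powr a) * \<kappa> = (\<integral>\<^sup>+x. ennreal (\<bar>v $ i\<bar> powr a) * (ennreal (entry_norm (Z x) powr - a) * indicator B x) \<partial>M)"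
      unfolding \<kappa>_def using mZ by (subst nn_integral_cmult) auto
    also have "\<dots> \<le> \<rho> v" unfolding \<rho>_def
    proof (rule nn_integral_mono_AE)
      show "AE x in M. ennreal (\<bar>v $ i\<bar> powr a) * (ennreal (entry_norm (Z x) powr - a) * indicator B x)
        \<le> ennreal (l1norm (Y x *\<^sub>v v) powr a) * indicator B x"
        using Fpos ZY AE_space
      proof eventually_elim
        case (elim x)
        show ?case
        proof (cases "x \<in> B")
          case True
          have F: "0 < entry_norm (Z x)" "Z x * Y x = 1\<^sub>m d" using elim True by auto
          note Yx = Y(1)[OF elim(3)] and Zx = Z(1)[OF elim(3)]
          have "\<bar>v $ i\<bar> \<le> l1norm v" using entry_le_l1norm[of i v] v i by simp
          moreover have "Z x *\<^sub>v (Y x *\<^sub>v v) = v" using assoc_mult_mat_vec[OF Zx Yx v] F(2) v by simp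
          then have "l1norm v \<le> entry_norm (Z x) * l1norm (Y x *\<^sub>v v)"
            using l1norm_mult[OF Zx, of "Y x *\<^sub>v v"] Yx v by auto
          ultimately have "\<bar>v $ i\<bar> powr a \<le> (entry_norm (Z x) * l1norm (Y x *\<^sub>v v)) powr a"
            using a by (intro powr_mono2) auto
          then have "\<bar>v $ i\<bar> powr a * entry_norm (Z x) powr - a \<le> l1norm (Y x *\<^sub>v v) powr a"
            using F(1) by (simp add: powr_mult powr_minus field_simps)
          then show ?thesis using True by (simp add: ennreal_mult[symmetric] ennreal_leI)
        qed simp
      qed
    qed
    finally show ?thesis .
  qed
  have bd: "\<bar>v $ i\<bar> \<le> (1 / k) powr (1 / a)" if "v \<in> S" "i < d" for v i
  proof -
    have v: "v \<in> carrier_vec d" "\<rho> v \<le> 1" using that by (auto simp: S_def)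
    have "ennreal (\<bar>v $ i\<bar> powr a * k) \<le> ennreal (\<bar>v $ i\<bar> powr a) * \<kappa>"
      using k by (simp add: ennreal_mult mult_left_mono)
    also have "\<dots> \<le> ennreal 1" using low[OF v(1) that(2)] v(2) by simp
    finally have "\<bar>v $ i\<bar> powr a \<le> 1 / k" using k by (simp add: field_simps)
    then have "(\<bar>v $ i\<bar> powr a) powr (1 / a) \<le> (1 / k) powr (1 / a)" using a by (intro powr_mono2) auto
    then show ?thesis using a by (simp add: powr_powr)
  qed
  have "\<exists>c\<ge>1. \<forall>i<d. \<rho> (unit_vec d i) \<le> ennreal c"
  proof -
    define c where "c = 1 + (\<Sum>i<d. enn2real (\<rho> (unit_vec d i)))"
    have "\<rho> (unit_vec d i) \<le> ennreal c" if "i < d" for i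
    proof -
      have "enn2real (\<rho> (unit_vec d i)) \<le> (\<Sum>i<d. enn2real (\<rho> (unit_vec d i)))"
        using that by (intro member_le_sum) auto
      then have "enn2real (\<rho> (unit_vec d i)) \<le> c" by (simp add: c_def)
      then show ?thesis using fin[OF that] by (metis \<rho>_def ennreal_enn2real ennreal_leI infinity_ennreal_def)
    qed
    moreover have "1 \<le> c" by (simp add: c_def sum_nonneg)
    ultimately show ?thesis by blast
  qed
  then obtain c where c: "1 \<le> c" "\<And>i. i < d \<Longrightarrow> \<rho> (unit_vec d i) \<le> ennreal c" by blast
  define \<delta> where "\<delta> = c powr (- 1 / a)"
  have \<delta>: "0 < \<delta>" "\<delta> powr a = 1 / c"
  proof -
    show "0 < \<delta>" using c by (simp add: \<delta>_def)
    have "\<delta> powr a = c powr (- 1)" unfolding \<delta>_def powr_powr using a by simp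
    then show "\<delta> powr a = 1 / c" using c(1) by (simp add: powr_minus_divide)
  qed
  have "\<delta> \<cdot>\<^sub>v unit_vec d i \<in> S" if "i < d" for i
  proof -
    have "\<rho> (\<delta> \<cdot>\<^sub>v unit_vec d i) = ennreal (1 / c) * \<rho> (unit_vec d i)"
      using \<delta> by (simp add: hom)
    also have "\<dots> \<le> ennreal (1 / c) * ennreal c" using c(2)[OF that] by (intro mult_left_mono) auto
    also have "\<dots> = 1" using c(1) by (simp add: ennreal_mult[symmetric])
    finally show ?thesis by (simp add: S_def)
  qed
  moreover have "S \<subseteq> carrier_vec d" by (auto simp: S_def)
  ultimately obtain P Q where PQ: "P \<in> carrier_mat d d" "Q \<in> carrier_mat d d" "P * Q = 1\<^sub>m d" "Q * P = 1\<^sub>m d"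
    "\<And>j. j < d \<Longrightarrow> col P j \<in> S" "\<And>v k. v \<in> S \<Longrightarrow> k < d \<Longrightarrow> \<bar>(Q *\<^sub>v v) $ k\<bar> \<le> 2"
    using near_extremal_basis[of S d \<delta> "(1 / k) powr (1 / a)"] \<delta>(1) bd by metis
  have pos: "\<bar>(Q *\<^sub>v v) $ k\<bar> \<le> 2 * R"
    if v: "v \<in> carrier_vec d" and R: "0 < R" "\<rho> v \<le> ennreal (R powr a)" and k: "k < d" for v R k
  proof -
    have "\<rho> ((1 / R) \<cdot>\<^sub>v v) = ennreal ((1 / R) powr a) * \<rho> v" using hom[OF v, of "1 / R"] R by simp
    also have "\<dots> \<le> ennreal ((1 / R) powr a) * ennreal (R powr a)" using R by (intro mult_left_mono) auto
    also have "\<dots> = 1" using R by (simp add: ennreal_mult[symmetric] powr_mult[symmetric])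
    finally have "\<bar>(Q *\<^sub>v ((1 / R) \<cdot>\<^sub>v v)) $ k\<bar> \<le> 2" using v k by (intro PQ(6)) (auto simp: S_def)
    then show ?thesis using mult_mat_vec[OF PQ(2) v, of "1 / R"] k PQ(2) R(1) by (simp add: abs_mult field_simps)
  qed
  have nn: "\<bar>(Q *\<^sub>v v) $ k\<bar> \<le> 2 * R"
    if v: "v \<in> carrier_vec d" and R: "0 \<le> R" "\<rho> v \<le> ennreal (R powr a)" and k: "k < d" for v R k
  proof (rule field_le_epsilon)
    fix e :: real assume e: "0 < e"
    have "R powr a \<le> (R + e / 2) powr a" using R e a by (intro powr_mono2) auto
    then have "\<rho> v \<le> ennreal ((R + e / 2) powr a)" using R(2) ennreal_leI order_trans by blast
    then show "\<bar>(Q *\<^sub>v v) $ k\<bar> \<le> 2 * R + e" using pos[OF v _ _ k, of "R + e / 2"] R e by (simp add: algebra_simps)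
  qed
  show ?thesis
    by (rule that[OF PQ(1-3)]) (use PQ(5) nn in \<open>auto simp: S_def \<rho>_def\<close>)
qed

section \<open>Matrix weights\<close>

lemma mat_powr_one:
  assumes "psd d A" shows "mat_powr A 1 = A"
proof -
  obtain U l where U: "diagonalizes d U l A" "\<And>i. i < d \<Longrightarrow> 0 \<le> l i"
    using psd_diagonalizes[OF assms] by blast
  have "mat_powr A 1 = transpose_mat U * mat_diag d (\<lambda>i. l i powr 1) * U"
    by (rule mat_powr_diagonalizes[OF U(1)])
  also have "\<dots> = transpose_mat U * mat_diag d l * U" using U(2) by (intro diag_conj_cong) simp
  finally show ?thesis using diagonalizes_orthogonal(5)[OF U(1)] by simp
qed

lemma psd_symmetric: "psd d A \<Longrightarrow> transpose_mat A = A" "psd d A \<Longrightarrow> A \<in> carrier_mat d d"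
  by (auto simp: psd_def)

lemma matrix_weightD:
  assumes "matrix_weight n d V"
  shows "\<And>x. x \<in> space (leb n) \<Longrightarrow> psd d (V x)"
    "\<And>x. x \<in> space (leb n) \<Longrightarrow> V x \<in> carrier_mat d d"
    "\<And>i j. i < d \<Longrightarrow> j < d \<Longrightarrow> (\<lambda>x. V x $$ (i,j)) \<in> borel_measurable (leb n)"
    "AE x in leb n. invertible_mat (V x)"
  using assms by (auto simp: matrix_weight_def psd_def)

lemma matrix_weight_inverse_AE:
  assumes "matrix_weight n d V"
  shows "AE x in leb n. V x * mat_powr (V x) (-1) = 1\<^sub>m d" "AE x in leb n. mat_powr (V x) (-1) * V x = 1\<^sub>m d"
  using matrix_weightD(4)[OF assms] AE_space
  by (eventually_elim, use psd_invertible_inverse matrix_weightD(1)[OF assms] in blast)+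

text \<open>Measurability of the entries is Cramer's rule, off the null set where the weight is
  singular.\<close>

lemma matrix_weight_inverse:
  assumes "matrix_weight n d V"
  shows "matrix_weight n d (weight_powr V (-1))"
proof -
  note V = matrix_weightD[OF assms]
  have "(\<lambda>x. mat_powr (V x) (-1) $$ (i,j)) \<in> borel_measurable (leb n)" if ij: "i < d" "j < d" for i j
  proof (rule measurable_AE_leb)
    have "(\<lambda>x. det (replace_col (V x) (unit_vec d j) i)) \<in> borel_measurable (leb n)"
    proof (rule measurable_det)
      fix k l assume kl: "k < d" "l < d"
      have "(\<lambda>x. if l = i then unit_vec d j $ k else V x $$ (k,l)) \<in> borel_measurable (leb n)"
        using V(3) kl by (cases "l = i") auto
      then show "(\<lambda>x. replace_col (V x) (unit_vec d j) i $$ (k,l)) \<in> borel_measurable (leb n)"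
        by (rule measurable_cong[THEN iffD1, rotated]) (use kl in \<open>simp add: replace_col_def carrier_matD[OF V(2)]\<close>)
    qed (simp add: replace_col_def carrier_matD[OF V(2)])
    moreover have "(\<lambda>x. det (V x)) \<in> borel_measurable (leb n)" using V(2,3) by (rule measurable_det)
    ultimately show "(\<lambda>x. det (replace_col (V x) (unit_vec d j) i) / det (V x)) \<in> borel_measurable (leb n)"
      by measurable
    show "AE x in leb n. mat_powr (V x) (-1) $$ (i,j) = det (replace_col (V x) (unit_vec d j) i) / det (V x)"
      using matrix_weight_inverse_AE(1)[OF assms] AE_space
    proof eventually_elim
      case (elim x)
      show ?case
        by (rule inverse_entry_cramer[OF V(2)[OF elim(2)] mat_powr_carrier[OF V(1)[OF elim(2)]] elim(1) ij])
    qed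
  qed auto
  moreover have "AE x in leb n. invertible_mat (mat_powr (V x) (-1))"
    using V(4) AE_space by eventually_elim (use V(1) psd_invertible_inverse(3) in blast)
  ultimately show ?thesis using V(1) psd_mat_powr by (auto simp: matrix_weight_def weight_powr_def)
qed

lemma inverse_inverse_weight:
  assumes "matrix_weight n d V" "x \<in> space (leb n)"
  shows "mat_powr (weight_powr V (-1) x) (-1) = V x"
  using mat_powr_mat_powr[of d "V x"] mat_powr_one matrix_weightD(1)[OF assms]
  by (simp add: weight_powr_def)

lemma measurable_weight_pair:
  assumes V: "matrix_weight n d V" and U: "matrix_weight n d U"
  shows "(\<lambda>(x,y). opnorm (V x * U y)) \<in> borel_measurable (leb n \<Otimes>\<^sub>M leb n)"
    "(\<lambda>(x,y). entry_norm (V x * U y)) \<in> borel_measurable (leb n \<Otimes>\<^sub>M leb n)"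
proof -
  note V = matrix_weightD[OF V] and U = matrix_weightD[OF U]
  have c: "case z of (x,y) \<Rightarrow> V x * U y \<in> carrier_mat d d" if "z \<in> space (leb n \<Otimes>\<^sub>M leb n)" for z
    using that V(2) U(2) by (auto simp: space_pair_measure intro!: mult_carrier_mat)
  have m: "(\<lambda>z. (case z of (x,y) \<Rightarrow> V x * U y) $$ (i,j)) \<in> borel_measurable (leb n \<Otimes>\<^sub>M leb n)"
    if ij: "i < d" "j < d" for i j
  proof -
    have "(\<lambda>z. (V (fst z) * U (snd z)) $$ (i,j)) \<in> borel_measurable (leb n \<Otimes>\<^sub>M leb n)"
    proof (rule measurable_mult_mat_entry[OF _ _ _ _ ij])
      show "(\<lambda>z. V (fst z) $$ (k,l)) \<in> borel_measurable (leb n \<Otimes>\<^sub>M leb n)" if "k < d" "l < d" for k l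
        using measurable_compose[OF measurable_fst V(3)[OF that]] .
      show "(\<lambda>z. U (snd z) $$ (k,l)) \<in> borel_measurable (leb n \<Otimes>\<^sub>M leb n)" if "k < d" "l < d" for k l
        using measurable_compose[OF measurable_snd U(3)[OF that]] .
    qed (use V(2) U(2) in \<open>auto simp: space_pair_measure\<close>)
    then show ?thesis by (simp add: case_prod_unfold)
  qed
  show "(\<lambda>(x,y). opnorm (V x * U y)) \<in> borel_measurable (leb n \<Otimes>\<^sub>M leb n)"
    using measurable_opnorm[of "leb n \<Otimes>\<^sub>M leb n" "\<lambda>(x,y). V x * U y" d] c m by (simp add: case_prod_unfold)
  show "(\<lambda>(x,y). entry_norm (V x * U y)) \<in> borel_measurable (leb n \<Otimes>\<^sub>M leb n)"
    using measurable_entry_norm[of "leb n \<Otimes>\<^sub>M leb n" "\<lambda>(x,y). V x * U y" d] c m by (simp add: case_prod_unfold)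
qed

lemma measurable_weight_section:
  assumes V: "matrix_weight n d V" and U: "matrix_weight n d U"
    and x: "x \<in> space (leb n)"
  shows "(\<lambda>y. opnorm (V x * U y)) \<in> borel_measurable (leb n)"
  using measurable_compose[OF measurable_Pair1'[OF x] measurable_weight_pair(1)[OF V U]] by simp

lemma measurable_avg_leb:
  assumes B: "B \<in> sets (leb n)" and f: "case_prod f \<in> borel_measurable (leb n \<Otimes>\<^sub>M leb n)"
  shows "(\<lambda>x. avg (leb n) B (f x)) \<in> borel_measurable (leb n)"
proof -
  interpret sigma_finite_measure "leb n" by (rule sigma_finite_leb)
  note [measurable] = B f
  have "(\<lambda>x. \<integral>\<^sup>+y. f x y * indicator B y \<partial>leb n) \<in> borel_measurable (leb n)"
    by (rule borel_measurable_nn_integral) measurable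
  then show ?thesis unfolding avg_def by measurable
qed

lemma entry_norm_swap:
  assumes "psd d A" "psd d B"
  shows "entry_norm (A * B) = entry_norm (B * A)"
  using entry_norm_transpose[of "A * B"] transpose_mult[of A d d B d] psd_symmetric assms by metis

lemma conj_exp_real: "1 < t \<Longrightarrow> conj_exp (ereal t) = ereal (t / (t - 1))"
  by (simp add: conj_exp_def one_ereal_def field_simps)

lemma A_const_real:
  assumes r: "1 < r"
  shows "A_const n \<B> (ereal r) W = (SUP B\<in>\<B>. ennpow
           (avg (leb n) B (\<lambda>x. ennpow
              (avg (leb n) B (\<lambda>y. ennpow (opnorm (W x * mat_powr (W y) (-1))) (r / (r - 1))))
              (r - 1))) (1 / r))"
proof -
  have "ereal r / ereal (r / (r - 1)) = ereal (r - 1)" using r by (simp add: field_simps)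
  moreover have "1 / ereal r = ereal (1 / r)" using r by (simp add: one_ereal_def)
  moreover have "ereal r \<noteq> 1" using r by (simp add: one_ereal_def)
  ultimately show ?thesis using r by (simp add: A_const_def conj_exp_real)
qed

lemma basisD:
  assumes "basis n \<B>" "B \<in> \<B>"
  shows "B \<in> sets (leb n)" "emeasure (leb n) B < \<infinity>" "B \<subseteq> space (leb n)"
  using assms openin_imp_sets_leb sets.sets_into_space[of B "leb n"] by (auto simp: basis_def)

lemma entry_norm_mult_bound:
  assumes Q: "Q \<in> carrier_mat d d" and V: "V \<in> carrier_mat d d"
    and b: "\<And>j k. j < d \<Longrightarrow> k < d \<Longrightarrow> \<bar>(Q *\<^sub>v col V j) $ k\<bar> \<le> c"
  shows "entry_norm (Q * V) \<le> real d ^ 2 * c"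
proof -
  have "entry_norm (Q * V) = (\<Sum>j<d. \<Sum>i<d. \<bar>(Q * V) $$ (i,j)\<bar>)" using Q V by (simp add: entry_norm_def)
  also have "\<dots> \<le> (\<Sum>j<d. \<Sum>i<d. c)"
  proof (intro sum_mono)
    fix j i assume "j \<in> {..<d}" "i \<in> {..<d}"
    then show "\<bar>(Q * V) $$ (i,j)\<bar> \<le> c" using b[of j i] Q V by simp
  qed
  finally show ?thesis by (simp add: power2_eq_square mult.assoc)
qed

lemma sum_powr_le:
  fixes c :: "nat \<Rightarrow> real"
  assumes "\<And>i. i < d \<Longrightarrow> 0 \<le> c i" "0 < a"
  shows "(\<Sum>i<d. c i) powr a \<le> real d powr a * (\<Sum>i<d. c i powr a)"
proof -
  define S where "S = (\<Sum>i<d. c i powr a)"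
  have S: "0 \<le> S" by (simp add: S_def sum_nonneg)
  have "c i \<le> S powr (1 / a)" if "i < d" for i
  proof -
    have "c i powr a \<le> S" unfolding S_def using that by (intro member_le_sum) auto
    then have "(c i powr a) powr (1 / a) \<le> S powr (1 / a)" using assms(2) by (intro powr_mono2) auto
    then show ?thesis using assms that by (simp add: powr_powr)
  qed
  then have "(\<Sum>i<d. c i) \<le> real d * S powr (1 / a)"
    using sum_bounded_above[of "{..<d}" c "S powr (1 / a)"] by simp
  then have "(\<Sum>i<d. c i) powr a \<le> (real d * S powr (1 / a)) powr a"
    using assms by (intro powr_mono2) (auto intro!: sum_nonneg)
  also have "\<dots> = real d powr a * S" using S assms(2) by (simp add: powr_mult powr_powr)
  finally show ?thesis by (simp add: S_def)
qed

text \<open>The kernel \<open>|V(x) V(y)\<^sup>-\<^sup>1|\<close> of the Muckenhoupt constants,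
  in the entry norm.\<close>

definition weight_ratio :: "(pt \<Rightarrow> rmat) \<Rightarrow> pt \<Rightarrow> pt \<Rightarrow> real" where
  "weight_ratio V x y = entry_norm (V x * mat_powr (V y) (-1))"

lemma weight_ratio_nonneg [simp]: "0 \<le> weight_ratio V x y"
  by (simp add: weight_ratio_def)

lemma weight_ratio_inverse:
  assumes V: "matrix_weight n d V" and "x \<in> space (leb n)" "y \<in> space (leb n)"
  shows "weight_ratio (weight_powr V (-1)) x y = weight_ratio V y x"
  using entry_norm_swap[OF psd_mat_powr[OF matrix_weightD(1)[OF V]] matrix_weightD(1)[OF V]] assms
  by (simp add: weight_ratio_def inverse_inverse_weight[OF V]) (simp add: weight_powr_def)

lemma measurable_weight_ratio:
  assumes V: "matrix_weight n d V"
  shows "case_prod (weight_ratio V) \<in> borel_measurable (leb n \<Otimes>\<^sub>M leb n)"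
    "x \<in> space (leb n) \<Longrightarrow> weight_ratio V x \<in> borel_measurable (leb n)"
    "x \<in> space (leb n) \<Longrightarrow> (\<lambda>y. weight_ratio V y x) \<in> borel_measurable (leb n)"
proof -
  show *: "case_prod (weight_ratio V) \<in> borel_measurable (leb n \<Otimes>\<^sub>M leb n)"
    using measurable_weight_pair(2)[OF V matrix_weight_inverse[OF V]]
    by (simp add: weight_ratio_def[abs_def] weight_powr_def)
  show "x \<in> space (leb n) \<Longrightarrow> weight_ratio V x \<in> borel_measurable (leb n)"
    using measurable_compose[OF measurable_Pair1' *] by simp
  show "x \<in> space (leb n) \<Longrightarrow> (\<lambda>y. weight_ratio V y x) \<in> borel_measurable (leb n)"
    using measurable_compose[OF measurable_Pair2' *] by simp
qed

lemma ex_in_nonnull: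
  assumes "B \<in> sets M" "emeasure M B \<noteq> 0" "AE x\<in>B in M. P x"
  obtains x where "x \<in> B" "P x"
proof -
  have "\<exists>x. x \<in> B \<and> P x"
  proof (rule ccontr)
    assume "\<not> ?thesis"
    then have "AE x in M. x \<notin> B" using assms(3) by (auto elim: eventually_mono)
    then show False using assms(1,2) AE_iff_null_sets by auto
  qed
  then show ?thesis using that by blast
qed

lemma smult_mult_smult_mat:
  fixes A B :: rmat
  assumes "A \<in> carrier_mat d d" "B \<in> carrier_mat d d"
  shows "(a \<cdot>\<^sub>m A) * (b \<cdot>\<^sub>m B) = (a * b) \<cdot>\<^sub>m (A * B)"
proof -
  have "b \<cdot>\<^sub>m (a \<cdot>\<^sub>m C) = (a * b) \<cdot>\<^sub>m C" for C :: rmat by (rule eq_matI) auto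
  then show ?thesis
    using assms by (simp add: mult_smult_distrib[of _ d d _ d] mult_smult_assoc_mat[of _ d d _ d])
qed

lemma scaled_weight:
  assumes V: "matrix_weight n d V" and w: "w \<in> borel_measurable (leb n)" "\<And>x. 0 < w x"
  shows "matrix_weight n d (\<lambda>x. w x \<cdot>\<^sub>m V x)"
    and "\<And>x y. x \<in> space (leb n) \<Longrightarrow> y \<in> space (leb n) \<Longrightarrow>
      weight_ratio (\<lambda>x. w x \<cdot>\<^sub>m V x) x y = w x / w y * weight_ratio V x y"
proof -
  note V' = matrix_weightD[OF V]
  note c = V'(2) mat_powr_carrier[OF V'(1), of _ "-1"]
  have inv: "mat_powr (w x \<cdot>\<^sub>m V x) (-1) = (1 / w x) \<cdot>\<^sub>m mat_powr (V x) (-1)" if "x \<in> space (leb n)" for x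
    using mat_powr_smult[OF V'(1)[OF that], of "w x" "-1"] w(2)[of x] by (simp add: powr_minus_divide less_imp_le)
  have prod: "(w x \<cdot>\<^sub>m V x) * mat_powr (w y \<cdot>\<^sub>m V y) (-1) = (w x / w y) \<cdot>\<^sub>m (V x * mat_powr (V y) (-1))"
    if "x \<in> space (leb n)" "y \<in> space (leb n)" for x y
    unfolding inv[OF that(2)] smult_mult_smult_mat[OF c(1)[OF that(1)] c(2)[OF that(2)]] by simp
  show "weight_ratio (\<lambda>x. w x \<cdot>\<^sub>m V x) x y = w x / w y * weight_ratio V x y"
    if "x \<in> space (leb n)" "y \<in> space (leb n)" for x y
    unfolding weight_ratio_def prod[OF that] using w(2)[of x] w(2)[of y] by simp
  have "(\<lambda>x. (w x \<cdot>\<^sub>m V x) $$ (i,j)) \<in> borel_measurable (leb n)" if ij: "i < d" "j < d" for i j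
  proof -
    have "(\<lambda>x. w x * V x $$ (i,j)) \<in> borel_measurable (leb n)" using V'(3)[OF ij] w(1) by measurable
    moreover have "(w x \<cdot>\<^sub>m V x) $$ (i,j) = w x * V x $$ (i,j)" if "x \<in> space (leb n)" for x
      using V'(2)[OF that] ij by simp
    ultimately show ?thesis by (simp cong: measurable_cong)
  qed
  moreover have "AE x in leb n. invertible_mat (w x \<cdot>\<^sub>m V x)"
    using matrix_weight_inverse_AE[OF V] AE_space
  proof eventually_elim
    case (elim x)
    let ?A = "w x \<cdot>\<^sub>m V x" and ?B = "(1 / w x) \<cdot>\<^sub>m mat_powr (V x) (-1)"
    note cx = c[OF elim(3)]
    have one: "(w x * (1 / w x)) \<cdot>\<^sub>m (1\<^sub>m d :: rmat) = 1\<^sub>m d" using w(2)[of x] by (intro eq_matI) auto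
    have "?A * ?B = 1\<^sub>m d" "?B * ?A = 1\<^sub>m d"
      using smult_mult_smult_mat[OF cx, of "w x" "1 / w x"] smult_mult_smult_mat[OF cx(2,1), of "1 / w x" "w x"]
        elim(1,2) one by (simp_all add: mult.commute)
    then have "inverts_mat ?A ?B" "inverts_mat ?B ?A" using cx by (simp_all add: inverts_mat_def)
    then show ?case unfolding invertible_mat_def using cx by auto
  qed
  ultimately show "matrix_weight n d (\<lambda>x. w x \<cdot>\<^sub>m V x)"
    using V'(1) psd_smult w(2) by (auto simp: matrix_weight_def less_imp_le)
qed

lemma l1norm_unit_vec: "j < d \<Longrightarrow> l1norm (unit_vec d j) = 1"
  by (simp add: l1norm_def unit_vec_def if_distrib cong: if_cong)

lemma mat_unit_vec_col: "A \<in> carrier_mat m d \<Longrightarrow> j < d \<Longrightarrow> A *\<^sub>v unit_vec d j = col (A :: rmat) j"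
  by (intro eq_vecI) (auto simp: scalar_prod_right_unit)

text \<open>The kernel is at most \<open>|V(x) P| |Q V(y)\<^sup>-\<^sup>1|\<close>, where
  \<open>Q\<close> is a reducing matrix of the weight \<open>H V\<close> on \<open>B\<close> and
  \<open>P\<close> its inverse. The first factor has a controlled integral because the columns
  of \<open>P\<close> are in the unit ball. The second is at most a multiple of
  \<open>J(y)\<^sup>1\<^sup>/\<^sup>a\<close>, since \<open>J(y)\<close> dominates the integral
  at each column of \<open>V(y)\<^sup>-\<^sup>1\<close>. It is stated through an upper bound
  \<open>R\<close> for this root, which avoids roots of extended reals.\<close>

lemma weight_reducing_matrix:
  assumes d: "1 \<le> d" and a: "0 < a" and mV: "matrix_weight n d V"
    and B: "B \<in> sets (leb n)" "emeasure (leb n) B \<noteq> 0"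
    and H: "H \<in> borel_measurable (leb n)" "\<And>x. 0 < H x"
  defines "J \<equiv> \<lambda>y. \<integral>\<^sup>+x\<in>B. ennreal ((H x * weight_ratio V x y) powr a) \<partial>leb n"
  assumes fin: "AE y\<in>B in leb n. J y < \<infinity>"
  obtains P where "P \<in> carrier_mat d d"
    "(\<integral>\<^sup>+x\<in>B. ennreal ((H x * entry_norm (V x * P)) powr a) \<partial>leb n) \<le> ennreal (real d powr (a + 1))"
    "\<And>x y R. x \<in> space (leb n) \<Longrightarrow> y \<in> space (leb n) \<Longrightarrow> 0 \<le> R \<Longrightarrow> J y \<le> ennreal (R powr a) \<Longrightarrow>
       weight_ratio V x y \<le> 2 * real d ^ 2 * R * entry_norm (V x * P)"
proof -
  define U where "U = weight_powr V (-1)"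
  have ratio: "weight_ratio V x y = entry_norm (V x * U y)" for x y
    by (simp add: weight_ratio_def U_def weight_powr_def)
  have mU: "matrix_weight n d U" unfolding U_def by (rule matrix_weight_inverse[OF mV])
  note V = matrix_weightD[OF mV] and U = matrix_weightD[OF mU]
  have inB: "x \<in> space (leb n)" if "x \<in> B" for x using that B(1) sets.sets_into_space by blast
  have UV: "AE x\<in>B in leb n. U x * V x = 1\<^sub>m d"
    using matrix_weight_inverse_AE(2)[OF mV] by eventually_elim (simp add: U_def weight_powr_def)
  define Y where "Y x = H x \<cdot>\<^sub>m V x" for x
  define Z where "Z x = (1 / H x) \<cdot>\<^sub>m U x" for x
  have mY: "matrix_weight n d Y" unfolding Y_def using scaled_weight(1)[OF mV H] .
  have mZ: "matrix_weight n d Z" unfolding Z_def using scaled_weight(1)[OF mU, of "\<lambda>x. 1 / H x"] H by simp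
  note Y = matrix_weightD[OF mY] and Z = matrix_weightD[OF mZ]
  have ZY: "AE x\<in>B in leb n. Z x * Y x = 1\<^sub>m d"
    using UV AE_space
  proof eventually_elim
    case (elim x)
    have "Z x * Y x = (1 / H x * H x) \<cdot>\<^sub>m (U x * V x)"
      unfolding Y_def Z_def by (rule smult_mult_smult_mat[OF U(2)[OF elim(2)] V(2)[OF elim(2)]])
    then show ?case using elim(1) H(2)[of x] by (auto intro!: eq_matI)
  qed
  have Yv: "l1norm (Y x *\<^sub>v v) = H x * l1norm (V x *\<^sub>v v)" if "x \<in> space (leb n)" "v \<in> carrier_vec d" for x v
  proof -
    have "Y x *\<^sub>v v = H x \<cdot>\<^sub>v (V x *\<^sub>v v)"
      unfolding Y_def using V(2)[OF that(1)] that(2) by (intro eq_vecI) auto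
    then show ?thesis using H(2)[of x] by simp
  qed
  define \<rho> where "\<rho> v = (\<integral>\<^sup>+x\<in>B. ennreal (l1norm (Y x *\<^sub>v v) powr a) \<partial>leb n)" for v
  have rho_col: "\<rho> (U y *\<^sub>v v) \<le> ennreal (l1norm v powr a) * J y"
    if y: "y \<in> space (leb n)" and v: "v \<in> carrier_vec d" for y v
  proof -
    have "\<rho> (U y *\<^sub>v v) \<le> (\<integral>\<^sup>+x. ennreal (l1norm v powr a) * (ennreal ((H x * weight_ratio V x y) powr a) * indicator B x) \<partial>leb n)"
      unfolding \<rho>_def
    proof (rule nn_integral_mono)
      fix x assume x: "x \<in> space (leb n)"
      have "l1norm (Y x *\<^sub>v (U y *\<^sub>v v)) = H x * l1norm ((V x * U y) *\<^sub>v v)"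
        using Yv[OF x, of "U y *\<^sub>v v"] U(2)[OF y] v assoc_mult_mat_vec[OF V(2)[OF x] U(2)[OF y] v]
        by (simp add: mult_mat_vec_carrier[of _ d d])
      also have "\<dots> \<le> H x * (weight_ratio V x y * l1norm v)"
        unfolding ratio using U(2)[OF y] V(2)[OF x] v H(2)[of x]
        by (intro mult_left_mono l1norm_mult) (auto intro: less_imp_le)
      finally have "l1norm (Y x *\<^sub>v (U y *\<^sub>v v)) powr a \<le> (l1norm v * (H x * weight_ratio V x y)) powr a"
        using a by (intro powr_mono2) (auto simp: mult_ac)
      then show "ennreal (l1norm (Y x *\<^sub>v (U y *\<^sub>v v)) powr a) * indicator B x
        \<le> ennreal (l1norm v powr a) * (ennreal ((H x * weight_ratio V x y) powr a) * indicator B x)"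
        using H(2)[of x] by (simp add: indicator_def powr_mult ennreal_mult[symmetric] ennreal_leI)
    qed
    also have "\<dots> = ennreal (l1norm v powr a) * J y"
      unfolding J_def using measurable_weight_ratio(3)[OF mV y] B(1) H(1) by (intro nn_integral_cmult) auto
    finally show ?thesis .
  qed
  have "AE y\<in>B in leb n. U y * V y = 1\<^sub>m d \<and> J y < \<infinity>" using UV fin by eventually_elim auto
  then obtain y0 where y0: "y0 \<in> B" "U y0 * V y0 = 1\<^sub>m d \<and> J y0 < \<infinity>"
    by (rule ex_in_nonnull[OF B])
  have fin_unit: "\<rho> (unit_vec d i) < \<infinity>" if "i < d" for i
  proof -
    note y0s = inB[OF y0(1)]
    have "U y0 *\<^sub>v (V y0 *\<^sub>v unit_vec d i) = unit_vec d i"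
      using assoc_mult_mat_vec[OF U(2)[OF y0s] V(2)[OF y0s], of "unit_vec d i"] y0(2) by simp
    then have "\<rho> (unit_vec d i) \<le> ennreal (l1norm (V y0 *\<^sub>v unit_vec d i) powr a) * J y0"
      using rho_col[OF y0s, of "V y0 *\<^sub>v unit_vec d i"] V(2)[OF y0s] by auto
    also have "\<dots> < \<infinity>" using y0(2) by (simp add: ennreal_mult_less_top)
    finally show ?thesis .
  qed
  obtain P Q where PQ: "P \<in> carrier_mat d d" "Q \<in> carrier_mat d d" "P * Q = 1\<^sub>m d"
    "\<And>j. j < d \<Longrightarrow> \<rho> (col P j) \<le> 1"
    "\<And>v R k. v \<in> carrier_vec d \<Longrightarrow> 0 \<le> R \<Longrightarrow> \<rho> v \<le> ennreal (R powr a) \<Longrightarrow> k < d \<Longrightarrow> \<bar>(Q *\<^sub>v v) $ k\<bar> \<le> 2 * R"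
  proof (rule reducing_matrix[of a B "leb n" d Y Z, folded \<rho>_def])
  qed (use a B d Y(2,3) Z(2,3) ZY fin_unit in auto)
  have "(\<integral>\<^sup>+x\<in>B. ennreal ((H x * entry_norm (V x * P)) powr a) \<partial>leb n) \<le> ennreal (real d powr (a + 1))"
  proof -
    let ?c = "\<lambda>j x. ennreal (l1norm (Y x *\<^sub>v col P j) powr a) * indicator B x"
    have mcol: "?c j \<in> borel_measurable (leb n)" if "j < d" for j
    proof -
      have "(\<lambda>x. l1norm (Y x *\<^sub>v col P j)) \<in> borel_measurable (leb n)"
      proof (rule measurable_vnorm(2)[of _ _ d])
        show "(\<lambda>x. (Y x *\<^sub>v col P j) $ i) \<in> borel_measurable (leb n)" if "i < d" for i
          using measurable_mult_mat_vec_entry[of "leb n" Y d "\<lambda>_. col P j" i] Y(2,3) PQ(1) that by auto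
      qed (use Y(2) PQ(1) in \<open>auto intro!: mult_mat_vec_carrier\<close>)
      then show ?thesis using B(1) by auto
    qed
    have "(\<integral>\<^sup>+x\<in>B. ennreal ((H x * entry_norm (V x * P)) powr a) \<partial>leb n) \<le> (\<integral>\<^sup>+x. ennreal (real d powr a) * (\<Sum>j<d. ?c j x) \<partial>leb n)"
    proof (rule nn_integral_mono)
      fix x assume x: "x \<in> space (leb n)"
      have "H x * entry_norm (V x * P) = (\<Sum>j<d. l1norm (Y x *\<^sub>v col P j))"
        using V(2)[OF x] PQ(1)
        by (auto simp: entry_norm_cols col_mult2[OF V(2)[OF x] PQ(1)] Yv[OF x] sum_distrib_left intro!: sum.cong)
      then have "(H x * entry_norm (V x * P)) powr a \<le> real d powr a * (\<Sum>j<d. l1norm (Y x *\<^sub>v col P j) powr a)"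
        using sum_powr_le[of d "\<lambda>j. l1norm (Y x *\<^sub>v col P j)" a] a by simp
      then show "ennreal ((H x * entry_norm (V x * P)) powr a) * indicator B x \<le> ennreal (real d powr a) * (\<Sum>j<d. ?c j x)"
        by (simp add: indicator_def sum_nonneg ennreal_mult[symmetric] ennreal_leI)
    qed
    also have "\<dots> = ennreal (real d powr a) * (\<Sum>j<d. \<rho> (col P j))"
      unfolding \<rho>_def by (subst nn_integral_cmult[OF borel_measurable_sum], use mcol in blast, subst nn_integral_sum, use mcol in auto)
    also have "\<dots> \<le> ennreal (real d powr a) * (\<Sum>j<d. 1)" using PQ(4) by (intro mult_left_mono sum_mono) auto
    also have "\<dots> = ennreal (real d powr (a + 1))"
      using d by (simp add: ennreal_of_nat_eq_real_of_nat ennreal_mult[symmetric] powr_add)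
    finally show ?thesis .
  qed
  moreover have "weight_ratio V x y \<le> 2 * real d ^ 2 * R * entry_norm (V x * P)"
    if x: "x \<in> space (leb n)" and y: "y \<in> space (leb n)" and R: "0 \<le> R" "J y \<le> ennreal (R powr a)" for x y R
  proof -
    have "entry_norm (Q * U y) \<le> real d ^ 2 * (2 * R)"
    proof (rule entry_norm_mult_bound[OF PQ(2) U(2)[OF y]])
      fix j k assume jk: "j < d" "k < d"
      have "\<rho> (col (U y) j) \<le> ennreal (R powr a)"
        using rho_col[OF y unit_vec_carrier[of d j]] jk R(2)
        by (simp add: l1norm_unit_vec mat_unit_vec_col[OF U(2)[OF y]])
      then show "\<bar>(Q *\<^sub>v col (U y) j) $ k\<bar> \<le> 2 * R"
        by (intro PQ(5)) (use R jk U(2)[OF y] in auto)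
    qed
    moreover have "(V x * P) * (Q * U y) = V x * ((P * Q) * U y)"
      using V(2)[OF x] U(2)[OF y] PQ(1,2) by (simp add: assoc_mult_mat[of _ d d _ d _ d])
    then have "weight_ratio V x y \<le> entry_norm (V x * P) * entry_norm (Q * U y)"
      unfolding ratio using entry_norm_mult[of "V x * P" d d "Q * U y" d] V(2)[OF x] U(2)[OF y] PQ(1-3) by auto
    ultimately have "weight_ratio V x y \<le> entry_norm (V x * P) * (real d ^ 2 * (2 * R))"
      by (meson entry_norm_nonneg mult_left_mono order_trans)
    then show ?thesis by (simp add: mult_ac)
  qed
  ultimately show ?thesis using that PQ(1) by blast
qed

section \<open>Duality of the Muckenhoupt classes\<close>

text \<open>For \<open>d = 1\<close> the kernel is a product and the two constants coincide. In
  general the constant of the inverse weight has the two averages in the opposite order;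
  \<open>weight_reducing_matrix\<close> makes the kernel a product up to a dimensional constant.
  The measure \<open>m\<close> of \<open>B\<close> cancels, so that the bound is uniform in
  \<open>B\<close>.\<close>

lemma dual_weight_class:
  assumes d: "1 \<le> d" and \<B>: "basis n \<B>" and r: "1 < r" and VA: "V \<in> A_class n d \<B> (ereal r)"
  shows "weight_powr V (-1) \<in> A_class n d \<B> (ereal (r / (r - 1)))"
proof -
  define U where "U = weight_powr V (-1)"
  have mV: "matrix_weight n d V" and fin: "A_const n \<B> (ereal r) V < \<infinity>"
    using VA by (auto simp: A_class_def)
  have mU: "matrix_weight n d U" unfolding U_def by (rule matrix_weight_inverse[OF mV])
  note V = matrix_weightD[OF mV] and U = matrix_weightD[OF mU]
  have VU: "mat_powr (V x) (-1) = U x" for x by (simp add: U_def weight_powr_def)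
  define a where "a = r / (r - 1)"
  have a: "1 < a" "a * (r - 1) = r" "r * (a - 1) = a" "(r - 1) * (a - 1) = 1" "a / (a - 1) = r" "r / a = r - 1"
    using r by (auto simp: a_def field_simps)
  obtain A where A: "A_const n \<B> (ereal r) V = ennreal A" "0 \<le> A" using fin by (cases "A_const n \<B> (ereal r) V") auto
  define d2 where "d2 = real d ^ 2"
  have d2: "1 \<le> d2" using d by (simp add: d2_def)
  \<comment> \<open>Of the powers below, \<open>2 d\<^sup>2\<close> and
    \<open>d\<^sup>a\<^sup>+\<^sup>1\<close> come from the reducing matrix and
    \<open>d\<^sup>2\<close> from the comparison of the norms.\<close>
  define Cst where "Cst = (2 * d2) powr a * real d powr (a + 1) * d2 powr a * A powr a"
  have main: "avg (leb n) B (\<lambda>x. ennpow (avg (leb n) B (\<lambda>y. ennpow (opnorm (U x * mat_powr (U y) (-1))) (a / (a - 1)))) (a - 1))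
     \<le> ennreal Cst" if B: "B \<in> \<B>" for B
  proof (cases "emeasure (leb n) B = 0")
    case True
    then show ?thesis using avg_null[OF basisD(1)[OF \<B> B]] by simp
  next
    case False
    note Bs = basisD[OF \<B> B]
    obtain m where m: "emeasure (leb n) B = ennreal m" "0 < m"
      using False Bs(2) by (cases "emeasure (leb n) B") (auto simp: less_le)
    have inB: "x \<in> space (leb n)" if "x \<in> B" for x using that Bs(3) by auto
    define I where "I x = avg (leb n) B (\<lambda>y. ennpow (opnorm (V x * U y)) a)" for x
    define J where "J x = (\<integral>\<^sup>+y\<in>B. ennreal ((1 * weight_ratio U y x) powr a) \<partial>leb n)" for x
    have mI: "I \<in> borel_measurable (leb n)" unfolding I_def
      by (rule measurable_avg_leb[OF Bs(1)]) (use measurable_ennpow[OF measurable_weight_pair(1)[OF mV mU], of a] in \<open>simp add: case_prod_unfold\<close>)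
    have JI: "J x \<le> ennreal (d2 powr a * m) * I x" if x: "x \<in> space (leb n)" for x
    proof -
      have "J x \<le> (\<integral>\<^sup>+y. ennreal (d2 powr a) * (ennpow (opnorm (V x * U y)) a * indicator B y) \<partial>leb n)"
        unfolding J_def
      proof (rule nn_integral_mono)
        fix y assume y: "y \<in> space (leb n)"
        have "weight_ratio U y x = entry_norm (V x * U y)"
          unfolding U_def weight_ratio_inverse[OF mV y x] by (simp add: weight_ratio_def weight_powr_def)
        then have "ennreal (weight_ratio U y x) \<le> ennreal d2 * opnorm (V x * U y)"
          unfolding d2_def using entry_norm_le_opnorm[OF mult_carrier_mat[OF V(2)[OF x] U(2)[OF y]]] by simp
        then have "ennpow (ennreal (weight_ratio U y x)) a \<le> ennpow (ennreal d2 * opnorm (V x * U y)) a"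
          using a by (intro ennpow_mono) auto
        then show "ennreal ((1 * weight_ratio U y x) powr a) * indicator B y
          \<le> ennreal (d2 powr a) * (ennpow (opnorm (V x * U y)) a * indicator B y)"
          using d2 by (auto simp: ennpow_mult indicator_def)
      qed
      also have "\<dots> = ennreal (d2 powr a) * (\<integral>\<^sup>+y\<in>B. ennpow (opnorm (V x * U y)) a \<partial>leb n)"
        by (intro nn_integral_cmult borel_measurable_times_ennreal measurable_ennpow
            measurable_weight_section[OF mV mU x] borel_measurable_indicator Bs(1))
      also have "\<dots> = ennreal (d2 powr a) * (I x * ennreal m)"
        unfolding I_def using set_nn_integral_avg[OF False Bs(2)] m by simp
      finally show ?thesis using m by (simp add: ennreal_mult mult_ac)
    qed
    have "ennpow (avg (leb n) B (\<lambda>x. ennpow (I x) (r - 1))) (1 / r) \<le> ennreal A"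
      unfolding A(1)[symmetric] A_const_real[OF r] I_def VU a_def using B by (rule SUP_upper)
    then have "ennpow (ennpow (avg (leb n) B (\<lambda>x. ennpow (I x) (r - 1))) (1 / r)) r \<le> ennpow (ennreal A) r"
      using r by (intro ennpow_mono) auto
    then have avI: "avg (leb n) B (\<lambda>x. ennpow (I x) (r - 1)) \<le> ennreal (A powr r)"
      using r A(2) by (simp add: ennpow_inverse)
    define c1 where "c1 = (d2 powr a * m) powr (r - 1) * A powr r"
    have avJ: "avg (leb n) B (\<lambda>x. ennpow (J x) (r - 1)) \<le> ennreal c1"
    proof -
      have "avg (leb n) B (\<lambda>x. ennpow (J x) (r - 1)) \<le> avg (leb n) B (\<lambda>x. ennreal ((d2 powr a * m) powr (r - 1)) * ennpow (I x) (r - 1))"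
      proof (rule avg_mono_AE, rule AE_I2, rule impI)
        fix x assume "x \<in> space (leb n)"
        from JI[OF this] have "ennpow (J x) (r - 1) \<le> ennpow (ennreal (d2 powr a * m) * I x) (r - 1)"
          using r by (intro ennpow_mono) auto
        then show "ennpow (J x) (r - 1) \<le> ennreal ((d2 powr a * m) powr (r - 1)) * ennpow (I x) (r - 1)"
          using m by (simp add: ennpow_mult)
      qed
      also have "\<dots> = ennreal ((d2 powr a * m) powr (r - 1)) * avg (leb n) B (\<lambda>x. ennpow (I x) (r - 1))"
        by (intro avg_cmult measurable_ennpow mI Bs(1))
      also have "\<dots> \<le> ennreal ((d2 powr a * m) powr (r - 1)) * ennreal (A powr r)"
        using avI by (intro mult_left_mono) auto
      finally show ?thesis by (simp add: c1_def ennreal_mult)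
    qed
    have Jfin: "AE x\<in>B in leb n. J x < \<infinity>"
    proof -
      have "(\<integral>\<^sup>+x. ennpow (I x) (r - 1) * indicator B x \<partial>leb n) \<noteq> \<infinity>"
        using avg_less_top_iff[OF False Bs(2)] avI by (metis ennreal_less_top infinity_ennreal_def order.strict_trans1 less_irrefl)
      then have "AE x in leb n. ennpow (I x) (r - 1) * indicator B x \<noteq> \<infinity>"
        by (intro nn_integral_PInf_AE borel_measurable_times_ennreal measurable_ennpow mI
            borel_measurable_indicator Bs(1))
      then show ?thesis
      proof (eventually_elim, intro impI)
        fix x assume I: "ennpow (I x) (r - 1) * indicator B x \<noteq> \<infinity>" and x: "x \<in> B"
        then have "ennpow (I x) (r - 1) < top" by (simp add: less_top)
        then have "ennreal (d2 powr a * m) * I x < \<infinity>" by (simp add: ennreal_mult_less_top)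
        then show "J x < \<infinity>" using JI[OF inB[OF x]] by (rule order.strict_trans1[rotated])
      qed
    qed
    obtain P where P: "P \<in> carrier_mat d d"
      "(\<integral>\<^sup>+x\<in>B. ennreal ((1 * entry_norm (U x * P)) powr a) \<partial>leb n) \<le> ennreal (real d powr (a + 1))"
      "\<And>x y R. x \<in> space (leb n) \<Longrightarrow> y \<in> space (leb n) \<Longrightarrow> 0 \<le> R \<Longrightarrow> J y \<le> ennreal (R powr a) \<Longrightarrow>
         weight_ratio U x y \<le> 2 * real d ^ 2 * R * entry_norm (U x * P)"
      by (rule weight_reducing_matrix[OF d _ mU Bs(1) False, of a "\<lambda>_. 1", folded J_def])
        (use a Jfin in auto)
    have mJ: "J \<in> borel_measurable (leb n)"
    proof -
      have "(\<lambda>(x, y). ennreal ((1 * weight_ratio U y x) powr a)) \<in> borel_measurable (leb n \<Otimes>\<^sub>M leb n)"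
        using measurable_compose[OF measurable_pair_swap' measurable_weight_ratio(1)[OF mU]] by (simp add: case_prod_unfold)
      from measurable_avg_leb[OF Bs(1) this]
      have "(\<lambda>x. avg (leb n) B (\<lambda>y. ennreal ((1 * weight_ratio U y x) powr a)) * ennreal m) \<in> borel_measurable (leb n)"
        by measurable
      then show ?thesis unfolding J_def[abs_def] set_nn_integral_avg[OF False Bs(2)] m(1) .
    qed
    let ?in = "\<lambda>x. avg (leb n) B (\<lambda>y. ennpow (opnorm (U x * mat_powr (U y) (-1))) (a / (a - 1)))"
    have inner: "?in x \<le> ennreal ((2 * d2 * entry_norm (U x * P)) powr r * c1)" if x: "x \<in> space (leb n)" for x
    proof -
      let ?e = "2 * d2 * entry_norm (U x * P)"
      have "?in x \<le> avg (leb n) B (\<lambda>y. ennreal (?e powr r) * ennpow (J y) (r - 1))"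
      proof (rule avg_mono_AE, use Jfin in eventually_elim, intro impI)
        fix y assume Jy: "y \<in> B \<longrightarrow> J y < \<infinity>" and y: "y \<in> B"
        then obtain b where b: "J y = ennreal b" "0 \<le> b" by (cases "J y") auto
        have "weight_ratio U x y \<le> 2 * real d ^ 2 * b powr (1 / a) * entry_norm (U x * P)"
          using b a by (intro P(3)[OF x inB[OF y]]) (auto simp: powr_powr)
        also have "\<dots> = ?e * b powr (1 / a)" by (simp add: d2_def)
        finally have "weight_ratio U x y powr r \<le> (?e * b powr (1 / a)) powr r"
          using r by (intro powr_mono2) auto
        also have "\<dots> = ?e powr r * b powr (r - 1)"
          using d2 a by (simp add: powr_mult powr_powr)
        finally have 1: "ennreal (weight_ratio U x y powr r) \<le> ennreal (?e powr r) * ennpow (J y) (r - 1)"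
          using b by (simp add: ennreal_mult[symmetric] ennreal_leI)
        have "ennpow (opnorm (U x * mat_powr (U y) (-1))) r \<le> ennpow (ennreal (weight_ratio U x y)) r"
          unfolding weight_ratio_def using r by (intro ennpow_mono opnorm_le_entry_norm) auto
        then show "ennpow (opnorm (U x * mat_powr (U y) (-1))) (a / (a - 1)) \<le> ennreal (?e powr r) * ennpow (J y) (r - 1)"
          unfolding a(5) using 1 by simp
      qed
      also have "\<dots> = ennreal (?e powr r) * avg (leb n) B (\<lambda>y. ennpow (J y) (r - 1))"
        by (intro avg_cmult measurable_ennpow mJ Bs(1))
      also have "\<dots> \<le> ennreal (?e powr r) * ennreal c1" using avJ by (intro mult_left_mono) auto
      finally show ?thesis by (simp add: ennreal_mult' c1_def)
    qed
    have c1: "0 \<le> c1" by (simp add: c1_def)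
    have mUPe: "(\<lambda>x. entry_norm (U x * P)) \<in> borel_measurable (leb n)"
    proof (rule measurable_entry_norm)
      show "(\<lambda>x. (U x * P) $$ (i,j)) \<in> borel_measurable (leb n)" if "i < d" "j < d" for i j
        using measurable_mult_mat_entry[of "leb n" U d "\<lambda>_. P" i j] U(2,3) P(1) that by auto
    qed (use U(2) P(1) in \<open>auto intro!: mult_carrier_mat\<close>)
    define c2 where "c2 = (2 * d2) powr a * c1 powr (a - 1)"
    have c2: "0 \<le> c2" by (simp add: c2_def)
    have "avg (leb n) B (\<lambda>x. ennpow (?in x) (a - 1)) \<le> avg (leb n) B (\<lambda>x. ennreal c2 * ennreal ((1 * entry_norm (U x * P)) powr a))"
    proof (rule avg_mono_AE, rule AE_I2, rule impI)
      fix x assume x: "x \<in> space (leb n)"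
      have "ennpow (?in x) (a - 1) \<le> ennpow (ennreal ((2 * d2 * entry_norm (U x * P)) powr r * c1)) (a - 1)"
        using inner[OF x] a by (intro ennpow_mono) auto
      also have "\<dots> = ennreal c2 * ennreal ((1 * entry_norm (U x * P)) powr a)"
        using c1 d2 a by (simp add: powr_mult powr_powr c2_def ennreal_mult[symmetric])
      finally show "ennpow (?in x) (a - 1) \<le> ennreal c2 * ennreal ((1 * entry_norm (U x * P)) powr a)" .
    qed
    also have "\<dots> = ennreal c2 * avg (leb n) B (\<lambda>x. ennreal ((1 * entry_norm (U x * P)) powr a))"
      using mUPe Bs(1) by (intro avg_cmult) auto
    also have "\<dots> \<le> ennreal c2 * (ennreal (real d powr (a + 1)) / ennreal m)"
      unfolding avg_def m(1) using P(2) by (intro mult_left_mono divide_right_mono_ennreal) auto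
    also have "\<dots> = ennreal (c2 * (real d powr (a + 1) / m))"
      using c2 divide_ennreal[of "real d powr (a + 1)" m] m(2) by (simp add: ennreal_mult[symmetric])
    also have "c2 * (real d powr (a + 1) / m) = Cst"
    proof -
      have "c1 powr (a - 1) = d2 powr a * m * A powr a"
        using a m(2) A(2) by (simp add: c1_def powr_mult powr_powr)
      then show ?thesis using m(2) by (simp add: c2_def Cst_def)
    qed
    finally show ?thesis .
  qed
  have "A_const n \<B> (ereal a) U \<le> ennpow (ennreal Cst) (1 / a)"
    unfolding A_const_real[OF a(1)] using main a by (intro SUP_least ennpow_mono) auto
  also have "\<dots> < \<infinity>" by simp
  finally show ?thesis using mU by (simp add: A_class_def U_def a_def)
qed

section \<open>Rubio de Francia iteration\<close>

text \<open>Up to the factor \<open>d\<close>, a majorant of all averages of \<open>h\<close>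
  against the kernel of \<open>V\<close>. A supremum of these averages over an uncountable basis
  need not be measurable, whereas the maximal functions of the definition are.\<close>

definition scalar_max :: "nat \<Rightarrow> nat \<Rightarrow> pt set set \<Rightarrow> (pt \<Rightarrow> rmat) \<Rightarrow> (pt \<Rightarrow> real) \<Rightarrow> pt \<Rightarrow> ennreal" where
  "scalar_max n d \<B> V h x = (\<Sum>i<d. CG_max n \<B> V (\<lambda>y. h y \<cdot>\<^sub>v unit_vec d i) x)"

lemma ennpow_sum_le:
  assumes "0 < a"
  shows "ennpow (\<Sum>i<d. c i) a \<le> ennreal (real d powr a) * (\<Sum>i<d. ennpow (c i) a)"
proof -
  define S where "S = (\<Sum>i<d. ennpow (c i) a)"
  have "c i \<le> ennpow S (1 / a)" if "i < d" for i
  proof -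
    have "ennpow (c i) a \<le> S" unfolding S_def using that by (intro member_le_sum) auto
    then have "ennpow (ennpow (c i) a) (1 / a) \<le> ennpow S (1 / a)" using assms by (intro ennpow_mono) auto
    then show ?thesis using assms by (simp add: ennpow_inverse)
  qed
  then have "(\<Sum>i<d. c i) \<le> (\<Sum>i<d. ennpow S (1 / a))" by (intro sum_mono) auto
  also have "\<dots> = ennreal (real d) * ennpow S (1 / a)" by (simp add: ennreal_of_nat_eq_real_of_nat)
  finally have "ennpow (\<Sum>i<d. c i) a \<le> ennpow (ennreal (real d) * ennpow S (1 / a)) a"
    using assms by (intro ennpow_mono) auto
  also have "\<dots> = ennreal (real d powr a) * S" using assms by (simp add: ennpow_mult ennpow_inverse)
  finally show ?thesis by (simp add: S_def)
qed

lemma scalar_multiple_vec_fun: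
  assumes [measurable]: "h \<in> borel_measurable (leb n)"
  shows "(\<lambda>y. h y \<cdot>\<^sub>v unit_vec d i) \<in> vec_fun n d"
proof -
  have "(\<lambda>y. h y * (if j = i then 1 else 0)) \<in> borel_measurable (leb n)" for j by measurable
  then have "(\<lambda>y. (h y \<cdot>\<^sub>v unit_vec d i) $ j) \<in> borel_measurable (leb n)" if "j < d" for j
    using that by (simp add: unit_vec_def)
  then show ?thesis by (auto simp: vec_fun_def)
qed

lemma Lnorm_real: "Lnorm M (ereal t) g = ennpow (\<integral>\<^sup>+x. ennpow (g x) t \<partial>M) (1 / t)"
  by (simp add: Lnorm_def)

lemma vnorm_unit_vec [simp]: "i < d \<Longrightarrow> vnorm (unit_vec d i) = 1"
  by (simp add: vnorm_def)

lemma muckenhoupt_basisD: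
  assumes mb: "matrix_Muckenhoupt_basis n \<B> K" and d: "1 \<le> d" and t: "1 < t"
  shows "basis n \<B>"
    and "\<And>c. 0 \<le> c \<Longrightarrow> 0 \<le> K d (ereal t) c"
    and "\<And>V f. V \<in> A_class n d \<B> (ereal t) \<Longrightarrow> f \<in> vec_fun n d \<Longrightarrow>
      Lnorm (leb n) (ereal t) (\<lambda>x. ennreal (vnorm (f x))) < \<infinity> \<Longrightarrow>
      CG_max n \<B> V f \<in> borel_measurable (leb n) \<and>
      Lnorm (leb n) (ereal t) (CG_max n \<B> V f) \<le>
        ennreal (K d (ereal t) (enn2real (A_const n \<B> (ereal t) V))) * Lnorm (leb n) (ereal t) (\<lambda>x. ennreal (vnorm (f x)))"
proof -
  have dt: "1 \<le> d \<and> 1 < ereal t \<and> ereal t < \<infinity>" using d t by (simp add: one_ereal_def)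
  note * = mb[unfolded matrix_Muckenhoupt_basis_def]
  show "basis n \<B>" using * by blast
  note ** = *[THEN conjunct2, rule_format, OF dt]
  show "0 \<le> c \<Longrightarrow> 0 \<le> K d (ereal t) c" for c using ** by blast
  show "V \<in> A_class n d \<B> (ereal t) \<Longrightarrow> f \<in> vec_fun n d \<Longrightarrow>
      Lnorm (leb n) (ereal t) (\<lambda>x. ennreal (vnorm (f x))) < \<infinity> \<Longrightarrow>
      CG_max n \<B> V f \<in> borel_measurable (leb n) \<and>
      Lnorm (leb n) (ereal t) (CG_max n \<B> V f) \<le>
        ennreal (K d (ereal t) (enn2real (A_const n \<B> (ereal t) V))) * Lnorm (leb n) (ereal t) (\<lambda>x. ennreal (vnorm (f x)))" for V f
    using ** by blast
qed

text \<open>The bound \<open>L\<close> may be larger than the norm of the operator, so that it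
  can be positive when the norm is zero.\<close>

lemma scalar_max_bound:
  assumes d: "1 \<le> d" and mb: "matrix_Muckenhoupt_basis n \<B> K" and t: "1 < t"
    and VA: "V \<in> A_class n d \<B> (ereal t)"
    and h: "h \<in> borel_measurable (leb n)" "\<And>x. 0 \<le> h x"
    and fin: "(\<integral>\<^sup>+x. ennreal (h x powr t) \<partial>leb n) < \<infinity>"
    and L: "real d ^ 2 * K d (ereal t) (enn2real (A_const n \<B> (ereal t) V)) \<le> L"
  shows "scalar_max n d \<B> V h \<in> borel_measurable (leb n)"
    "(\<integral>\<^sup>+x. ennpow (scalar_max n d \<B> V h x) t \<partial>leb n) \<le> ennreal (L powr t) * (\<integral>\<^sup>+x. ennreal (h x powr t) \<partial>leb n)"
proof -
  define k where "k = K d (ereal t) (enn2real (A_const n \<B> (ereal t) V))"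
  define I where "I = (\<integral>\<^sup>+x. ennreal (h x powr t) \<partial>leb n)"
  have k: "0 \<le> k" unfolding k_def using muckenhoupt_basisD(2)[OF mb d t] by simp
  have mu: "\<And>f. f \<in> vec_fun n d \<Longrightarrow> Lnorm (leb n) (ereal t) (\<lambda>x. ennreal (vnorm (f x))) < \<infinity> \<Longrightarrow>
     CG_max n \<B> V f \<in> borel_measurable (leb n) \<and>
     Lnorm (leb n) (ereal t) (CG_max n \<B> V f) \<le> ennreal k * Lnorm (leb n) (ereal t) (\<lambda>x. ennreal (vnorm (f x)))"
    using muckenhoupt_basisD(3)[OF mb d t VA] by (simp add: k_def)
  define c where "c i = CG_max n \<B> V (\<lambda>y. h y \<cdot>\<^sub>v unit_vec d i)" for i
  have hL: "Lnorm (leb n) (ereal t) (\<lambda>x. ennreal (vnorm (h x \<cdot>\<^sub>v unit_vec d i))) = ennpow I (1 / t)" if "i < d" for i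
    using h(2) that by (simp add: Lnorm_real I_def)
  have c: "c i \<in> borel_measurable (leb n)" "(\<integral>\<^sup>+x. ennpow (c i x) t \<partial>leb n) \<le> ennreal (k powr t) * I" if "i < d" for i
  proof -
    have "Lnorm (leb n) (ereal t) (\<lambda>x. ennreal (vnorm (h x \<cdot>\<^sub>v unit_vec d i))) < \<infinity>"
      unfolding hL[OF that] using fin by (simp add: I_def)
    from mu[OF scalar_multiple_vec_fun[OF h(1)] this]
    have 1: "c i \<in> borel_measurable (leb n)" "Lnorm (leb n) (ereal t) (c i) \<le> ennreal k * ennpow I (1 / t)"
      using hL[OF that] by (auto simp: c_def)
    show "c i \<in> borel_measurable (leb n)" by (rule 1)
    from 1(2) have "ennpow (ennpow (\<integral>\<^sup>+x. ennpow (c i x) t \<partial>leb n) (1 / t)) t \<le> ennpow (ennreal k * ennpow I (1 / t)) t"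
      unfolding Lnorm_real using t by (intro ennpow_mono) auto
    then show "(\<integral>\<^sup>+x. ennpow (c i x) t \<partial>leb n) \<le> ennreal (k powr t) * I"
      using t k by (simp add: ennpow_mult ennpow_inverse)
  qed
  have sm: "scalar_max n d \<B> V h x = (\<Sum>i<d. c i x)" for x by (simp add: scalar_max_def c_def)
  have "(\<lambda>x. \<Sum>i<d. c i x) \<in> borel_measurable (leb n)" using c(1) by (intro borel_measurable_sum) auto
  then show "scalar_max n d \<B> V h \<in> borel_measurable (leb n)" by (simp add: sm[abs_def])
  have "(\<integral>\<^sup>+x. ennpow (scalar_max n d \<B> V h x) t \<partial>leb n)
     \<le> (\<integral>\<^sup>+x. ennreal (real d powr t) * (\<Sum>i<d. ennpow (c i x) t) \<partial>leb n)"
    unfolding sm using t by (intro nn_integral_mono ennpow_sum_le) auto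
  also have "\<dots> = ennreal (real d powr t) * (\<Sum>i<d. \<integral>\<^sup>+x. ennpow (c i x) t \<partial>leb n)"
    by (subst nn_integral_cmult[OF borel_measurable_sum], use c(1) in auto, subst nn_integral_sum, use c(1) in auto)
  also have "\<dots> \<le> ennreal (real d powr t) * (\<Sum>i<d. ennreal (k powr t) * I)"
    using c(2) by (intro mult_left_mono sum_mono) auto
  also have "\<dots> = ennreal (real d powr t * (real d * k powr t)) * I"
    by (simp add: ennreal_of_nat_eq_real_of_nat ennreal_mult mult.assoc)
  also have "\<dots> \<le> ennreal (L powr t) * I"
  proof (intro mult_right_mono ennreal_leI)
    have "real d powr 1 \<le> real d powr t" using d t by (intro powr_mono) auto
    then have "real d * k powr t \<le> real d powr t * k powr t" by (intro mult_right_mono) (use d in auto)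
    then have "real d powr t * (real d * k powr t) \<le> real d powr t * (real d powr t * k powr t)"
      by (intro mult_left_mono) auto
    also have "\<dots> = (real d ^ 2 * k) powr t" using k by (simp add: powr_mult power2_eq_square)
    also have "\<dots> \<le> L powr t" using L k t unfolding k_def[symmetric] by (intro powr_mono2) auto
    finally show "real d powr t * (real d * k powr t) \<le> L powr t" .
  qed auto
  finally show "(\<integral>\<^sup>+x. ennpow (scalar_max n d \<B> V h x) t \<partial>leb n) \<le> ennreal (L powr t) * (\<integral>\<^sup>+x. ennreal (h x powr t) \<partial>leb n)"
    by (simp add: I_def)
qed

lemma avg_le_scalar_max:
  assumes V: "matrix_weight n d V" and \<B>: "basis n \<B>" "B \<in> \<B>" and x: "x \<in> B"
    and h[measurable]: "h \<in> borel_measurable (leb n)" and h0: "\<And>x. 0 \<le> h x"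
  shows "avg (leb n) B (\<lambda>y. ennreal (weight_ratio V x y * h y)) \<le> ennreal (real d) * scalar_max n d \<B> V h x"
proof -
  note mU = matrix_weight_inverse[OF V]
  note V' = matrix_weightD[OF V] and U' = matrix_weightD[OF mU, unfolded weight_powr_def]
  note Bs = basisD[OF \<B>]
  have xs: "x \<in> space (leb n)" using x Bs by auto
  define g where "g i y = ennreal (vnorm (V x *\<^sub>v (mat_powr (V y) (-1) *\<^sub>v (h y \<cdot>\<^sub>v unit_vec d i))))" for i y
  have gv: "V x *\<^sub>v (mat_powr (V y) (-1) *\<^sub>v (h y \<cdot>\<^sub>v unit_vec d i)) = h y \<cdot>\<^sub>v col (V x * mat_powr (V y) (-1)) i"
    if y: "y \<in> space (leb n)" and i: "i < d" for y i
  proof -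
    let ?C = "V x * mat_powr (V y) (-1)"
    have C: "?C \<in> carrier_mat d d" using V'(2)[OF xs] U'(2)[OF y] by (rule mult_carrier_mat)
    have "V x *\<^sub>v (mat_powr (V y) (-1) *\<^sub>v (h y \<cdot>\<^sub>v unit_vec d i)) = ?C *\<^sub>v (h y \<cdot>\<^sub>v unit_vec d i)"
      using assoc_mult_mat_vec[OF V'(2)[OF xs] U'(2)[OF y], of "h y \<cdot>\<^sub>v unit_vec d i"] by simp
    also have "\<dots> = h y \<cdot>\<^sub>v (?C *\<^sub>v unit_vec d i)" using mult_mat_vec[OF C] by simp
    also have "?C *\<^sub>v unit_vec d i = col ?C i" using C i by (intro eq_vecI) (auto simp: scalar_prod_right_unit)
    finally show ?thesis .
  qed
  have gm: "g i \<in> borel_measurable (leb n)" if i: "i < d" for i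
  proof -
    have "(\<lambda>y. (V x * mat_powr (V y) (-1)) $$ (k,i)) \<in> borel_measurable (leb n)" if "k < d" for k
      by (rule measurable_mult_mat_entry) (use V'(2)[OF xs] U'(2,3) that i in auto)
    then have "(\<lambda>y. vnorm (h y \<cdot>\<^sub>v vec d (\<lambda>k. (V x * mat_powr (V y) (-1)) $$ (k,i)))) \<in> borel_measurable (leb n)"
      by (intro measurable_vnorm(1)[of _ _ d]) auto
    moreover have "g i y = ennreal (vnorm (h y \<cdot>\<^sub>v vec d (\<lambda>k. (V x * mat_powr (V y) (-1)) $$ (k,i))))"
      if "y \<in> space (leb n)" for y
      unfolding g_def gv[OF that i] using V'(2)[OF xs] U'(2)[OF that] by (simp add: col_def)
    ultimately show ?thesis by (simp cong: measurable_cong)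
  qed
  have "avg (leb n) B (\<lambda>y. ennreal (entry_norm (V x * mat_powr (V y) (-1)) * h y))
      \<le> avg (leb n) B (\<lambda>y. ennreal (real d) * (\<Sum>i<d. g i y))"
  proof (rule avg_mono_AE, rule AE_I2, rule impI)
    fix y assume y: "y \<in> space (leb n)"
    let ?C = "V x * mat_powr (V y) (-1)"
    have C: "?C \<in> carrier_mat d d" using V'(2)[OF xs] U'(2)[OF y] by (rule mult_carrier_mat)
    have dC: "dim_col ?C = d" "dim_row ?C = d" using C by auto
    have "l1norm (col ?C i) \<le> real d * vnorm (col ?C i)" for i
      using l1norm_le_vnorm[of "col ?C i"] unfolding dim_col dC .
    then have "entry_norm ?C \<le> (\<Sum>i<d. real d * vnorm (col ?C i))"
      unfolding entry_norm_cols dC by (rule sum_mono)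
    then have "entry_norm ?C * h y \<le> (\<Sum>i<d. real d * vnorm (col ?C i)) * h y"
      using h0 by (intro mult_right_mono) auto
    also have "\<dots> = real d * (\<Sum>i<d. vnorm (h y \<cdot>\<^sub>v col ?C i))"
      using h0[of y] by (simp add: sum_distrib_left sum_distrib_right mult_ac)
    finally have "ennreal (entry_norm ?C * h y) \<le> ennreal (real d * (\<Sum>i<d. vnorm (h y \<cdot>\<^sub>v col ?C i)))"
      by (rule ennreal_leI)
    also have "\<dots> = ennreal (real d) * (\<Sum>i<d. g i y)"
    proof -
      have "(\<Sum>i<d. g i y) = (\<Sum>i<d. ennreal (vnorm (h y \<cdot>\<^sub>v col ?C i)))"
        unfolding g_def using gv[OF y] by (intro sum.cong) auto
      also have "\<dots> = ennreal (\<Sum>i<d. vnorm (h y \<cdot>\<^sub>v col ?C i))" by (rule sum_ennreal) simp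
      finally show ?thesis by (simp add: ennreal_mult sum_nonneg)
    qed
    finally show "ennreal (entry_norm ?C * h y) \<le> ennreal (real d) * (\<Sum>i<d. g i y)" .
  qed
  also have "\<dots> = ennreal (real d) * avg (leb n) B (\<lambda>y. \<Sum>i<d. g i y)"
    using gm by (intro avg_cmult Bs(1) borel_measurable_sum) auto
  also have "avg (leb n) B (\<lambda>y. \<Sum>i<d. g i y) = (\<Sum>i<d. avg (leb n) B (g i))"
  proof -
    have "(\<integral>\<^sup>+y\<in>B. (\<Sum>i<d. g i y) \<partial>leb n) = (\<Sum>i<d. \<integral>\<^sup>+y\<in>B. g i y \<partial>leb n)"
      unfolding sum_distrib_right using gm Bs(1) by (intro nn_integral_sum) auto
    then show ?thesis unfolding avg_def divide_ennreal_def by (simp add: sum_distrib_right)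
  qed
  also have "(\<Sum>i<d. avg (leb n) B (g i)) \<le> scalar_max n d \<B> V h x"
    unfolding scalar_max_def
  proof (rule sum_mono)
    fix i
    show "avg (leb n) B (g i) \<le> CG_max n \<B> V (\<lambda>y. h y \<cdot>\<^sub>v unit_vec d i) x"
      unfolding CG_max_def g_def using x \<B>(2) by (intro SUP_upper2[of B]) auto
  qed
  finally show ?thesis by (simp add: weight_ratio_def mult_left_mono)
qed

lemma avg_suminf:
  assumes "B \<in> sets M" "\<And>k. f k \<in> borel_measurable M"
  shows "avg M B (\<lambda>y. \<Sum>k. f k y) = (\<Sum>k. avg M B (f k))"
proof -
  have "(\<integral>\<^sup>+y\<in>B. (\<Sum>k. f k y) \<partial>M) = (\<Sum>k. \<integral>\<^sup>+y\<in>B. f k y \<partial>M)"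
    using assms by (subst nn_integral_suminf[symmetric]) auto
  then show ?thesis unfolding avg_def divide_ennreal_def by simp
qed

lemma suminf_ennreal_term: "f k \<le> (\<Sum>i. f i)" for f :: "nat \<Rightarrow> ennreal"
proof -
  have "sum f {k} \<le> (\<Sum>i. f i)" by (rule sum_le_suminf) auto
  then show ?thesis by simp
qed

lemma suminf_half_powers: "(\<Sum>k. ennreal ((1/2)^k)) = ennreal 2"
proof (rule suminf_ennreal_eq)
  show "(\<lambda>k. (1/2::real)^k) sums 2" using geometric_sums[of "1/2::real"] by simp
qed simp

text \<open>It takes the place of Minkowski's inequality for series: one of the two factors
  \<open>2\<^sup>-\<^sup>k\<close> of \<open>4\<^sup>-\<^sup>k\<close> makes the series
  converge, the other one dominates its own power of exponent \<open>t \<ge> 1\<close>.\<close>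

lemma suminf_quarter_powers:
  assumes t: "1 \<le> t" and g: "\<And>k. 0 \<le> g k"
  shows "ennpow (\<Sum>k. ennreal ((1/4)^k * g k)) t \<le> ennreal (2 powr t) * (\<Sum>k. ennreal ((1/2)^k * g k powr t))"
proof -
  define S where "S = (\<Sum>k. ennreal ((1/2)^k * g k powr t))"
  have 1: "ennreal ((1/2)^k * g k) \<le> ennpow S (1 / t)" for k
  proof -
    have "((1/2::real)^k) powr t \<le> ((1/2)^k) powr 1" using t by (intro powr_mono') (auto simp: power_le_one)
    then have "((1/2)^k * g k) powr t \<le> (1/2)^k * g k powr t"
      using g[of k] by (simp add: powr_mult mult_right_mono)
    then have "ennreal (((1/2)^k * g k) powr t) \<le> ennreal ((1/2)^k * g k powr t)" by (rule ennreal_leI)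
    also have "\<dots> \<le> S" unfolding S_def by (rule suminf_ennreal_term)
    finally have "ennpow (ennreal (((1/2)^k * g k) powr t)) (1 / t) \<le> ennpow S (1 / t)"
      using t by (intro ennpow_mono) auto
    then show ?thesis using t g[of k] by (simp add: powr_powr)
  qed
  have "(\<Sum>k. ennreal ((1/4)^k * g k)) \<le> (\<Sum>k. ennreal ((1/2)^k) * ennpow S (1 / t))"
  proof (rule suminf_le)
    fix k
    have "(1/4::real)^k = (1/2)^k * (1/2)^k" by (simp add: power_mult_distrib[symmetric])
    then have "ennreal ((1/4)^k * g k) = ennreal ((1/2)^k) * ennreal ((1/2)^k * g k)"
      using g[of k] by (simp add: ennreal_mult[symmetric] mult.assoc)
    also have "\<dots> \<le> ennreal ((1/2)^k) * ennpow S (1 / t)" using 1 by (intro mult_left_mono) auto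
    finally show "ennreal ((1/4)^k * g k) \<le> ennreal ((1/2)^k) * ennpow S (1 / t)" .
  qed auto
  also have "\<dots> = (\<Sum>k. ennreal ((1/2)^k)) * ennpow S (1 / t)" by (rule ennreal_suminf_multc)
  also note suminf_half_powers
  finally have "ennpow (\<Sum>k. ennreal ((1/4)^k * g k)) t \<le> ennpow (ennreal 2 * ennpow S (1 / t)) t"
    using t by (intro ennpow_mono) auto
  also have "\<dots> = ennreal (2 powr t) * S" using t by (simp add: ennpow_mult ennpow_inverse del: ennreal_numeral)
  finally show ?thesis by (simp add: S_def)
qed

text \<open>The function \<open>H\<close> is the sum of the iterates of the maximal operator
  divided by \<open>4 L\<close>. Averaging against the kernel turns each iterate into at most
  the next one, which shifts the series and leaves a factor \<open>4 d L\<close>. The choice of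
  4 instead of the usual 2 is what \<open>suminf_quarter_powers\<close> requires.\<close>

lemma rubio_de_francia:
  assumes d: "1 \<le> d" and mb: "matrix_Muckenhoupt_basis n \<B> K" and t: "1 < t"
    and VA: "V \<in> A_class n d \<B> (ereal t)"
    and h: "h \<in> borel_measurable (leb n)" "\<And>x. 0 \<le> h x"
    and fin: "(\<integral>\<^sup>+x. ennreal (h x powr t) \<partial>leb n) < \<infinity>"
    and L: "0 < L" "real d ^ 2 * K d (ereal t) (enn2real (A_const n \<B> (ereal t) V)) \<le> L"
  obtains H where "H \<in> borel_measurable (leb n)" "\<And>x. h x \<le> H x"
    "(\<integral>\<^sup>+x. ennreal (H x powr t) \<partial>leb n) \<le> ennreal (4 powr t) * (\<integral>\<^sup>+x. ennreal (h x powr t) \<partial>leb n)"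
    "\<And>B. B \<in> \<B> \<Longrightarrow> AE x\<in>B in leb n. avg (leb n) B (\<lambda>y. ennreal (weight_ratio V x y * H y)) \<le> ennreal (4 * real d * L * H x)"
proof -
  have mV: "matrix_weight n d V" using VA by (simp add: A_class_def)
  have \<B>: "basis n \<B>" using mb by (simp add: matrix_Muckenhoupt_basis_def)
  define I where "I = (\<integral>\<^sup>+x. ennreal (h x powr t) \<partial>leb n)"
  have I: "I < \<infinity>" using fin by (simp add: I_def)
  define step where "step g x = enn2real (scalar_max n d \<B> V g x) / L" for g x
  define g where "g k = (step ^^ k) h" for k
  have g0: "g 0 = h" and gS: "g (Suc k) = step (g k)" for k by (simp_all add: g_def)
  have g: "g k \<in> borel_measurable (leb n) \<and> (\<forall>x. 0 \<le> g k x) \<and> (\<integral>\<^sup>+x. ennreal (g k x powr t) \<partial>leb n) \<le> I" for k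
  proof (induction k)
    case 0
    then show ?case using h by (simp add: g0 I_def)
  next
    case (Suc k)
    then have gk: "g k \<in> borel_measurable (leb n)" "\<And>x. 0 \<le> g k x" "(\<integral>\<^sup>+x. ennreal (g k x powr t) \<partial>leb n) \<le> I" by auto
    have f: "(\<integral>\<^sup>+x. ennreal (g k x powr t) \<partial>leb n) < \<infinity>" using gk(3) I by (rule order.strict_trans1)
    note sm = scalar_max_bound[OF d mb t VA gk(1,2) f L(2)]
    have 1: "step (g k) \<in> borel_measurable (leb n)" unfolding step_def using sm(1) by measurable
    have "ennreal (step (g k) x powr t) \<le> ennreal (L powr - t) * ennpow (scalar_max n d \<B> V (g k) x) t" for x
      using L(1) by (cases "scalar_max n d \<B> V (g k) x")
        (auto simp: step_def powr_divide powr_minus ennreal_mult[symmetric] field_simps ennreal_mult_top)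
    then have "(\<integral>\<^sup>+x. ennreal (step (g k) x powr t) \<partial>leb n) \<le> (\<integral>\<^sup>+x. ennreal (L powr - t) * ennpow (scalar_max n d \<B> V (g k) x) t \<partial>leb n)"
      by (intro nn_integral_mono)
    also have "\<dots> = ennreal (L powr - t) * (\<integral>\<^sup>+x. ennpow (scalar_max n d \<B> V (g k) x) t \<partial>leb n)"
      using sm(1) by (intro nn_integral_cmult measurable_ennpow)
    also have "\<dots> \<le> ennreal (L powr - t) * (ennreal (L powr t) * I)"
      using sm(2) gk(3) by (intro mult_left_mono order_trans[OF sm(2)]) auto
    also have "\<dots> = I" using L(1) by (simp add: mult.assoc[symmetric] ennreal_mult[symmetric] powr_add[symmetric])
    finally have 2: "(\<integral>\<^sup>+x. ennreal (step (g k) x powr t) \<partial>leb n) \<le> I" .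
    have "0 \<le> step (g k) x" for x using L(1) by (simp add: step_def)
    then show ?case using 1 2 unfolding gS by blast
  qed
  then have gm: "\<And>k. g k \<in> borel_measurable (leb n)" and gp: "\<And>k x. 0 \<le> g k x"
    and gI: "\<And>k. (\<integral>\<^sup>+x. ennreal (g k x powr t) \<partial>leb n) \<le> I" by auto
  have gstep: "AE x in leb n. \<forall>k. scalar_max n d \<B> V (g k) x = ennreal (L * g (Suc k) x)"
  proof (subst AE_all_countable, rule allI)
    fix k
    have f: "(\<integral>\<^sup>+x. ennreal (g k x powr t) \<partial>leb n) < \<infinity>" using gI I by (rule order.strict_trans1)
    note sm = scalar_max_bound[OF d mb t VA gm gp f L(2)]
    have "(\<integral>\<^sup>+x. ennpow (scalar_max n d \<B> V (g k) x) t \<partial>leb n) \<noteq> \<infinity>"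
      using sm(2) f by (metis ennreal_less_top ennreal_mult_less_top infinity_ennreal_def le_less_trans less_irrefl)
    then have "AE x in leb n. ennpow (scalar_max n d \<B> V (g k) x) t \<noteq> \<infinity>"
      by (intro nn_integral_PInf_AE measurable_ennpow sm(1))
    then show "AE x in leb n. scalar_max n d \<B> V (g k) x = ennreal (L * g (Suc k) x)"
    proof eventually_elim
      case (elim x)
      then have "scalar_max n d \<B> V (g k) x < top" by (metis ennpow_less_top_iff infinity_ennreal_def less_top)
      then show ?case using L(1) by (simp add: gS step_def)
    qed
  qed
  define R where "R x = (\<Sum>k. ennreal ((1/4)^k * g k x))" for x
  have Rm: "R \<in> borel_measurable (leb n)" unfolding R_def using gm by measurable
  have RI: "(\<integral>\<^sup>+x. ennpow (R x) t \<partial>leb n) \<le> ennreal (4 powr t) * I"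
  proof -
    have "(\<integral>\<^sup>+x. ennpow (R x) t \<partial>leb n) \<le> (\<integral>\<^sup>+x. ennreal (2 powr t) * (\<Sum>k. ennreal ((1/2)^k * g k x powr t)) \<partial>leb n)"
      unfolding R_def using t gp by (intro nn_integral_mono suminf_quarter_powers) auto
    also have "\<dots> = ennreal (2 powr t) * (\<Sum>k. \<integral>\<^sup>+x. ennreal ((1/2)^k * g k x powr t) \<partial>leb n)"
      using gm by (simp add: nn_integral_cmult nn_integral_suminf)
    also have "\<dots> = ennreal (2 powr t) * (\<Sum>k. ennreal ((1/2)^k) * (\<integral>\<^sup>+x. ennreal (g k x powr t) \<partial>leb n))"
      using gm by (simp add: ennreal_mult nn_integral_cmult)
    also have "\<dots> \<le> ennreal (2 powr t) * (\<Sum>k. ennreal ((1/2)^k) * I)"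
      using gI by (intro mult_left_mono suminf_le) auto
    also have "(\<Sum>k. ennreal ((1/2)^k) * I) = ennreal 2 * I"
      unfolding ennreal_suminf_multc suminf_half_powers ..
    also have "ennreal (2 powr t) * (ennreal 2 * I) = ennreal (2 powr t * 2) * I"
      by (simp add: ennreal_mult mult.assoc del: ennreal_numeral)
    also have "\<dots> \<le> ennreal (4 powr t) * I"
    proof (intro mult_right_mono ennreal_leI)
      have "(2::real) powr 1 \<le> 2 powr t" using t by (intro powr_mono) auto
      then have "2 powr t * 2 \<le> 2 powr t * (2 powr t :: real)" by (intro mult_left_mono) auto
      also have "\<dots> = 4 powr t" by (simp add: powr_mult[symmetric])
      finally show "2 powr t * 2 \<le> (4 powr t :: real)" .
    qed auto
    finally show ?thesis .
  qed
  have Rfin: "AE x in leb n. R x < top"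
  proof -
    have "ennreal (4 powr t) * I < \<infinity>" using I by (simp add: ennreal_mult_less_top)
    then have "(\<integral>\<^sup>+x. ennpow (R x) t \<partial>leb n) \<noteq> \<infinity>" using RI by auto
    then have "AE x in leb n. ennpow (R x) t \<noteq> \<infinity>" by (intro nn_integral_PInf_AE measurable_ennpow Rm)
    then show ?thesis by eventually_elim (metis ennpow_less_top_iff infinity_ennreal_def less_top)
  qed
  define H where "H x = (if R x = top then h x else enn2real (R x))" for x
  have HR: "AE x in leb n. ennreal (H x) = R x" using Rfin by eventually_elim (simp add: H_def less_top)
  have Hm: "H \<in> borel_measurable (leb n)" unfolding H_def using h(1) Rm by measurable
  have hH: "h x \<le> H x" for x
  proof (cases "R x = top")
    case False
    have "ennreal (h x) \<le> R x" unfolding R_def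
      using suminf_ennreal_term[of "\<lambda>k. ennreal ((1/4)^k * g k x)" 0] by (simp add: g0)
    then have "enn2real (ennreal (h x)) \<le> enn2real (R x)" using False by (intro enn2real_mono) (auto simp: less_top)
    then show ?thesis using False h(2) by (simp add: H_def)
  qed (simp add: H_def)
  have HI: "(\<integral>\<^sup>+x. ennreal (H x powr t) \<partial>leb n) \<le> ennreal (4 powr t) * I"
  proof -
    have "(\<integral>\<^sup>+x. ennreal (H x powr t) \<partial>leb n) = (\<integral>\<^sup>+x. ennpow (R x) t \<partial>leb n)"
      using HR by (intro nn_integral_cong_AE) (auto elim!: eventually_mono simp: H_def ennpow_def)
    then show ?thesis using RI by simp
  qed
  have main: "AE x\<in>B in leb n. avg (leb n) B (\<lambda>y. ennreal (weight_ratio V x y * H y)) \<le> ennreal (4 * real d * L * H x)"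
    if B: "B \<in> \<B>" for B
    using gstep HR
  proof eventually_elim
    case (elim x)
    show ?case
    proof
      assume x: "x \<in> B"
      note Bs = basisD[OF \<B> B]
      have xs: "x \<in> space (leb n)" using x Bs by auto
      let ?F = "weight_ratio V x"
      have Fm[measurable]: "?F \<in> borel_measurable (leb n)" by (rule measurable_weight_ratio(2)[OF mV xs])
      have F0: "0 \<le> ?F y" for y by simp
      have "avg (leb n) B (\<lambda>y. ennreal (?F y * H y)) \<le> avg (leb n) B (\<lambda>y. \<Sum>k. ennreal ((1/4)^k) * ennreal (?F y * g k y))"
      proof (rule avg_mono_AE)
        show "AE y\<in>B in leb n. ennreal (?F y * H y) \<le> (\<Sum>k. ennreal ((1/4)^k) * ennreal (?F y * g k y))"
          using HR
        proof eventually_elim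
          case (elim y)
          have "ennreal (?F y * H y) = ennreal (?F y) * R y" using F0 elim by (simp add: ennreal_mult')
          also have "\<dots> = (\<Sum>k. ennreal (?F y) * ennreal ((1/4)^k * g k y))" unfolding R_def by simp
          also have "\<dots> = (\<Sum>k. ennreal ((1/4)^k) * ennreal (?F y * g k y))"
            using F0 gp by (intro suminf_cong) (simp add: ennreal_mult[symmetric] mult_ac)
          finally show ?case by simp
        qed
      qed
      also have "\<dots> = (\<Sum>k. avg (leb n) B (\<lambda>y. ennreal ((1/4)^k) * ennreal (?F y * g k y)))"
        using gm Fm by (intro avg_suminf Bs(1)) auto
      also have "\<dots> = (\<Sum>k. ennreal ((1/4)^k) * avg (leb n) B (\<lambda>y. ennreal (?F y * g k y)))"
        using gm Fm by (intro suminf_cong avg_cmult Bs(1)) auto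
      also have "\<dots> \<le> (\<Sum>k. ennreal (4 * real d * L) * ennreal ((1/4)^(Suc k) * g (Suc k) x))"
      proof (intro suminf_le)
        fix k
        have "avg (leb n) B (\<lambda>y. ennreal (?F y * g k y)) \<le> ennreal (real d) * scalar_max n d \<B> V (g k) x"
          by (rule avg_le_scalar_max[OF mV \<B> B x gm gp])
        also have "\<dots> = ennreal (real d * L * g (Suc k) x)" using elim L gp by (simp add: ennreal_mult mult.assoc)
        finally have "ennreal ((1/4)^k) * avg (leb n) B (\<lambda>y. ennreal (?F y * g k y))
            \<le> ennreal ((1/4)^k) * ennreal (real d * L * g (Suc k) x)" by (intro mult_left_mono) auto
        also have "\<dots> = ennreal (4 * real d * L) * ennreal ((1/4)^(Suc k) * g (Suc k) x)"
          using L gp by (simp add: ennreal_mult[symmetric])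
        finally show "ennreal ((1/4)^k) * avg (leb n) B (\<lambda>y. ennreal (?F y * g k y))
           \<le> ennreal (4 * real d * L) * ennreal ((1/4)^(Suc k) * g (Suc k) x)" .
      qed auto
      also have "\<dots> = ennreal (4 * real d * L) * (\<Sum>k. ennreal ((1/4)^(Suc k) * g (Suc k) x))" by (rule ennreal_suminf_cmult)
      also have "\<dots> \<le> ennreal (4 * real d * L) * R x"
      proof (intro mult_left_mono)
        show "(\<Sum>k. ennreal ((1/4)^(Suc k) * g (Suc k) x)) \<le> R x"
          unfolding R_def using suminf_offset[of "\<lambda>k. ennreal ((1/4)^k * g k x)" 1] by simp
      qed auto
      also have "\<dots> = ennreal (4 * real d * L * H x)"
        using elim L by (simp add: ennreal_mult')
      finally show "avg (leb n) B (\<lambda>y. ennreal (weight_ratio V x y * H y)) \<le> ennreal (4 * real d * L * H x)" .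
    qed
  qed
  show ?thesis using that[OF Hm hH HI[unfolded I_def] main] .
qed

section \<open>Reverse factorization\<close>

lemma A_const_one: "A_const n \<B> 1 W = (SUP B\<in>\<B>. esssup (restrict_space (leb n) B)
           (\<lambda>x. avg (leb n) B (\<lambda>y. opnorm (mat_powr (W x) (-1) * W y))))"
  by (simp add: A_const_def)

lemma A_const_infinity: "A_const n \<B> \<infinity> W = (SUP B\<in>\<B>. esssup (restrict_space (leb n) B)
           (\<lambda>x. avg (leb n) B (\<lambda>y. opnorm (W x * mat_powr (W y) (-1)))))"
  by (simp add: A_const_def)

lemma avg_scaled_le:
  assumes B: "B \<in> sets M" and f: "f \<in> borel_measurable M" "\<And>y. 0 \<le> f y" and h: "0 < h"
    and le: "avg M B (\<lambda>y. ennreal (f y)) \<le> ennreal (c * h)" and c: "0 \<le> c" and a: "0 \<le> a"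
  shows "avg M B (\<lambda>y. ennreal (a * (f y / h))) \<le> ennreal (a * c)"
proof -
  have "avg M B (\<lambda>y. ennreal (a * (f y / h))) = avg M B (\<lambda>y. ennreal (a / h) * ennreal (f y))"
    using f(2) h a by (simp add: ennreal_mult[symmetric])
  also have "\<dots> = ennreal (a / h) * avg M B (\<lambda>y. ennreal (f y))" using f(1) by (intro avg_cmult B) auto
  also have "\<dots> \<le> ennreal (a / h) * ennreal (c * h)" using le by (intro mult_left_mono) auto
  also have "\<dots> = ennreal (a * c)" using h c a by (simp add: ennreal_mult[symmetric])
  finally show ?thesis .
qed

text \<open>Both endpoint classes are treated at once: \<open>k\<close> is the kernel of a
  weight or its transpose, and \<open>f\<close> the operator norm for the weight divided by
  \<open>h\<close> or multiplied by it.\<close>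

lemma esssup_avg_ratio_le:
  assumes B: "B \<in> sets (leb n)" and f: "case_prod f \<in> borel_measurable (leb n \<Otimes>\<^sub>M leb n)"
    and h: "h \<in> borel_measurable (leb n)" "\<And>x. 0 < h x" and c: "0 \<le> c"
    and k: "\<And>x. x \<in> space (leb n) \<Longrightarrow> k x \<in> borel_measurable (leb n)" "\<And>x y. 0 \<le> k x y"
    and le: "\<And>x y. x \<in> space (leb n) \<Longrightarrow> y \<in> space (leb n) \<Longrightarrow> f x y \<le> ennreal (h y / h x * k x y)"
    and A1: "AE x\<in>B in leb n. avg (leb n) B (\<lambda>y. ennreal (k x y * h y)) \<le> ennreal (c * h x)"
  shows "esssup (restrict_space (leb n) B) (\<lambda>x. avg (leb n) B (f x)) \<le> ennreal c"
proof (rule esssup_I)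
  show "(\<lambda>x. avg (leb n) B (f x)) \<in> borel_measurable (restrict_space (leb n) B)"
    by (rule measurable_restrict_space1[OF measurable_avg_leb[OF B f]])
  have "AE x\<in>B in leb n. avg (leb n) B (f x) \<le> ennreal c"
    using A1 AE_space
  proof (eventually_elim, intro impI)
    fix x assume *: "x \<in> B \<longrightarrow> avg (leb n) B (\<lambda>y. ennreal (k x y * h y)) \<le> ennreal (c * h x)"
      and xs: "x \<in> space (leb n)" and x: "x \<in> B"
    have "avg (leb n) B (f x) \<le> avg (leb n) B (\<lambda>y. ennreal (1 * (k x y * h y / h x)))"
      using le[OF xs] by (intro avg_mono_AE AE_I2) (simp add: mult.commute)
    also have "\<dots> \<le> ennreal (1 * c)"
      using * x c h k(1)[OF xs] k(2)
      by (intro avg_scaled_le B) (auto intro!: mult_nonneg_nonneg simp: less_imp_le)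
    finally show "avg (leb n) B (f x) \<le> ennreal c" by simp
  qed
  then show "AE x in restrict_space (leb n) B. avg (leb n) B (f x) \<le> ennreal c"
    by (subst AE_restrict_space_iff) (use B in auto)
qed

lemma opnorm_le_weight_ratio:
  "opnorm (V x * mat_powr (V y) (-1)) \<le> ennreal (weight_ratio V x y)"
  "matrix_weight n d V \<Longrightarrow> x \<in> space (leb n) \<Longrightarrow> y \<in> space (leb n) \<Longrightarrow>
    opnorm (mat_powr (V x) (-1) * V y) \<le> ennreal (weight_ratio V y x)"
proof -
  show "opnorm (V x * mat_powr (V y) (-1)) \<le> ennreal (weight_ratio V x y)"
    unfolding weight_ratio_def by (rule opnorm_le_entry_norm)
  show "opnorm (mat_powr (V x) (-1) * V y) \<le> ennreal (weight_ratio V y x)"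
    if "matrix_weight n d V" "x \<in> space (leb n)" "y \<in> space (leb n)"
    unfolding weight_ratio_def using opnorm_le_entry_norm[of "mat_powr (V x) (-1) * V y"]
      entry_norm_swap[OF psd_mat_powr[OF matrix_weightD(1)[OF that(1,2)]] matrix_weightD(1)[OF that(1,3)], of "-1"]
    by simp
qed

text \<open>The hypotheses say that \<open>V / H1\<close> is in \<open>A_\<infinity>\<close> and
  that \<open>H2 V\<close> is in \<open>A\<^sub>1\<close>, which are the cases \<open>\<theta> =
  0\<close> and \<open>\<theta> = 1\<close>. For \<open>0 < \<theta> < 1\<close> the kernel of
  the new weight is the product of the two kernels to the powers \<open>1 - \<theta>\<close> and
  \<open>\<theta>\<close>. In the scalar case the second one is bounded for almost every
  \<open>y\<close> by a function of \<open>x\<close> whose average is bounded. Here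
  \<open>weight_reducing_matrix\<close> provides such a function, and what remains of the inner
  average is the \<open>A_\<infinity>\<close> condition.\<close>

lemma reverse_factorization:
  assumes d: "1 \<le> d" and mV: "matrix_weight n d V" and \<B>: "basis n \<B>"
    and H1: "H1 \<in> borel_measurable (leb n)" "\<And>x. 0 < H1 x"
    and H2: "H2 \<in> borel_measurable (leb n)" "\<And>x. 0 < H2 x"
    and c: "0 < c1" "0 < c2" and \<theta>: "0 \<le> \<theta>" "\<theta> \<le> 1"
    and A1: "\<And>B. B \<in> \<B> \<Longrightarrow> AE x\<in>B in leb n. avg (leb n) B (\<lambda>y. ennreal (weight_ratio V x y * H1 y)) \<le> ennreal (c1 * H1 x)"
    and A2: "\<And>B. B \<in> \<B> \<Longrightarrow> AE x\<in>B in leb n. avg (leb n) B (\<lambda>y. ennreal (weight_ratio V y x * H2 y)) \<le> ennreal (c2 * H2 x)"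
  shows "A_const n \<B> (if \<theta> = 0 then \<infinity> else ereal (1 / \<theta>)) (\<lambda>x. (H2 x powr \<theta> * H1 x powr (\<theta> - 1)) \<cdot>\<^sub>m V x)
    \<le> ennreal (2 * real d ^ 4 * c2 powr \<theta> * c1 powr (1 - \<theta>))"
proof -
  define w where "w x = H2 x powr \<theta> * H1 x powr (\<theta> - 1)" for x
  define V0 where "V0 x = w x \<cdot>\<^sub>m V x" for x
  note [measurable] = H1(1) H2(1)
  have w: "w \<in> borel_measurable (leb n)" "\<And>x. 0 < w x"
  proof -
    show "w \<in> borel_measurable (leb n)" unfolding w_def by measurable
    show "0 < w x" for x using H1(2)[of x] H2(2)[of x] by (simp add: w_def)
  qed
  note V = matrix_weightD[OF mV]
  have mV0: "matrix_weight n d V0" and ratio0: "\<And>x y. x \<in> space (leb n) \<Longrightarrow> y \<in> space (leb n) \<Longrightarrow>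
      weight_ratio V0 x y = w x / w y * weight_ratio V x y"
    unfolding V0_def[abs_def] by (rule scaled_weight[OF mV w])+
  have mU0: "matrix_weight n d (\<lambda>x. mat_powr (V0 x) (-1))"
    using matrix_weight_inverse[OF mV0] by (simp add: weight_powr_def)
  have d4: "1 \<le> 2 * real d ^ 4" using d by (simp add: one_le_power order_trans[of 1 "real d ^ 4"])
  have inB: "x \<in> space (leb n)" if "x \<in> B" "B \<in> \<B>" for x B using that basisD(3)[OF \<B>] by auto
  consider "\<theta> = 0" | "\<theta> = 1" | "0 < \<theta>" "\<theta> < 1" using \<theta> by linarith
  then have "A_const n \<B> (if \<theta> = 0 then \<infinity> else ereal (1 / \<theta>)) V0
    \<le> ennreal (2 * real d ^ 4 * c2 powr \<theta> * c1 powr (1 - \<theta>))"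
  proof cases
    case 1
    have w1: "w x = 1 / H1 x" for x using 1 H1(2)[of x] H2(2)[of x] by (simp add: w_def powr_minus_divide)
    have "A_const n \<B> \<infinity> V0 \<le> ennreal c1"
      unfolding A_const_infinity
    proof (rule SUP_least)
      fix B assume B: "B \<in> \<B>"
      show "esssup (restrict_space (leb n) B) (\<lambda>x. avg (leb n) B (\<lambda>y. opnorm (V0 x * mat_powr (V0 y) (-1)))) \<le> ennreal c1"
      proof (rule esssup_avg_ratio_le[OF basisD(1)[OF \<B> B] measurable_weight_pair(1)[OF mV0 mU0] H1 _ _ _ _ A1[OF B]])
        show "opnorm (V0 x * mat_powr (V0 y) (-1)) \<le> ennreal (H1 y / H1 x * weight_ratio V x y)"
          if "x \<in> space (leb n)" "y \<in> space (leb n)" for x y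
          using opnorm_le_weight_ratio(1)[of V0 x y] ratio0[OF that] by (simp add: w1)
      qed (use c measurable_weight_ratio(2)[OF mV] in auto)
    qed
    also have "ennreal c1 \<le> ennreal (2 * real d ^ 4 * c2 powr \<theta> * c1 powr (1 - \<theta>))"
      using d4 c 1 mult_right_mono[OF d4, of c1] by (intro ennreal_leI) auto
    finally show ?thesis using 1 by simp
  next
    case 2
    have w1: "w x = H2 x" for x using 2 H1(2)[of x] H2(2)[of x] by (simp add: w_def)
    have "A_const n \<B> 1 V0 \<le> ennreal c2"
      unfolding A_const_one
    proof (rule SUP_least)
      fix B assume B: "B \<in> \<B>"
      show "esssup (restrict_space (leb n) B) (\<lambda>x. avg (leb n) B (\<lambda>y. opnorm (mat_powr (V0 x) (-1) * V0 y))) \<le> ennreal c2"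
      proof (rule esssup_avg_ratio_le[OF basisD(1)[OF \<B> B] measurable_weight_pair(1)[OF mU0 mV0] H2 _ _ _ _ A2[OF B]])
        show "opnorm (mat_powr (V0 x) (-1) * V0 y) \<le> ennreal (H2 y / H2 x * weight_ratio V y x)"
          if "x \<in> space (leb n)" "y \<in> space (leb n)" for x y
          using opnorm_le_weight_ratio(2)[OF mV0 that] ratio0[OF that(2,1)] by (simp add: w1)
      qed (use c measurable_weight_ratio(3)[OF mV] in auto)
    qed
    also have "ennreal c2 \<le> ennreal (2 * real d ^ 4 * c2 powr \<theta> * c1 powr (1 - \<theta>))"
      using d4 c 2 mult_right_mono[OF d4, of c2] by (intro ennreal_leI) auto
    finally show ?thesis using 2 by (simp add: one_ereal_def)
  next
    case 3
    define r where "r = 1 / \<theta>"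
    have r: "1 < r" using 3 by (simp add: r_def)
    define \<kappa> where "\<kappa> = r - 1"
    have \<kappa>: "0 < \<kappa>" "r / (r - 1) = 1 / (1 - \<theta>)" "\<theta> / (1 - \<theta>) = 1 / \<kappa>" "1 / r = \<theta>" "\<kappa> * \<theta> = 1 - \<theta>"
      using 3 r by (auto simp: \<kappa>_def r_def field_simps)
    have "A_const n \<B> (ereal r) V0 \<le> ennreal (2 * real d ^ 4 * c2 powr \<theta> * c1 powr (1 - \<theta>))"
      unfolding A_const_real[OF r]
    proof (rule SUP_least)
      fix B assume B: "B \<in> \<B>"
      note Bs = basisD[OF \<B> B]
      let ?op = "\<lambda>x y. ennpow (opnorm (V0 x * mat_powr (V0 y) (-1))) (r / (r - 1))"
      let ?in = "\<lambda>x. avg (leb n) B (?op x)"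
      show "ennpow (avg (leb n) B (\<lambda>x. ennpow (?in x) (r - 1))) (1 / r) \<le> ennreal (2 * real d ^ 4 * c2 powr \<theta> * c1 powr (1 - \<theta>))"
      proof (cases "emeasure (leb n) B = 0")
        case True
        then show ?thesis using avg_null[OF Bs(1)] by simp
      next
        case False
        obtain m where m: "emeasure (leb n) B = ennreal m" "0 < m"
          using False Bs(2) by (cases "emeasure (leb n) B") (auto simp: less_le)
        define J where "J y = (\<integral>\<^sup>+x\<in>B. ennreal ((H2 x * weight_ratio V x y) powr 1) \<partial>leb n)" for y
        have J: "AE y\<in>B in leb n. J y \<le> ennreal ((c2 * H2 y * m) powr 1)"
          using A2[OF B]
        proof (eventually_elim, intro impI)
          fix y assume *: "y \<in> B \<longrightarrow> avg (leb n) B (\<lambda>x. ennreal (weight_ratio V x y * H2 x)) \<le> ennreal (c2 * H2 y)"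
            and y: "y \<in> B"
          have "J y = avg (leb n) B (\<lambda>x. ennreal (weight_ratio V x y * H2 x)) * ennreal m"
            unfolding J_def m(1)[symmetric] set_nn_integral_avg[OF False Bs(2), symmetric]
            using H2(2) by (intro nn_integral_cong) (simp add: mult.commute less_imp_le)
          also have "\<dots> \<le> ennreal (c2 * H2 y) * ennreal m" using * y by (intro mult_right_mono) auto
          finally show "J y \<le> ennreal ((c2 * H2 y * m) powr 1)"
            using c m H2(2)[of y] by (simp add: ennreal_mult[symmetric] less_imp_le)
        qed
        then have Jfin: "AE y\<in>B in leb n. J y < \<infinity>" by eventually_elim (auto simp: order.strict_trans1)
        obtain P where P: "P \<in> carrier_mat d d"
          "(\<integral>\<^sup>+x\<in>B. ennreal ((H2 x * entry_norm (V x * P)) powr 1) \<partial>leb n) \<le> ennreal (real d powr (1 + 1))"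
          "\<And>x y R. x \<in> space (leb n) \<Longrightarrow> y \<in> space (leb n) \<Longrightarrow> 0 \<le> R \<Longrightarrow> J y \<le> ennreal (R powr 1) \<Longrightarrow>
             weight_ratio V x y \<le> 2 * real d ^ 2 * R * entry_norm (V x * P)"
          by (rule weight_reducing_matrix[OF d _ mV Bs(1) False H2, of 1, folded J_def]) (use Jfin in auto)
        define D where "D = 2 * real d ^ 2 * c2 * m"
        have D: "0 \<le> D" using c m by (simp add: D_def)
        define E where "E x = D * (H2 x * entry_norm (V x * P))" for x
        have E: "0 \<le> E x" for x using D H2(2)[of x] by (simp add: E_def less_imp_le)
        have inner: "AE x\<in>B in leb n. ?in x \<le> ennreal (E x powr (1 / \<kappa>) * c1)"
          using A1[OF B]
        proof (eventually_elim, intro impI)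
          fix x assume *: "x \<in> B \<longrightarrow> avg (leb n) B (\<lambda>y. ennreal (weight_ratio V x y * H1 y)) \<le> ennreal (c1 * H1 x)"
            and x: "x \<in> B"
          note xs = inB[OF x B]
          let ?bd = "\<lambda>y. E x powr (1 / \<kappa>) * (weight_ratio V x y * H1 y / H1 x)"
          have "?in x \<le> avg (leb n) B (\<lambda>y. ennreal (?bd y))"
          proof (rule avg_mono_AE, use J in eventually_elim, intro impI)
            fix y assume Jy: "y \<in> B \<longrightarrow> J y \<le> ennreal ((c2 * H2 y * m) powr 1)" and y: "y \<in> B"
            note ys = inB[OF y B]
            have H: "0 < H1 x" "0 < H1 y" "0 < H2 x" "0 < H2 y" using H1(2) H2(2) by auto
            define f where "f = weight_ratio V x y"
            have "f \<le> 2 * real d ^ 2 * (c2 * H2 y * m) * entry_norm (V x * P)"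
              unfolding f_def using Jy y c m H by (intro P(3)[OF xs ys]) auto
            then have f: "0 \<le> f" "f \<le> D * H2 y * entry_norm (V x * P)"
              by (auto simp: f_def D_def mult_ac)
            \<comment> \<open>This also holds for \<open>f = 0\<close>, where both powers are 0.\<close>
            have f_split: "f = f powr \<theta> * f powr (1 - \<theta>)"
              using f(1) by (cases "f = 0") (simp_all add: powr_add[symmetric])
            have "w x / w y = (H2 x / H2 y) powr \<theta> * (H1 y / H1 x) powr (1 - \<theta>)"
              using H by (simp add: w_def powr_divide powr_diff field_simps)
            then have "w x / w y * f = (H2 x / H2 y) powr \<theta> * (H1 y / H1 x) powr (1 - \<theta>) * (f powr \<theta> * f powr (1 - \<theta>))"
              using f_split by simp
            also have "\<dots> = ((H2 x / H2 y) powr \<theta> * f powr \<theta>) * ((H1 y / H1 x) powr (1 - \<theta>) * f powr (1 - \<theta>))"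
              by (simp only: mult_ac)
            also have "\<dots> = (H2 x / H2 y * f) powr \<theta> * (H1 y / H1 x * f) powr (1 - \<theta>)"
              using powr_mult[of "H2 x / H2 y" f \<theta>] powr_mult[of "H1 y / H1 x" f "1 - \<theta>"] f(1) H by simp
            finally have "(w x / w y * f) powr (1 / (1 - \<theta>)) = (H2 x / H2 y * f) powr (\<theta> / (1 - \<theta>)) * (H1 y / H1 x * f)"
              using f(1) H 3 by (simp add: powr_mult powr_powr)
            also have "\<dots> \<le> E x powr (1 / \<kappa>) * (H1 y / H1 x * f)"
            proof (intro mult_right_mono)
              have "H2 x / H2 y * f \<le> H2 x / H2 y * (D * H2 y * entry_norm (V x * P))"
                using f(2) H by (intro mult_left_mono) auto
              also have "\<dots> = E x" using H by (simp add: E_def)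
              finally show "(H2 x / H2 y * f) powr (\<theta> / (1 - \<theta>)) \<le> E x powr (1 / \<kappa>)"
                unfolding \<kappa>(3) using f(1) H \<kappa>(1) by (intro powr_mono2) auto
            qed (use f(1) H in auto)
            finally have 1: "(w x / w y * f) powr (1 / (1 - \<theta>)) \<le> ?bd y"
              by (simp add: f_def mult_ac)
            have "?op x y \<le> ennpow (ennreal (w x / w y * f)) (r / (r - 1))"
              using opnorm_le_weight_ratio(1)[of V0 x y] r unfolding ratio0[OF xs ys] f_def by (intro ennpow_mono) auto
            also have "\<dots> = ennreal ((w x / w y * f) powr (1 / (1 - \<theta>)))"
              using f(1) w(2)[of x] w(2)[of y] by (simp add: \<kappa>(2) less_imp_le)
            also have "\<dots> \<le> ennreal (?bd y)" by (rule ennreal_leI[OF 1])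
            finally show "?op x y \<le> ennreal (?bd y)" .
          qed
          also have "\<dots> \<le> ennreal (E x powr (1 / \<kappa>) * c1)"
            using * x c H1(1) H1(2) measurable_weight_ratio(2)[OF mV xs]
            by (intro avg_scaled_le Bs(1)) (auto intro!: mult_nonneg_nonneg simp: less_imp_le)
          finally show "?in x \<le> ennreal (E x powr (1 / \<kappa>) * c1)" .
        qed
        let ?k = "\<lambda>x. ennreal ((H2 x * entry_norm (V x * P)) powr 1)"
        have mVP: "?k \<in> borel_measurable (leb n)"
        proof -
          have "(\<lambda>x. entry_norm (V x * P)) \<in> borel_measurable (leb n)"
          proof (rule measurable_entry_norm)
            show "(\<lambda>x. (V x * P) $$ (i,j)) \<in> borel_measurable (leb n)" if "i < d" "j < d" for i j
              using measurable_mult_mat_entry[of "leb n" V d "\<lambda>_. P" i j] V(2,3) P(1) that by auto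
          qed (use V(2) P(1) in \<open>auto intro!: mult_carrier_mat\<close>)
          then show ?thesis by measurable
        qed
        have "avg (leb n) B (\<lambda>x. ennpow (?in x) (r - 1)) \<le> avg (leb n) B (\<lambda>x. ennreal (D * c1 powr \<kappa>) * ?k x)"
        proof (rule avg_mono_AE, use inner in eventually_elim, intro impI)
          fix x assume "x \<in> B \<longrightarrow> ?in x \<le> ennreal (E x powr (1 / \<kappa>) * c1)" "x \<in> B"
          then have "ennpow (?in x) \<kappa> \<le> ennpow (ennreal (E x powr (1 / \<kappa>) * c1)) \<kappa>"
            using \<kappa>(1) by (intro ennpow_mono) auto
          also have "\<dots> = ennreal (E x * c1 powr \<kappa>)" using E[of x] c \<kappa>(1) by (simp add: powr_mult powr_powr)
          also have "E x * c1 powr \<kappa> = D * c1 powr \<kappa> * (H2 x * entry_norm (V x * P)) powr 1"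
            using H2(2)[of x] by (simp add: E_def less_imp_le mult_ac)
          also have "ennreal \<dots> = ennreal (D * c1 powr \<kappa>) * ?k x" using D by (intro ennreal_mult) auto
          finally show "ennpow (?in x) (r - 1) \<le> ennreal (D * c1 powr \<kappa>) * ?k x" by (simp add: \<kappa>_def)
        qed
        also have "\<dots> = ennreal (D * c1 powr \<kappa>) * avg (leb n) B ?k"
          by (intro avg_cmult Bs(1) mVP)
        also have "\<dots> \<le> ennreal (D * c1 powr \<kappa>) * (ennreal (real d powr (1 + 1)) / ennreal m)"
          unfolding avg_def m(1) using P(2) by (intro mult_left_mono divide_right_mono_ennreal) auto
        also have "\<dots> = ennreal (D * c1 powr \<kappa> * (real d ^ 2 / m))"
          using m(2) D d by (simp add: divide_ennreal ennreal_mult[symmetric] powr_realpow[of "real d" 2, simplified])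
        also have "D * c1 powr \<kappa> * (real d ^ 2 / m) = 2 * real d ^ 4 * c2 * c1 powr \<kappa>"
          using m(2) by (simp add: D_def power_add[symmetric])
        finally have "ennpow (avg (leb n) B (\<lambda>x. ennpow (?in x) (r - 1))) \<theta> \<le> ennpow (ennreal (2 * real d ^ 4 * c2 * c1 powr \<kappa>)) \<theta>"
          using \<theta> by (intro ennpow_mono) auto
        also have "\<dots> = ennreal ((2 * real d ^ 4) powr \<theta> * c2 powr \<theta> * c1 powr (1 - \<theta>))"
          using c by (simp add: powr_mult powr_powr \<kappa>(5))
        also have "\<dots> \<le> ennreal (2 * real d ^ 4 * c2 powr \<theta> * c1 powr (1 - \<theta>))"
        proof (intro ennreal_leI mult_right_mono)
          have "(2 * real d ^ 4) powr \<theta> \<le> (2 * real d ^ 4) powr 1" using d4 \<theta> by (intro powr_mono) auto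
          then show "(2 * real d ^ 4) powr \<theta> \<le> 2 * real d ^ 4" using d4 by simp
        qed auto
        finally show ?thesis unfolding \<kappa>(4) .
      qed
    qed
    then show ?thesis using 3 by (simp add: r_def)
  qed
  then show ?thesis unfolding V0_def[abs_def] w_def .
qed

text \<open>Test the maximal operator on the indicator function of \<open>B\<close>: if the
  result is zero, then so is \<open>V(x) V(y)\<^sup>-\<^sup>1\<close> for almost all
  \<open>x\<close> and \<open>y\<close> in \<open>B\<close>.\<close>

lemma vanishing_constant_null_basis:
  assumes d: "1 \<le> d" and mb: "matrix_Muckenhoupt_basis n \<B> K" and t: "1 < t"
    and VA: "V \<in> A_class n d \<B> (ereal t)"
    and K0: "K d (ereal t) (enn2real (A_const n \<B> (ereal t) V)) = 0" and B: "B \<in> \<B>"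
  shows "emeasure (leb n) B = 0"
proof (rule ccontr)
  assume nn: "emeasure (leb n) B \<noteq> 0"
  have mV: "matrix_weight n d V" using VA by (simp add: A_class_def)
  note V = matrix_weightD[OF mV]
  have \<B>: "basis n \<B>" using muckenhoupt_basisD(1)[OF mb d t] .
  note Bs = basisD[OF \<B> B]
  define h :: "pt \<Rightarrow> real" where "h = indicator B"
  have h: "h \<in> borel_measurable (leb n)" "\<And>x. 0 \<le> h x" using Bs(1) by (auto simp: h_def)
  have "(\<integral>\<^sup>+x. ennreal (h x powr t) \<partial>leb n) = (\<integral>\<^sup>+x. indicator B x \<partial>leb n)"
    by (intro nn_integral_cong) (auto simp: h_def indicator_def)
  then have fin: "(\<integral>\<^sup>+x. ennreal (h x powr t) \<partial>leb n) < \<infinity>" using Bs by simp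
  note sm = scalar_max_bound[OF d mb t VA h fin, of 0]
  have "(\<integral>\<^sup>+x. ennpow (scalar_max n d \<B> V h x) t \<partial>leb n) = 0" using sm(2) K0 by simp
  then have "AE x in leb n. scalar_max n d \<B> V h x = 0"
    using sm(1) K0 by (subst (asm) nn_integral_0_iff_AE) auto
  then have ae: "AE x\<in>B in leb n. scalar_max n d \<B> V h x = 0 \<and> mat_powr (V x) (-1) * V x = 1\<^sub>m d \<and> V x * mat_powr (V x) (-1) = 1\<^sub>m d"
    using matrix_weight_inverse_AE[OF mV] by eventually_elim auto
  obtain x where x: "x \<in> B" "scalar_max n d \<B> V h x = 0" "V x * mat_powr (V x) (-1) = 1\<^sub>m d"
    by (rule ex_in_nonnull[OF Bs(1) nn ae]) blast
  have xs: "x \<in> space (leb n)" using x Bs by auto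
  have "avg (leb n) B (\<lambda>y. ennreal (weight_ratio V x y * h y)) = 0"
    using avg_le_scalar_max[OF mV \<B> B x(1) h] x(2) by simp
  then have "(\<integral>\<^sup>+y\<in>B. ennreal (weight_ratio V x y * h y) \<partial>leb n) = 0"
    using set_nn_integral_avg[OF nn Bs(2)] by simp
  then have "AE y in leb n. ennreal (weight_ratio V x y * h y) * indicator B y = 0"
    using measurable_weight_ratio(2)[OF mV xs] h(1) Bs(1) by (subst (asm) nn_integral_0_iff_AE) auto
  then have ae': "AE y\<in>B in leb n. weight_ratio V x y = 0 \<and> mat_powr (V y) (-1) * V y = 1\<^sub>m d"
    using matrix_weight_inverse_AE(2)[OF mV]
    by eventually_elim (auto simp: h_def ennreal_eq_0_iff intro: antisym)
  obtain y where y: "y \<in> B" "weight_ratio V x y = 0" "mat_powr (V y) (-1) * V y = 1\<^sub>m d"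
    by (rule ex_in_nonnull[OF Bs(1) nn ae']) blast
  have ys: "y \<in> space (leb n)" using y Bs by auto
  note c = V(2)[OF xs] V(2)[OF ys] mat_powr_carrier[OF V(1)[OF xs], of "-1"] mat_powr_carrier[OF V(1)[OF ys], of "-1"]
  have "(V x * mat_powr (V y) (-1)) * (V y * mat_powr (V x) (-1)) = V x * ((mat_powr (V y) (-1) * V y) * mat_powr (V x) (-1))"
    using c by (simp add: assoc_mult_mat[of _ d d _ d _ d])
  also have "\<dots> = 1\<^sub>m d" using x(3) y(3) c by simp
  finally have "0 < weight_ratio V x y" unfolding weight_ratio_def
    using d c by (intro entry_norm_pos_inverse[of d]) (auto intro!: mult_carrier_mat)
  then show False using y(2) by simp
qed

section \<open>Hoelder's inequality and duality\<close>

text \<open>The integrals are replaced by positive upper bounds, so that no degenerate cases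
  arise; the exponents may be 0, as happens for infinite \<open>p\<^sub>0\<close> or
  \<open>q\<^sub>0\<close>.\<close>

lemma nn_integral_Hoelder:
  fixes u v :: "'a \<Rightarrow> real"
  assumes m: "u \<in> borel_measurable M" "v \<in> borel_measurable M"
    and nn: "\<And>x. 0 \<le> u x" "\<And>x. 0 \<le> v x"
    and int: "(\<integral>\<^sup>+x. ennreal (u x) \<partial>M) \<le> ennreal U" "(\<integral>\<^sup>+x. ennreal (v x) \<partial>M) \<le> ennreal V"
    and UV: "0 < U" "0 < V" and ab: "0 \<le> a" "0 \<le> b" "a + b = 1"
  shows "(\<integral>\<^sup>+x. ennreal (u x powr a * v x powr b) \<partial>M) \<le> ennreal (U powr a * V powr b)"
proof -
  let ?c = "U powr a * V powr b"
  have pw: "u x powr a * v x powr b \<le> ?c * a / U * u x + ?c * b / V * v x" for x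
  proof (cases "u x = 0 \<or> v x = 0")
    case True
    moreover have "0 \<le> ?c * a / U * u x + ?c * b / V * v x" using nn[of x] UV ab by simp
    ultimately show ?thesis by auto
  next
    case False
    then have pos: "0 < u x / U" "0 < v x / V" using nn[of x] UV by (auto simp: less_le)
    have "(u x / U) powr a * (v x / V) powr b \<le> a * (u x / U) + b * (v x / V)"
      using Youngs_inequality_0[OF ab pos] .
    then have "?c * ((u x / U) powr a * (v x / V) powr b) \<le> ?c * (a * (u x / U) + b * (v x / V))"
      using UV by (intro mult_left_mono) auto
    moreover have "?c * ((u x / U) powr a * (v x / V) powr b) = u x powr a * v x powr b"
      using UV nn[of x] by (simp add: powr_divide)
    ultimately show ?thesis by (simp add: algebra_simps)
  qed
  have "(\<integral>\<^sup>+x. ennreal (u x powr a * v x powr b) \<partial>M) \<le>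
     (\<integral>\<^sup>+x. ennreal (?c * a / U) * ennreal (u x) + ennreal (?c * b / V) * ennreal (v x) \<partial>M)"
  proof (rule nn_integral_mono)
    fix x
    have "ennreal (u x powr a * v x powr b) \<le> ennreal (?c * a / U * u x + ?c * b / V * v x)"
      by (rule ennreal_leI[OF pw])
    also have "\<dots> = ennreal (?c * a / U) * ennreal (u x) + ennreal (?c * b / V) * ennreal (v x)"
      using UV ab nn[of x] by (simp add: ennreal_mult[symmetric])
    finally show "ennreal (u x powr a * v x powr b) \<le> ennreal (?c * a / U) * ennreal (u x) + ennreal (?c * b / V) * ennreal (v x)" .
  qed
  also have "\<dots> = ennreal (?c * a / U) * (\<integral>\<^sup>+x. ennreal (u x) \<partial>M) + ennreal (?c * b / V) * (\<integral>\<^sup>+x. ennreal (v x) \<partial>M)"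
    using m by (subst nn_integral_add) (auto simp: nn_integral_cmult)
  also have "\<dots> \<le> ennreal (?c * a / U) * ennreal U + ennreal (?c * b / V) * ennreal V"
    using int by (intro add_mono mult_left_mono) auto
  also have "\<dots> = ennreal (?c * a / U * U + ?c * b / V * V)"
    using UV ab by (simp add: ennreal_mult[symmetric])
  also have "?c * a / U * U + ?c * b / V * V = ?c * (a + b)" using UV by (simp add: algebra_simps)
  finally show ?thesis using ab by simp
qed

text \<open>The norm of \<open>g\<close> may be infinite, hence the usual extremal function
  \<open>g\<^sup>r\<^sup>-\<^sup>1\<close> is formed from the truncations of \<open>g\<close>.\<close>

lemma (in sigma_finite_measure) Lp_norm_by_duality:
  fixes g :: "'a \<Rightarrow> real"
  assumes g: "g \<in> borel_measurable M" "\<And>x. 0 \<le> g x" and r: "1 < r" and \<Lambda>: "0 \<le> \<Lambda>"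
    and dual: "\<And>h. h \<in> borel_measurable M \<Longrightarrow> (\<And>x. 0 \<le> h x) \<Longrightarrow>
      (\<integral>\<^sup>+x. ennreal (h x powr (r / (r - 1))) \<partial>M) \<le> 1 \<Longrightarrow> (\<integral>\<^sup>+x. ennreal (g x * h x) \<partial>M) \<le> ennreal \<Lambda>"
  shows "(\<integral>\<^sup>+x. ennreal (g x powr r) \<partial>M) \<le> ennreal (\<Lambda> powr r)"
proof -
  obtain A :: "nat \<Rightarrow> 'a set" where A: "range A \<subseteq> sets M" "(\<Union>i. A i) = space M" "\<And>i. emeasure M (A i) \<noteq> \<infinity>" "incseq A"
    using sigma_finite_incseq by blast
  have As[measurable]: "A i \<in> sets M" for i using A(1) by auto
  note [measurable] = g(1)
  define t where "t i x = min (g x) (real i) * indicator (A i) x" for i x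
  have t: "t i \<in> borel_measurable M" "0 \<le> t i x" "t i x \<le> g x" for i x
    using g(2)[of x] unfolding t_def by (auto simp: indicator_def)
  have main: "(\<integral>\<^sup>+x. ennreal (t i x powr r) \<partial>M) \<le> ennreal (\<Lambda> powr r)" for i
  proof -
    define I where "I = (\<integral>\<^sup>+x. ennreal (t i x powr r) \<partial>M)"
    have "I \<le> (\<integral>\<^sup>+x. ennreal (real i powr r) * indicator (A i) x \<partial>M)"
      unfolding I_def using r g(2)
      by (intro nn_integral_mono) (auto simp: t_def indicator_def intro!: ennreal_leI powr_mono2)
    also have "\<dots> = ennreal (real i powr r) * emeasure M (A i)" by (simp add: nn_integral_cmult_indicator)
    also have "\<dots> < \<infinity>" using A(3)[of i] by (simp add: ennreal_mult_less_top less_top)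
    finally obtain c where c: "I = ennreal c" "0 \<le> c" by (cases I) auto
    show ?thesis
    proof (cases "c = 0")
      case True
      then show ?thesis using c by (simp add: I_def)
    next
      case False
      then have cp: "0 < c" using c by simp
      define b where "b = r / (r - 1)"
      have b: "0 < b" "(r - 1) * b = r" "1 - 1 / b = 1 / r" using r by (auto simp: b_def field_simps)
      define h where "h x = t i x powr (r - 1) * c powr (- 1 / b)" for x
      have hb: "h x powr b = t i x powr r * (1 / c)" for x
      proof -
        have "(c powr (- 1 / b)) powr b = c powr (- 1)" unfolding powr_powr using b by simp
        then have "(c powr (- 1 / b)) powr b = 1 / c" using cp by (simp add: powr_minus_divide)
        then show ?thesis using b t(2)[of i x] by (simp add: h_def powr_mult powr_powr)
      qed
      have "(\<integral>\<^sup>+x. ennreal (h x powr b) \<partial>M) = (\<integral>\<^sup>+x. ennreal (t i x powr r) * ennreal (1 / c) \<partial>M)"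
        unfolding hb using cp by (intro nn_integral_cong) (simp add: ennreal_mult[symmetric])
      also have "\<dots> = I * ennreal (1 / c)" unfolding I_def using t(1) by (intro nn_integral_multc) measurable
      also have "\<dots> = 1" using c cp by (simp add: ennreal_mult[symmetric])
      finally have h1: "(\<integral>\<^sup>+x. ennreal (h x powr b) \<partial>M) \<le> 1" by simp
      have hm: "h \<in> borel_measurable M" unfolding h_def using t(1) by measurable
      have h0: "0 \<le> h x" for x by (simp add: h_def)
      have "I * ennreal (c powr (- 1 / b)) = (\<integral>\<^sup>+x. ennreal (t i x powr r) * ennreal (c powr (- 1 / b)) \<partial>M)"
        unfolding I_def using t(1) by (intro nn_integral_multc[symmetric]) measurable
      also have "\<dots> \<le> (\<integral>\<^sup>+x. ennreal (g x * h x) \<partial>M)"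
      proof (rule nn_integral_mono)
        fix x
        have "t i x powr r = t i x * t i x powr (r - 1)"
          using t(2)[of i x] r by (cases "t i x = 0") (auto simp: powr_mult_base)
        also have "\<dots> \<le> g x * t i x powr (r - 1)" using t(3) by (intro mult_right_mono) auto
        finally have "t i x powr r * c powr (- 1 / b) \<le> g x * h x"
          unfolding h_def by (simp add: mult_right_mono mult.assoc[symmetric])
        then show "ennreal (t i x powr r) * ennreal (c powr (- 1 / b)) \<le> ennreal (g x * h x)"
          by (simp add: ennreal_mult[symmetric] ennreal_leI)
      qed
      also have "\<dots> \<le> ennreal \<Lambda>" using dual[OF hm h0] h1 by (simp add: b_def)
      finally have "ennreal (c * c powr (- 1 / b)) \<le> ennreal \<Lambda>" using c by (simp add: ennreal_mult)
      moreover have "c * c powr (- 1 / b) = c powr (1 / r)"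
        unfolding b(3)[symmetric] using cp by (simp add: powr_mult_base)
      ultimately have "c powr (1 / r) \<le> \<Lambda>" using \<Lambda> by simp
      then have "(c powr (1 / r)) powr r \<le> \<Lambda> powr r" using r by (intro powr_mono2) auto
      then have "c \<le> \<Lambda> powr r" using cp r by (simp add: powr_powr)
      then show ?thesis using c by (simp add: I_def ennreal_leI)
    qed
  qed
  have "(\<integral>\<^sup>+x. ennreal (g x powr r) \<partial>M) \<le> (\<integral>\<^sup>+x. (SUP i. ennreal (t i x powr r)) \<partial>M)"
  proof (rule nn_integral_mono)
    fix x assume "x \<in> space M"
    then obtain j where j: "x \<in> A j" using A(2) by auto
    obtain k where k: "g x \<le> real k" using real_arch_simple by blast
    have "x \<in> A (max j k)" using j incseqD[OF A(4), of j "max j k"] by auto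
    moreover have "min (g x) (real (max j k)) = g x" using k by (intro min_absorb1) simp
    ultimately have "t (max j k) x = g x" by (simp add: t_def)
    then show "ennreal (g x powr r) \<le> (SUP i. ennreal (t i x powr r))" by (intro SUP_upper2[of "max j k"]) auto
  qed
  also have "\<dots> = (SUP i. \<integral>\<^sup>+x. ennreal (t i x powr r) \<partial>M)"
  proof (rule nn_integral_monotone_convergence_SUP)
    show "incseq (\<lambda>i x. ennreal (t i x powr r))"
    proof (rule incseq_SucI, rule le_funI)
      fix i x
      have "A i \<subseteq> A (Suc i)" using incseqD[OF A(4), of i "Suc i"] by simp
      then have "t i x \<le> t (Suc i) x" using g(2)[of x] by (auto simp: t_def indicator_def)
      then show "ennreal (t i x powr r) \<le> ennreal (t (Suc i) x powr r)"
        using t(2) r by (intro ennreal_leI powr_mono2) auto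
    qed
  qed (use t(1) in measurable)
  also have "\<dots> \<le> ennreal (\<Lambda> powr r)" using main by (intro SUP_least) auto
  finally show ?thesis .
qed

lemma (in sigma_finite_measure) ex_positive_Lp_function:
  assumes t: "0 < t"
  obtains \<phi> :: "'a \<Rightarrow> real" where "\<phi> \<in> borel_measurable M" "\<And>x. 0 < \<phi> x" "(\<integral>\<^sup>+x. ennreal (\<phi> x powr t) \<partial>M) \<le> 1"
proof -
  obtain f :: "'a \<Rightarrow> real" where f: "f \<in> borel_measurable M" "\<And>x. f x > 0" "integrable M f"
    using obtain_positive_integrable_function by metis
  define c where "c = (\<integral>x. f x \<partial>M)"
  have c: "0 \<le> c" unfolding c_def by (rule Bochner_Integration.integral_nonneg) (rule less_imp_le[OF f(2)])
  define \<phi> where "\<phi> x = (f x / (c + 1)) powr (1 / t)" for x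
  note [measurable] = f(1)
  have "(\<integral>\<^sup>+x. ennreal (\<phi> x powr t) \<partial>M) = (\<integral>\<^sup>+x. ennreal (f x / (c + 1)) \<partial>M)"
    using t f(2) c by (intro nn_integral_cong) (simp add: \<phi>_def powr_powr less_imp_le)
  also have "\<dots> = ennreal (\<integral>x. f x / (c + 1) \<partial>M)"
    using f c by (intro nn_integral_eq_integral) (auto intro!: divide_nonneg_nonneg simp: less_imp_le)
  also have "(\<integral>x. f x / (c + 1) \<partial>M) = c / (c + 1)" by (simp add: c_def)
  also have "ennreal (c / (c + 1)) \<le> 1" using c by (simp add: ennreal_le_1)
  finally have "(\<integral>\<^sup>+x. ennreal (\<phi> x powr t) \<partial>M) \<le> 1" .
  moreover have "\<phi> \<in> borel_measurable M" unfolding \<phi>_def by measurable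
  moreover have "0 < \<phi> x" for x using f(2)[of x] c by (simp add: \<phi>_def)
  ultimately show ?thesis using that by blast
qed

lemma add_Lp_bound:
  assumes m: "u \<in> borel_measurable M" "v \<in> borel_measurable M" and nn: "\<And>x. 0 \<le> u x" "\<And>x. 0 \<le> v x" and t: "1 \<le> t"
    and I: "(\<integral>\<^sup>+x. ennreal (u x powr t) \<partial>M) \<le> 1" "(\<integral>\<^sup>+x. ennreal (v x powr t) \<partial>M) \<le> 1"
  shows "(\<integral>\<^sup>+x. ennreal ((u x + v x) powr t) \<partial>M) \<le> ennreal (4 powr t)"
proof -
  have pw: "(u x + v x) powr t \<le> 2 powr t * u x powr t + 2 powr t * v x powr t" for x
  proof -
    have "(u x + v x) powr t \<le> (2 * max (u x) (v x)) powr t" using nn[of x] t by (intro powr_mono2) auto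
    also have "\<dots> = 2 powr t * max (u x) (v x) powr t" using nn[of x] by (simp add: powr_mult)
    also have "\<dots> \<le> 2 powr t * (u x powr t + v x powr t)" by (intro mult_left_mono) (auto simp: max_def)
    finally show ?thesis by (simp add: algebra_simps)
  qed
  have "(\<integral>\<^sup>+x. ennreal ((u x + v x) powr t) \<partial>M) \<le> (\<integral>\<^sup>+x. ennreal (2 powr t) * ennreal (u x powr t) + ennreal (2 powr t) * ennreal (v x powr t) \<partial>M)"
    using pw by (intro nn_integral_mono) (simp add: ennreal_mult[symmetric] ennreal_plus[symmetric] ennreal_leI del: ennreal_plus)
  also have "\<dots> = ennreal (2 powr t) * (\<integral>\<^sup>+x. ennreal (u x powr t) \<partial>M) + ennreal (2 powr t) * (\<integral>\<^sup>+x. ennreal (v x powr t) \<partial>M)"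
    using m by (subst nn_integral_add) (auto simp: nn_integral_cmult)
  also have "\<dots> \<le> ennreal (2 powr t) * 1 + ennreal (2 powr t) * 1" using I by (intro add_mono mult_left_mono) auto
  also have "\<dots> = ennreal (2 powr t * 2)" by (simp add: ennreal_plus[symmetric] del: ennreal_plus)
  also have "\<dots> \<le> ennreal (4 powr t)"
  proof (rule ennreal_leI)
    have "(2::real) powr 1 \<le> 2 powr t" using t by (intro powr_mono) auto
    then have "2 powr t * 2 \<le> 2 powr t * (2 powr t :: real)" by (intro mult_left_mono) auto
    also have "\<dots> = 4 powr t" by (simp add: powr_mult[symmetric])
    finally show "2 powr t * 2 \<le> (4 powr t :: real)" .
  qed
  finally show ?thesis .
qed

lemma avg_cong: "(\<And>x. x \<in> space M \<Longrightarrow> f x = g x) \<Longrightarrow> avg M B f = avg M B g"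
  unfolding avg_def by (intro arg_cong2[where f="(/)"] nn_integral_cong) auto

lemma esssup_cong_space:
  assumes "\<And>x. x \<in> space M \<Longrightarrow> f x = g x" shows "esssup M f = (esssup M g :: ennreal)"
proof (cases "f \<in> borel_measurable M")
  case True
  then have "g \<in> borel_measurable M" using assms by (simp cong: measurable_cong)
  then show ?thesis using True assms by (intro esssup_AE_cong AE_I2)
next
  case False
  then have "g \<notin> borel_measurable M" using assms by (simp cong: measurable_cong)
  then show ?thesis using False by (simp add: esssup_non_measurable)
qed

text \<open>The powers of a weight are known on the space only, where it is positive
  semidefinite.\<close>

lemma A_const_cong:
  assumes "\<And>x. x \<in> space (leb n) \<Longrightarrow> W x = W' x"
  shows "A_const n \<B> r W = A_const n \<B> r W'"
  unfolding A_const_def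
  by (intro if_cong refl SUP_cong arg_cong2[where f=ennpow] avg_cong esssup_cong_space)
    (auto simp: assms space_restrict_space intro!: avg_cong)

section \<open>The extrapolation argument\<close>

text \<open>Both iterations and the factorization together. The two bounds \<open>4 d L\<close>
  from the iteration, with \<open>L = d\<^sup>2 K\<close>, contribute \<open>4 d\<^sup>3\<close>
  to the power \<open>\<theta> + (1 - \<theta>)\<close>, and the factorization contributes
  \<open>2 d\<^sup>4\<close>.\<close>

lemma extrapolation_weight:
  assumes d: "1 \<le> d" and mb: "matrix_Muckenhoupt_basis n \<B> K" and r: "1 < r"
    and VA: "V \<in> A_class n d \<B> (ereal r)" and \<theta>: "0 \<le> \<theta>" "\<theta> \<le> 1"
    and h1: "h1 \<in> borel_measurable (leb n)" "\<And>x. 0 < h1 x" "(\<integral>\<^sup>+x. ennreal (h1 x powr r) \<partial>leb n) \<le> ennreal (4 powr r)"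
    and h2: "h2 \<in> borel_measurable (leb n)" "\<And>x. 0 < h2 x"
      "(\<integral>\<^sup>+x. ennreal (h2 x powr (r / (r - 1))) \<partial>leb n) \<le> ennreal (4 powr (r / (r - 1)))"
  obtains H1 H2 where
    "H1 \<in> borel_measurable (leb n)" "\<And>x. h1 x \<le> H1 x" "(\<integral>\<^sup>+x. ennreal (H1 x powr r) \<partial>leb n) \<le> ennreal (16 powr r)"
    "H2 \<in> borel_measurable (leb n)" "\<And>x. h2 x \<le> H2 x"
    "(\<integral>\<^sup>+x. ennreal (H2 x powr (r / (r - 1))) \<partial>leb n) \<le> ennreal (16 powr (r / (r - 1)))"
    "A_const n \<B> (if \<theta> = 0 then \<infinity> else ereal (1 / \<theta>)) (\<lambda>x. (H2 x powr \<theta> * H1 x powr (\<theta> - 1)) \<cdot>\<^sub>m V x)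
      \<le> ennreal (8 * real d ^ 7 *
         K d (ereal (r / (r - 1))) (enn2real (A_const n \<B> (ereal (r / (r - 1))) (weight_powr V (-1)))) powr \<theta> *
         K d (ereal r) (enn2real (A_const n \<B> (ereal r) V)) powr (1 - \<theta>))"
proof -
  have mV: "matrix_weight n d V" using VA by (simp add: A_class_def)
  have \<B>: "basis n \<B>" using muckenhoupt_basisD(1)[OF mb d r] .
  define U where "U = weight_powr V (-1)"
  define r' where "r' = r / (r - 1)"
  have r': "1 < r'" using r by (simp add: r'_def)
  have UA: "U \<in> A_class n d \<B> (ereal r')" unfolding U_def r'_def by (rule dual_weight_class[OF d \<B> r VA])
  define k1 where "k1 = K d (ereal r) (enn2real (A_const n \<B> (ereal r) V))"
  define k2 where "k2 = K d (ereal r') (enn2real (A_const n \<B> (ereal r') U))"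
  have k: "0 \<le> k1" "0 \<le> k2" unfolding k1_def k2_def
    using muckenhoupt_basisD(2)[OF mb d r] muckenhoupt_basisD(2)[OF mb d r'] by auto
  define L1 where "L1 = (if k1 = 0 then 1 else real d ^ 2 * k1)"
  define L2 where "L2 = (if k2 = 0 then 1 else real d ^ 2 * k2)"
  have L: "0 < L1" "real d ^ 2 * k1 \<le> L1" "0 < L2" "real d ^ 2 * k2 \<le> L2" using k d by (auto simp: L1_def L2_def)
  have four: "ennreal (4 powr t) * ennreal (4 powr t) = ennreal (16 powr t)" for t
    by (simp add: ennreal_mult[symmetric] powr_mult[symmetric])
  have "(\<integral>\<^sup>+x. ennreal (h1 x powr r) \<partial>leb n) < \<infinity>" using h1(3) by (simp add: order.strict_trans1)
  then obtain H1 where H1: "H1 \<in> borel_measurable (leb n)" "\<And>x. h1 x \<le> H1 x"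
    "(\<integral>\<^sup>+x. ennreal (H1 x powr r) \<partial>leb n) \<le> ennreal (4 powr r) * (\<integral>\<^sup>+x. ennreal (h1 x powr r) \<partial>leb n)"
    "\<And>B. B \<in> \<B> \<Longrightarrow> AE x\<in>B in leb n. avg (leb n) B (\<lambda>y. ennreal (weight_ratio V x y * H1 y)) \<le> ennreal (4 * real d * L1 * H1 x)"
    using rubio_de_francia[OF d mb r VA h1(1) less_imp_le[OF h1(2)] _ L(1,2)[unfolded k1_def]] by blast
  have "(\<integral>\<^sup>+x. ennreal (h2 x powr r') \<partial>leb n) < \<infinity>" using h2(3) by (simp add: order.strict_trans1 r'_def)
  then obtain H2 where H2: "H2 \<in> borel_measurable (leb n)" "\<And>x. h2 x \<le> H2 x"
    "(\<integral>\<^sup>+x. ennreal (H2 x powr r') \<partial>leb n) \<le> ennreal (4 powr r') * (\<integral>\<^sup>+x. ennreal (h2 x powr r') \<partial>leb n)"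
    "\<And>B. B \<in> \<B> \<Longrightarrow> AE x\<in>B in leb n. avg (leb n) B (\<lambda>y. ennreal (weight_ratio U x y * H2 y)) \<le> ennreal (4 * real d * L2 * H2 x)"
    using rubio_de_francia[OF d mb r' UA h2(1) less_imp_le[OF h2(2)] _ L(3,4)[unfolded k2_def]] by blast
  have pos: "0 < H1 x" "0 < H2 x" for x using h1(2) H1(2) h2(2) H2(2) by (meson less_le_trans)+
  have H1I: "(\<integral>\<^sup>+x. ennreal (H1 x powr r) \<partial>leb n) \<le> ennreal (16 powr r)"
    unfolding four[symmetric] using H1(3) h1(3) by (meson mult_left_mono order_trans zero_le)
  have H2I: "(\<integral>\<^sup>+x. ennreal (H2 x powr r') \<partial>leb n) \<le> ennreal (16 powr r')"
    unfolding four[symmetric] using H2(3) h2(3)[folded r'_def] by (meson mult_left_mono order_trans zero_le)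
  have A2: "AE x\<in>B in leb n. avg (leb n) B (\<lambda>y. ennreal (weight_ratio V y x * H2 y)) \<le> ennreal (4 * real d * L2 * H2 x)"
    if B: "B \<in> \<B>" for B
    using H2(4)[OF B] AE_space
  proof (eventually_elim, intro impI)
    fix x assume *: "x \<in> B \<longrightarrow> avg (leb n) B (\<lambda>y. ennreal (weight_ratio U x y * H2 y)) \<le> ennreal (4 * real d * L2 * H2 x)"
      and xs: "x \<in> space (leb n)" and x: "x \<in> B"
    have "avg (leb n) B (\<lambda>y. ennreal (weight_ratio V y x * H2 y)) = avg (leb n) B (\<lambda>y. ennreal (weight_ratio U x y * H2 y))"
      unfolding U_def using xs by (intro avg_cong) (simp add: weight_ratio_inverse[OF mV])
    then show "avg (leb n) B (\<lambda>y. ennreal (weight_ratio V y x * H2 y)) \<le> ennreal (4 * real d * L2 * H2 x)"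
      using * x by simp
  qed
  let ?A = "A_const n \<B> (if \<theta> = 0 then \<infinity> else ereal (1 / \<theta>)) (\<lambda>x. (H2 x powr \<theta> * H1 x powr (\<theta> - 1)) \<cdot>\<^sub>m V x)"
  have "?A \<le> ennreal (8 * real d ^ 7 * k2 powr \<theta> * k1 powr (1 - \<theta>))"
  proof (cases "k1 = 0 \<or> k2 = 0")
    case True
    \<comment> \<open>All sets of the basis are null sets; the two hypotheses of the factorization then hold with
      arbitrarily small constants.\<close>
    have null: "emeasure (leb n) B = 0" if "B \<in> \<B>" for B
      using True vanishing_constant_null_basis[OF d mb r VA _ that] vanishing_constant_null_basis[OF d mb r' UA _ that]
      unfolding k1_def k2_def by blast
    have "?A \<le> ennreal (2 * real d ^ 4 * e powr \<theta> * e powr (1 - \<theta>))" if e: "0 < e" for e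
      by (rule reverse_factorization[OF d mV \<B> H1(1) pos(1) H2(1) pos(2) e e \<theta>])
        (auto simp: avg_null[OF basisD(1)[OF \<B>] null])
    then have e: "?A \<le> ennreal (2 * real d ^ 4 * e)" if "0 < e" for e
      using that by (simp add: mult.assoc powr_add[symmetric])
    have "?A \<le> 0"
    proof (rule ennreal_le_epsilon)
      fix e :: real assume "0 < e"
      then have "?A \<le> ennreal (2 * real d ^ 4 * (e / (2 * real d ^ 4)))" using d by (intro e) auto
      then show "?A \<le> 0 + ennreal e" using d by simp
    qed
    then show ?thesis by simp
  next
    case False
    then have kp: "0 < k1" "0 < k2" using k by auto
    have Lk: "L1 = real d ^ 2 * k1" "L2 = real d ^ 2 * k2" using False by (auto simp: L1_def L2_def)
    have dp: "0 < real d" using d by simp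
    have "?A \<le> ennreal (2 * real d ^ 4 * (4 * real d * L2) powr \<theta> * (4 * real d * L1) powr (1 - \<theta>))"
      by (rule reverse_factorization[OF d mV \<B> H1(1) pos(1) H2(1) pos(2) _ _ \<theta> H1(4) A2]) (use L dp in auto)
    also have "2 * real d ^ 4 * (4 * real d * L2) powr \<theta> * (4 * real d * L1) powr (1 - \<theta>)
      = 8 * real d ^ 7 * k2 powr \<theta> * k1 powr (1 - \<theta>)"
    proof -
      define D where "D = 4 * real d ^ 3"
      have D: "0 < D" using dp by (simp add: D_def)
      have e: "4 * real d * L2 = D * k2" "4 * real d * L1 = D * k1"
        by (simp_all add: Lk D_def power2_eq_square power3_eq_cube)
      have "2 * real d ^ 4 * (4 * real d * L2) powr \<theta> * (4 * real d * L1) powr (1 - \<theta>)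
        = 2 * real d ^ 4 * (D powr \<theta> * D powr (1 - \<theta>)) * k2 powr \<theta> * k1 powr (1 - \<theta>)"
        unfolding e using k D by (simp add: powr_mult)
      also have "D powr \<theta> * D powr (1 - \<theta>) = D" using D by (simp add: powr_add[symmetric])
      also have "2 * real d ^ 4 * D = 8 * real d ^ 7" by (simp add: D_def power_add[symmetric])
      finally show ?thesis .
    qed
    finally show ?thesis .
  qed
  then show ?thesis using that[OF H1(1,2) H1I H2(1,2) H2I[unfolded r'_def]]
    unfolding k1_def k2_def U_def r'_def by blast
qed

lemma exponent_reciprocal:
  fixes t :: ereal
  assumes "1 \<le> t"
  obtains a where "0 \<le> a" "a \<le> 1" "1 / t = ereal a" "t = (if a = 0 then \<infinity> else ereal (1 / a))"
proof (cases t)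
  case (real x)
  then have "1 \<le> x" using assms by (simp add: one_ereal_def)
  then show ?thesis using that[of "1 / x"] real by (simp add: one_ereal_def)
next
  case PInf
  then show ?thesis using that[of 0] by simp
next
  case MInf
  then show ?thesis using assms by simp
qed

lemma conj_exp_reciprocal: "1 \<le> s \<Longrightarrow> 1 / conj_exp (ereal s) = ereal (1 - 1 / s)"
proof (cases "s = 1")
  case True
  then show ?thesis by (simp add: conj_exp_def one_ereal_def[symmetric] divide_ereal_def)
next
  case False
  assume "1 \<le> s"
  then show ?thesis using False conj_exp_real[of s] by (simp add: one_ereal_def field_simps)
qed

text \<open>The reciprocals \<open>\<alpha> = 1 / q0\<close> and \<open>\<pi> = 1 / p0\<close>
  are real numbers, which are 0 for infinite exponents. In terms of them \<open>1 / r0 = s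
  \<alpha>\<close>.\<close>

lemma exponent_data:
  assumes s: "1 \<le> s" and p0: "1 \<le> p0" "p0 \<le> q0" and eq: "1 / p0 - 1 / q0 = 1 / conj_exp (ereal s)"
    and r0: "r0 = q0 / ereal s"
  obtains \<alpha> \<pi> where "0 \<le> \<alpha>" "\<pi> = \<alpha> + 1 - 1 / s" "s * \<alpha> \<le> 1"
    "q0 = (if \<alpha> = 0 then \<infinity> else ereal (1 / \<alpha>))" "p0 = (if \<pi> = 0 then \<infinity> else ereal (1 / \<pi>))"
    "r0 = (if s * \<alpha> = 0 then \<infinity> else ereal (1 / (s * \<alpha>)))"
    "real_of_ereal (1 / r0) = s * \<alpha>" "real_of_ereal (1 / conj_exp r0) = 1 - s * \<alpha>"
    "1 / p0 - 1 / q0 = ereal (1 - 1 / s)"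
proof -
  obtain \<alpha> where a: "0 \<le> \<alpha>" "\<alpha> \<le> 1" "1 / q0 = ereal \<alpha>" "q0 = (if \<alpha> = 0 then \<infinity> else ereal (1 / \<alpha>))"
    using exponent_reciprocal[of q0] p0 by (metis order_trans)
  obtain \<pi> where b: "0 \<le> \<pi>" "\<pi> \<le> 1" "1 / p0 = ereal \<pi>" "p0 = (if \<pi> = 0 then \<infinity> else ereal (1 / \<pi>))"
    using exponent_reciprocal[of p0] p0 by metis
  have e: "1 / p0 - 1 / q0 = ereal (1 - 1 / s)" using eq conj_exp_reciprocal[OF s] by simp
  then have \<pi>: "\<pi> = \<alpha> + 1 - 1 / s" unfolding a(3) b(3) by simp
  have "\<alpha> \<le> 1 / s" using \<pi> b(2) by simp
  then have sa: "s * \<alpha> \<le> 1" using s by (simp add: field_simps)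
  have r0': "r0 = (if s * \<alpha> = 0 then \<infinity> else ereal (1 / (s * \<alpha>)))"
    using s unfolding r0 a(4) by (simp add: field_simps)
  have i: "1 / r0 = ereal (s * \<alpha>)" using s a(1) unfolding r0' by (simp add: one_ereal_def)
  have "1 / conj_exp r0 = ereal (1 - s * \<alpha>)"
  proof (cases "s * \<alpha> = 1")
    case True
    then show ?thesis unfolding conj_exp_def i by (simp add: one_ereal_def[symmetric] divide_ereal_def)
  next
    case False
    then show ?thesis unfolding conj_exp_def i by (simp add: one_ereal_def)
  qed
  then show ?thesis using that[OF a(1) \<pi> sa a(4) b(4) r0' _ _ e] i by simp
qed

lemma Lnorm_infinity: "Lnorm M \<infinity> g = esssup M g"
  by (simp add: Lnorm_def)

text \<open>Inserting the bound for \<open>F\<close>, the integrand is at most \<open>\<mu>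
  (H1\<^sup>r)\<^sup>1\<^sup>-\<^sup>1\<^sup>/\<^sup>s (H1 H2)\<^sup>\<alpha>\<close>. These two
  exponents add up to \<open>\<pi>\<close>, which is Hoelder's condition for the norm with
  exponent \<open>1 / \<pi>\<close>.\<close>

lemma source_bound:
  fixes F H1 H2 :: "pt \<Rightarrow> real"
  assumes m: "F \<in> borel_measurable M" "H1 \<in> borel_measurable M" "H2 \<in> borel_measurable M"
    and nn: "\<And>x. 0 \<le> F x" "\<And>x. 0 < H1 x" "\<And>x. 0 < H2 x"
    and s: "1 \<le> s" and \<alpha>: "0 \<le> \<alpha>" "s * \<alpha> \<le> 1" and \<beta>: "\<beta> = 1 / s - \<alpha>" and \<pi>: "\<pi> = \<alpha> + 1 - 1 / s"
    and pq: "1 < p" "p \<le> q" "1 / p - 1 / q = 1 - 1 / s" and r: "r = q / s" "1 < r"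
    and \<mu>: "0 < \<mu>" and F: "\<And>x. F x \<le> \<mu> * H1 x powr (r / p)"
    and I1: "(\<integral>\<^sup>+x. ennreal (H1 x powr r) \<partial>M) \<le> ennreal (16 powr r)"
    and I12: "(\<integral>\<^sup>+x. ennreal (H1 x * H2 x) \<partial>M) \<le> ennreal 256"
  shows "Lnorm M (if \<pi> = 0 then \<infinity> else ereal (1 / \<pi>)) (\<lambda>x. ennreal (H2 x powr \<alpha> * H1 x powr - \<beta> * F x))
    \<le> ennreal (\<mu> * 16 powr q * 256)"
proof -
  note [measurable] = m
  have ex: "r / p - \<beta> = r * (1 - 1 / s) + \<alpha>"
  proof -
    have "1 / p = 1 / q + (1 - 1 / s)" using pq(3) by simp
    then have "r / p = r * (1 / q + (1 - 1 / s))" by (simp only: divide_inverse mult_1_left)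
    also have "r * (1 / q) = 1 / s" using pq r s by simp
    then have "r * (1 / q + (1 - 1 / s)) = 1 / s + r * (1 - 1 / s)" by (simp add: distrib_left)
    finally show ?thesis by (simp add: \<beta>)
  qed
  have s1: "0 \<le> 1 - 1 / s" "1 - 1 / s \<le> 1" using s by auto
  have \<pi>0: "0 \<le> \<pi>" using \<pi> \<alpha> s1 by simp
  have \<alpha>1: "\<alpha> \<le> 1"
  proof -
    have "1 * \<alpha> \<le> s * \<alpha>" using s \<alpha> by (intro mult_right_mono) auto
    then show ?thesis using \<alpha> by simp
  qed
  have q16: "1 \<le> (16::real) powr q" using pq by (intro ge_one_powr_ge_zero) auto
  have pw: "H2 x powr \<alpha> * H1 x powr - \<beta> * F x \<le> \<mu> * ((H1 x powr r) powr (1 - 1 / s) * (H1 x * H2 x) powr \<alpha>)" for x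
  proof -
    have "H2 x powr \<alpha> * H1 x powr - \<beta> * F x \<le> H2 x powr \<alpha> * H1 x powr - \<beta> * (\<mu> * H1 x powr (r / p))"
      using F by (intro mult_left_mono) auto
    also have "\<dots> = \<mu> * (H1 x powr (r / p - \<beta>) * H2 x powr \<alpha>)"
      using nn(2)[of x] by (simp add: powr_diff powr_minus field_simps)
    also have "H1 x powr (r / p - \<beta>) * H2 x powr \<alpha> = (H1 x powr r) powr (1 - 1 / s) * (H1 x * H2 x) powr \<alpha>"
      unfolding ex using nn(2)[of x] nn(3)[of x] by (simp add: powr_add powr_powr powr_mult)
    finally show ?thesis .
  qed
  show ?thesis
  proof (cases "\<pi> = 0")
    case True
    then have z: "\<alpha> = 0" "1 - 1 / s = 0" using \<pi> \<alpha>(1) s1(1) by linarith+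
    have bd: "H2 x powr \<alpha> * H1 x powr - \<beta> * F x \<le> \<mu>" for x
      using pw[of x] nn(2)[of x] nn(3)[of x] unfolding z by simp
    have "esssup M (\<lambda>x. ennreal (H2 x powr \<alpha> * H1 x powr - \<beta> * F x)) \<le> ennreal \<mu>"
    proof (rule esssup_I)
      show "(\<lambda>x. ennreal (H2 x powr \<alpha> * H1 x powr - \<beta> * F x)) \<in> borel_measurable M" by measurable
    qed (use bd in \<open>auto intro!: ennreal_leI\<close>)
    also have "\<dots> \<le> ennreal (\<mu> * 16 powr q * 256)"
    proof (rule ennreal_leI)
      have "\<mu> * 1 \<le> \<mu> * (16 powr q * 256)" using q16 \<mu> by (intro mult_left_mono) auto
      then show "\<mu> \<le> \<mu> * 16 powr q * 256" by (simp add: mult.assoc)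
    qed
    finally show ?thesis using True by (simp add: Lnorm_infinity)
  next
    case False
    define P where "P = 1 / \<pi>"
    have P: "0 < P" using False \<pi>0 by (simp add: P_def)
    define a where "a = P * (1 - 1 / s)"
    define b where "b = P * \<alpha>"
    have "a + b = P * \<pi>" by (simp add: a_def b_def \<pi> algebra_simps)
    then have ab: "0 \<le> a" "0 \<le> b" "a + b = 1"
      using P s1 \<alpha> False by (auto simp: a_def b_def P_def)
    have "(\<integral>\<^sup>+x. ennreal ((H2 x powr \<alpha> * H1 x powr - \<beta> * F x) powr P) \<partial>M)
      \<le> (\<integral>\<^sup>+x. ennreal (\<mu> powr P) * ennreal ((H1 x powr r) powr a * (H1 x * H2 x) powr b) \<partial>M)"
    proof (rule nn_integral_mono)
      fix x
      have "(H2 x powr \<alpha> * H1 x powr - \<beta> * F x) powr P \<le> (\<mu> * ((H1 x powr r) powr (1 - 1 / s) * (H1 x * H2 x) powr \<alpha>)) powr P"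
        using pw nn(1)[of x] P by (intro powr_mono2) auto
      also have "\<dots> = \<mu> powr P * ((H1 x powr r) powr a * (H1 x * H2 x) powr b)"
        using \<mu> by (simp add: powr_mult powr_powr a_def b_def mult_ac)
      finally show "ennreal ((H2 x powr \<alpha> * H1 x powr - \<beta> * F x) powr P) \<le> ennreal (\<mu> powr P) * ennreal ((H1 x powr r) powr a * (H1 x * H2 x) powr b)"
        by (simp add: ennreal_mult[symmetric] ennreal_leI)
    qed
    also have "\<dots> = ennreal (\<mu> powr P) * (\<integral>\<^sup>+x. ennreal ((H1 x powr r) powr a * (H1 x * H2 x) powr b) \<partial>M)"
      by (intro nn_integral_cmult) measurable
    also have "\<dots> \<le> ennreal (\<mu> powr P) * ennreal ((16 powr r) powr a * 256 powr b)"
      using nn I1 I12 ab by (intro mult_left_mono nn_integral_Hoelder) (auto simp: less_imp_le)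
    also have "\<dots> = ennreal (\<mu> powr P * ((16 powr r) powr a * 256 powr b))"
      by (simp add: ennreal_mult)
    finally have "ennpow (\<integral>\<^sup>+x. ennreal ((H2 x powr \<alpha> * H1 x powr - \<beta> * F x) powr P) \<partial>M) (1 / P)
       \<le> ennpow (ennreal (\<mu> powr P * ((16 powr r) powr a * 256 powr b))) (1 / P)"
      using P by (intro ennpow_mono) auto
    also have "\<dots> = ennreal (\<mu> * (16 powr (r * (1 - 1 / s)) * 256 powr \<alpha>))"
      using P \<mu> by (simp add: powr_mult powr_powr a_def b_def)
    also have "\<dots> \<le> ennreal (\<mu> * 16 powr q * 256)"
    proof (rule ennreal_leI)
      have "r * (1 - 1 / s) \<le> r * 1" using r s1 by (intro mult_left_mono) auto
      also have "r * 1 \<le> q" using r s pq by (simp add: divide_le_eq mult_le_cancel_left1)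
      finally have 1: "(16::real) powr (r * (1 - 1 / s)) \<le> 16 powr q" by (intro powr_mono) auto
      have 2: "(256::real) powr \<alpha> \<le> 256 powr 1" using \<alpha>1 by (intro powr_mono) auto
      have "16 powr (r * (1 - 1 / s)) * 256 powr \<alpha> \<le> 16 powr q * (256 powr 1 :: real)"
        using 1 2 by (intro mult_mono) auto
      then have "\<mu> * (16 powr (r * (1 - 1 / s)) * 256 powr \<alpha>) \<le> \<mu> * (16 powr q * 256)"
        using \<mu> by (intro mult_left_mono) auto
      then show "\<mu> * (16 powr (r * (1 - 1 / s)) * 256 powr \<alpha>) \<le> \<mu> * 16 powr q * 256" by (simp add: mult.assoc)
    qed
    finally show ?thesis using False nn(1) by (simp add: Lnorm_real P_def)
  qed
qed

text \<open>If \<open>u\<close> is the function whose norm is bounded by \<open>E\<close>, then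
  \<open>g\<^sup>s H2 = u\<^sup>s (H1 H2)\<^sup>1\<^sup>-\<^sup>s\<^sup>\<alpha>\<close>, to
  which Hoelder's inequality applies with the exponents \<open>s \<alpha>\<close> and \<open>1 -
  s \<alpha>\<close>.\<close>

lemma target_bound:
  fixes g h H1 H2 :: "pt \<Rightarrow> real"
  assumes m: "g \<in> borel_measurable M" "H1 \<in> borel_measurable M" "H2 \<in> borel_measurable M"
    and nn: "\<And>x. 0 \<le> g x" "\<And>x. 0 < H1 x" "\<And>x. 0 < H2 x"
    and s: "1 \<le> s" and \<alpha>: "0 \<le> \<alpha>" "s * \<alpha> \<le> 1" and \<beta>: "\<beta> = 1 / s - \<alpha>"
    and E: "0 < E" "Lnorm M (if \<alpha> = 0 then \<infinity> else ereal (1 / \<alpha>)) (\<lambda>x. ennreal (H2 x powr \<alpha> * H1 x powr - \<beta> * g x)) \<le> ennreal E"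
    and h: "\<And>x. h x \<le> H2 x"
    and I12: "(\<integral>\<^sup>+x. ennreal (H1 x * H2 x) \<partial>M) \<le> ennreal 256"
  shows "(\<integral>\<^sup>+x. ennreal (g x powr s * h x) \<partial>M) \<le> ennreal (E powr s * 256)"
proof -
  note [measurable] = m
  define u where "u x = H2 x powr \<alpha> * H1 x powr - \<beta> * g x" for x
  have u: "0 \<le> u x" for x using nn(1)[of x] by (simp add: u_def)
  have um[measurable]: "u \<in> borel_measurable M" unfolding u_def by measurable
  have sb: "s * \<beta> = 1 - s * \<alpha>" using s by (simp add: \<beta> algebra_simps)
  have gH: "g x powr s * H2 x = u x powr s * (H1 x * H2 x) powr (1 - s * \<alpha>)" for x
  proof -
    have "u x powr s = H2 x powr (s * \<alpha>) * H1 x powr - (1 - s * \<alpha>) * g x powr s"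
      using nn(1)[of x] unfolding u_def sb[symmetric] by (simp add: powr_mult powr_powr mult.commute)
    then have "u x powr s * (H1 x * H2 x) powr (1 - s * \<alpha>)
      = (H2 x powr (s * \<alpha>) * H2 x powr (1 - s * \<alpha>)) * (H1 x powr - (1 - s * \<alpha>) * H1 x powr (1 - s * \<alpha>)) * g x powr s"
      using nn(2)[of x] nn(3)[of x] by (simp add: powr_mult)
    also have "H2 x powr (s * \<alpha>) * H2 x powr (1 - s * \<alpha>) = H2 x"
      using nn(3)[of x] by (simp add: powr_add[symmetric])
    also have "H1 x powr - (1 - s * \<alpha>) * H1 x powr (1 - s * \<alpha>) = 1"
      using nn(2)[of x] by (simp only: powr_add[symmetric]) simp
    finally show ?thesis by simp
  qed
  have "(\<integral>\<^sup>+x. ennreal (g x powr s * h x) \<partial>M) \<le> (\<integral>\<^sup>+x. ennreal (u x powr s * (H1 x * H2 x) powr (1 - s * \<alpha>)) \<partial>M)"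
    unfolding gH[symmetric] using h by (intro nn_integral_mono ennreal_leI mult_left_mono) auto
  also have "\<dots> \<le> ennreal (E powr s * 256)"
  proof (cases "\<alpha> = 0")
    case True
    then have "esssup M (\<lambda>x. ennreal (u x)) \<le> ennreal E" using E(2) by (simp add: Lnorm_infinity u_def)
    then have "AE x in M. ennreal (u x) \<le> ennreal E" using esssup_AE[of "\<lambda>x. ennreal (u x)" M] by (auto elim: eventually_mono)
    then have "AE x in M. ennreal (u x powr s * (H1 x * H2 x) powr (1 - s * \<alpha>)) \<le> ennreal (E powr s) * ennreal (H1 x * H2 x)"
    proof eventually_elim
      case (elim x)
      then have "u x \<le> E" using E(1) by simp
      then have "u x powr s \<le> E powr s" using u s by (intro powr_mono2) auto
      then have "u x powr s * (H1 x * H2 x) \<le> E powr s * (H1 x * H2 x)"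
        using nn(2)[of x] nn(3)[of x] by (intro mult_right_mono) auto
      then show ?case using True nn(2)[of x] nn(3)[of x]
        by (simp add: ennreal_mult[symmetric] ennreal_leI less_imp_le)
    qed
    then have "(\<integral>\<^sup>+x. ennreal (u x powr s * (H1 x * H2 x) powr (1 - s * \<alpha>)) \<partial>M) \<le> (\<integral>\<^sup>+x. ennreal (E powr s) * ennreal (H1 x * H2 x) \<partial>M)"
      by (rule nn_integral_mono_AE)
    also have "\<dots> = ennreal (E powr s) * (\<integral>\<^sup>+x. ennreal (H1 x * H2 x) \<partial>M)" by (intro nn_integral_cmult) measurable
    also have "\<dots> \<le> ennreal (E powr s) * ennreal 256" using I12 by (intro mult_left_mono) auto
    finally show ?thesis by (simp add: ennreal_mult)
  next
    case False
    then have ap: "0 < \<alpha>" using \<alpha> by simp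
    have "ennpow (ennpow (\<integral>\<^sup>+x. ennreal (u x powr (1 / \<alpha>)) \<partial>M) \<alpha>) (1 / \<alpha>) \<le> ennpow (ennreal E) (1 / \<alpha>)"
      using E(2) False u ap by (intro ennpow_mono) (auto simp: Lnorm_real u_def[symmetric])
    then have Iu: "(\<integral>\<^sup>+x. ennreal (u x powr (1 / \<alpha>)) \<partial>M) \<le> ennreal (E powr (1 / \<alpha>))"
      using ap E(1) by (simp add: ennpow_inverse)
    have "(\<integral>\<^sup>+x. ennreal ((u x powr (1 / \<alpha>)) powr (s * \<alpha>) * (H1 x * H2 x) powr (1 - s * \<alpha>)) \<partial>M)
       \<le> ennreal ((E powr (1 / \<alpha>)) powr (s * \<alpha>) * 256 powr (1 - s * \<alpha>))"
      using nn \<alpha> s E(1) Iu I12 by (intro nn_integral_Hoelder) (auto simp: less_imp_le)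
    also have "(E powr (1 / \<alpha>)) powr (s * \<alpha>) = E powr s" using ap E(1) by (simp add: powr_powr)
    also have "ennreal (E powr s * 256 powr (1 - s * \<alpha>)) \<le> ennreal (E powr s * 256)"
    proof (intro ennreal_leI mult_left_mono)
      have "(256::real) powr (1 - s * \<alpha>) \<le> 256 powr 1" using s \<alpha> by (intro powr_mono) auto
      then show "(256::real) powr (1 - s * \<alpha>) \<le> 256" by simp
    qed auto
    finally show ?thesis using ap u by (simp add: powr_powr)
  qed
  finally show ?thesis .
qed

lemma vec_funD:
  assumes "f \<in> vec_fun n d"
  shows "\<And>x. x \<in> space (leb n) \<Longrightarrow> f x \<in> carrier_vec d" "\<And>i. i < d \<Longrightarrow> (\<lambda>x. f x $ i) \<in> borel_measurable (leb n)"
  using assms by (auto simp: vec_fun_def)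

lemma measurable_weighted_norm:
  assumes "matrix_weight n d W" "f \<in> vec_fun n d"
  shows "(\<lambda>x. vnorm (W x *\<^sub>v f x)) \<in> borel_measurable (leb n)"
proof (rule measurable_vnorm(1)[of _ _ d])
  show "(\<lambda>x. (W x *\<^sub>v f x) $ i) \<in> borel_measurable (leb n)" if "i < d" for i
    using measurable_mult_mat_vec_entry[of "leb n" W d f i] matrix_weightD(2,3)[OF assms(1)] vec_funD[OF assms(2)] that by auto
qed (use matrix_weightD(2)[OF assms(1)] vec_funD[OF assms(2)] in \<open>auto intro!: mult_mat_vec_carrier\<close>)

lemma Lnorm_cong:
  assumes "\<And>x. x \<in> space M \<Longrightarrow> f x = g x"
  shows "Lnorm M t f = Lnorm M t g"
proof -
  have "(\<integral>\<^sup>+x. ennpow (f x) (real_of_ereal t) \<partial>M) = (\<integral>\<^sup>+x. ennpow (g x) (real_of_ereal t) \<partial>M)"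
    using assms by (intro nn_integral_cong) simp
  then show ?thesis using esssup_cong_space[of M f g] assms by (simp add: Lnorm_def)
qed

lemma wnorm_scaled:
  assumes W: "matrix_weight n d W" and f: "f \<in> vec_fun n d" and c: "\<And>x. 0 \<le> c x"
  shows "wnorm n (\<lambda>x. c x \<cdot>\<^sub>m W x) t f = Lnorm (leb n) t (\<lambda>x. ennreal (c x * vnorm (W x *\<^sub>v f x)))"
  unfolding wnorm_def
proof (rule Lnorm_cong)
  fix x assume x: "x \<in> space (leb n)"
  have "(c x \<cdot>\<^sub>m W x) *\<^sub>v f x = c x \<cdot>\<^sub>v (W x *\<^sub>v f x)"
    using matrix_weightD(2)[OF W x] vec_funD(1)[OF f x] by (intro eq_vecI) auto
  then show "ennreal (vnorm ((c x \<cdot>\<^sub>m W x) *\<^sub>v f x)) = ennreal (c x * vnorm (W x *\<^sub>v f x))" using c[of x] by simp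
qed

text \<open>A positive upper bound \<open>\<mu>\<close> stands for the norm of \<open>W
  f\<close>, so that functions of norm 0 need no separate treatment.\<close>

lemma extrapolation_step:
  fixes s \<alpha> \<pi> p q \<mu> :: real
  assumes d: "1 \<le> d" and mb: "matrix_Muckenhoupt_basis n \<B> K"
    and s: "1 \<le> s" and \<alpha>: "0 \<le> \<alpha>" "s * \<alpha> \<le> 1" and \<pi>: "\<pi> = \<alpha> + 1 - 1 / s"
    and pq: "1 < p" "p \<le> q" "1 / p - 1 / q = 1 - 1 / s"
    and W: "matrix_weight n d W" "weight_powr W s \<in> A_class n d \<B> (ereal (q / s))"
    and f: "f \<in> vec_fun n d" and Tf: "Tf \<in> vec_fun n d"
    and N: "\<And>c. 0 \<le> c \<Longrightarrow> 0 < N c" "mono_on {0..} N"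
    and hyp: "\<And>W0. matrix_weight n d W0 \<Longrightarrow> weight_powr W0 s \<in> A_class n d \<B> (if s * \<alpha> = 0 then \<infinity> else ereal (1 / (s * \<alpha>))) \<Longrightarrow>
      wnorm n W0 (if \<alpha> = 0 then \<infinity> else ereal (1 / \<alpha>)) Tf
        \<le> ennreal (N (enn2real (A_const n \<B> (if s * \<alpha> = 0 then \<infinity> else ereal (1 / (s * \<alpha>))) (weight_powr W0 s)))) *
          wnorm n W0 (if \<pi> = 0 then \<infinity> else ereal (1 / \<pi>)) f"
    and \<mu>: "0 < \<mu>" "(\<integral>\<^sup>+x. ennreal (vnorm (W x *\<^sub>v f x) powr p) \<partial>leb n) \<le> ennreal (\<mu> powr p)"
    and X: "8 * real d ^ 7 *
       K d (conj_exp (ereal (q / s))) (enn2real (A_const n \<B> (conj_exp (ereal (q / s))) (weight_powr W (- s)))) powr (s * \<alpha>) *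
       K d (ereal (q / s)) (enn2real (A_const n \<B> (ereal (q / s)) (weight_powr W s))) powr (1 - s * \<alpha>) \<le> X"
  shows "wnorm n W (ereal q) Tf \<le> ennreal (65536 * 16 powr q * N X * \<mu>)"
proof -
  interpret sigma_finite_measure "leb n" by (rule sigma_finite_leb)
  define r where "r = q / s"
  have sq: "s < q"
  proof -
    have "1 / p < 1" using pq(1) by simp
    then have "1 / q < 1 / s" using pq(3) by linarith
    then show ?thesis using s pq by (simp add: field_simps)
  qed
  have r: "1 < r" using sq s by (simp add: r_def)
  define V where "V = weight_powr W s"
  have VA: "V \<in> A_class n d \<B> (ereal r)" using W(2) by (simp add: V_def r_def)
  have mV: "matrix_weight n d V" using VA by (simp add: A_class_def)
  define F where "F x = vnorm (W x *\<^sub>v f x)" for x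
  define g where "g x = vnorm (W x *\<^sub>v Tf x)" for x
  have Fm[measurable]: "F \<in> borel_measurable (leb n)" unfolding F_def by (rule measurable_weighted_norm[OF W(1) f])
  have gm[measurable]: "g \<in> borel_measurable (leb n)" unfolding g_def by (rule measurable_weighted_norm[OF W(1) Tf])
  have Fg: "0 \<le> F x" "0 \<le> g x" for x by (simp_all add: F_def g_def)
  define r' where "r' = r / (r - 1)"
  have r': "1 < r'" "1 / r + 1 / r' = 1" using r by (auto simp: r'_def field_simps)
  \<comment> \<open>Positive functions are added to the functions to be majorized, since the new
    weight has to be invertible also where those vanish.\<close>
  obtain \<phi>1 where \<phi>1: "\<phi>1 \<in> borel_measurable (leb n)" "\<And>x. 0 < \<phi>1 x" "(\<integral>\<^sup>+x. ennreal (\<phi>1 x powr r) \<partial>leb n) \<le> 1"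
    using ex_positive_Lp_function[of r] r by auto
  obtain \<phi>2 where \<phi>2: "\<phi>2 \<in> borel_measurable (leb n)" "\<And>x. 0 < \<phi>2 x" "(\<integral>\<^sup>+x. ennreal (\<phi>2 x powr r') \<partial>leb n) \<le> 1"
    using ex_positive_Lp_function[of r'] r' by auto
  define u where "u x = (F x / \<mu>) powr (p / r)" for x
  have um[measurable]: "u \<in> borel_measurable (leb n)" unfolding u_def by measurable
  have uI: "(\<integral>\<^sup>+x. ennreal (u x powr r) \<partial>leb n) \<le> 1"
  proof -
    have "(\<integral>\<^sup>+x. ennreal (u x powr r) \<partial>leb n) = (\<integral>\<^sup>+x. ennreal (1 / \<mu> powr p) * ennreal (F x powr p) \<partial>leb n)"
      using r \<mu>(1) Fg by (intro nn_integral_cong) (simp add: u_def powr_powr powr_divide ennreal_mult[symmetric])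
    also have "\<dots> = ennreal (1 / \<mu> powr p) * (\<integral>\<^sup>+x. ennreal (F x powr p) \<partial>leb n)" by (intro nn_integral_cmult) measurable
    also have "\<dots> \<le> ennreal (1 / \<mu> powr p) * ennreal (\<mu> powr p)" using \<mu>(2) by (intro mult_left_mono) (auto simp: F_def)
    also have "\<dots> = 1" using \<mu>(1) by (simp add: ennreal_mult[symmetric])
    finally show ?thesis .
  qed
  define h1 where "h1 x = u x + \<phi>1 x" for x
  have h1: "h1 \<in> borel_measurable (leb n)" "0 < h1 x" "(\<integral>\<^sup>+x. ennreal (h1 x powr r) \<partial>leb n) \<le> ennreal (4 powr r)" for x
  proof -
    show "h1 \<in> borel_measurable (leb n)" unfolding h1_def using \<phi>1(1) by measurable
    show "0 < h1 x" using \<phi>1(2)[of x] by (simp add: h1_def u_def add_nonneg_pos)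
    show "(\<integral>\<^sup>+x. ennreal (h1 x powr r) \<partial>leb n) \<le> ennreal (4 powr r)"
      unfolding h1_def using \<phi>1 r uI um by (intro add_Lp_bound) (auto simp: less_imp_le u_def)
  qed
  \<comment> \<open>The factors 16 and 256 stem from \<open>||h1||, ||h2|| \<le> 4\<close>: the
    iteration multiplies these norms by at most 4, which gives \<open>||H1||, ||H2|| \<le>
    16\<close> and \<open>\<integral> H1 H2 \<le> 256\<close>.\<close>
  define E where "E = N X * (\<mu> * 16 powr q * 256)"
  let ?r0 = "if s * \<alpha> = 0 then \<infinity> else ereal (1 / (s * \<alpha>))"
  have K0: "0 \<le> X" using X d by (meson mult_nonneg_nonneg order_trans powr_ge_zero of_nat_0_le_iff zero_le_power zero_le_numeral)
  have E: "0 < E" using N(1)[OF K0] \<mu>(1) by (simp add: E_def)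
  have main: "(\<integral>\<^sup>+x. ennreal (g x powr s * h x) \<partial>leb n) \<le> ennreal (E powr s * 256)"
    if h: "h \<in> borel_measurable (leb n)" "\<And>x. 0 \<le> h x" "(\<integral>\<^sup>+x. ennreal (h x powr r') \<partial>leb n) \<le> 1" for h
  proof -
    define h2 where "h2 x = h x + \<phi>2 x" for x
    have h2: "h2 \<in> borel_measurable (leb n)" "0 < h2 x" "(\<integral>\<^sup>+x. ennreal (h2 x powr r') \<partial>leb n) \<le> ennreal (4 powr r')" for x
    proof -
      show "h2 \<in> borel_measurable (leb n)" unfolding h2_def using \<phi>2(1) h(1) by measurable
      show "0 < h2 x" using \<phi>2(2)[of x] h(2)[of x] by (simp add: h2_def add_nonneg_pos)
      show "(\<integral>\<^sup>+x. ennreal (h2 x powr r') \<partial>leb n) \<le> ennreal (4 powr r')"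
        unfolding h2_def using \<phi>2 r' h by (intro add_Lp_bound) (auto simp: less_imp_le)
    qed
    have \<theta>: "0 \<le> s * \<alpha>" "s * \<alpha> \<le> 1" using s \<alpha> by auto
    obtain H1 H2 where H:
      "H1 \<in> borel_measurable (leb n)" "\<And>x. h1 x \<le> H1 x" "(\<integral>\<^sup>+x. ennreal (H1 x powr r) \<partial>leb n) \<le> ennreal (16 powr r)"
      "H2 \<in> borel_measurable (leb n)" "\<And>x. h2 x \<le> H2 x" "(\<integral>\<^sup>+x. ennreal (H2 x powr r') \<partial>leb n) \<le> ennreal (16 powr r')"
      and HA: "A_const n \<B> ?r0 (\<lambda>x. (H2 x powr (s * \<alpha>) * H1 x powr (s * \<alpha> - 1)) \<cdot>\<^sub>m V x)
        \<le> ennreal (8 * real d ^ 7 *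
         K d (ereal r') (enn2real (A_const n \<B> (ereal r') (weight_powr V (-1)))) powr (s * \<alpha>) *
         K d (ereal r) (enn2real (A_const n \<B> (ereal r) V)) powr (1 - s * \<alpha>))"
      using extrapolation_weight[OF d mb r VA \<theta> h1 h2[unfolded r'_def]] unfolding r'_def by blast
    have pos: "0 < H1 x" "0 < H2 x" for x using h1(2)[of x] H(2)[of x] h2(2)[of x] H(5)[of x] by auto
    note [measurable] = H(1,4)
    have I12: "(\<integral>\<^sup>+x. ennreal (H1 x * H2 x) \<partial>leb n) \<le> ennreal 256"
    proof -
      have "(\<integral>\<^sup>+x. ennreal (H1 x * H2 x) \<partial>leb n) = (\<integral>\<^sup>+x. ennreal ((H1 x powr r) powr (1 / r) * (H2 x powr r') powr (1 / r')) \<partial>leb n)"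
        using r r' pos by (simp add: powr_powr less_imp_le)
      also have "\<dots> \<le> ennreal ((16 powr r) powr (1 / r) * (16 powr r') powr (1 / r'))"
        using r r' H by (intro nn_integral_Hoelder) auto
      also have "\<dots> = ennreal 256" using r r' by (simp add: powr_powr)
      finally show ?thesis .
    qed
    define \<beta> where "\<beta> = 1 / s - \<alpha>"
    define c where "c x = H2 x powr \<alpha> * H1 x powr - \<beta>" for x
    have cp: "0 < c x" for x using pos[of x] by (simp add: c_def)
    have cm[measurable]: "c \<in> borel_measurable (leb n)" unfolding c_def by measurable
    define W0 where "W0 x = c x \<cdot>\<^sub>m W x" for x
    have mW0: "matrix_weight n d W0" unfolding W0_def by (rule scaled_weight(1)[OF W(1) cm cp])
    define w where "w x = H2 x powr (s * \<alpha>) * H1 x powr (s * \<alpha> - 1)" for x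
    have wm: "w \<in> borel_measurable (leb n)" unfolding w_def by measurable
    have wp: "0 < w x" for x using pos[of x] by (simp add: w_def)
    have cs: "c x powr s = w x" for x
    proof -
      have "- \<beta> * s = s * \<alpha> - 1" using s by (simp add: \<beta>_def algebra_simps)
      then show ?thesis by (simp add: c_def w_def powr_mult powr_powr mult.commute)
    qed
    have W0s: "weight_powr W0 s x = w x \<cdot>\<^sub>m V x" if "x \<in> space (leb n)" for x
      using mat_powr_smult[OF matrix_weightD(1)[OF W(1) that], of "c x" s] cp[of x]
      by (simp add: weight_powr_def W0_def V_def cs less_imp_le)
    have mwV: "matrix_weight n d (\<lambda>x. w x \<cdot>\<^sub>m V x)" by (rule scaled_weight(1)[OF mV wm wp])
    have mW0s: "matrix_weight n d (weight_powr W0 s)"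
    proof -
      have "(\<lambda>x. weight_powr W0 s x $$ (i,j)) \<in> borel_measurable (leb n)" if "i < d" "j < d" for i j
        using matrix_weightD(3)[OF mwV that] by (simp add: W0s cong: measurable_cong)
      moreover have "AE x in leb n. invertible_mat (weight_powr W0 s x)"
        using matrix_weightD(4)[OF mwV] AE_space by eventually_elim (simp add: W0s)
      ultimately show ?thesis using matrix_weightD(1)[OF mwV] by (auto simp: matrix_weight_def W0s)
    qed
    have Ae: "A_const n \<B> ?r0 (weight_powr W0 s) = A_const n \<B> ?r0 (\<lambda>x. w x \<cdot>\<^sub>m V x)"
      by (rule A_const_cong) (rule W0s)
    have dual: "A_const n \<B> (ereal r') (weight_powr V (-1)) = A_const n \<B> (ereal r') (weight_powr W (- s))"
      by (rule A_const_cong) (simp add: V_def weight_powr_def mat_powr_mat_powr[OF matrix_weightD(1)[OF W(1)]])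
    have AX: "A_const n \<B> ?r0 (weight_powr W0 s) \<le> ennreal X"
    proof -
      let ?Y = "8 * real d ^ 7 *
         K d (ereal r') (enn2real (A_const n \<B> (ereal r') (weight_powr W (- s)))) powr (s * \<alpha>) *
         K d (ereal r) (enn2real (A_const n \<B> (ereal r) V)) powr (1 - s * \<alpha>)"
      have "A_const n \<B> ?r0 (weight_powr W0 s) \<le> ennreal ?Y"
        using HA unfolding Ae w_def dual .
      also have "ennreal ?Y \<le> ennreal X"
      proof (rule ennreal_leI)
        show "?Y \<le> X"
          using X unfolding r_def[symmetric] conj_exp_real[OF r] r'_def[symmetric] V_def[symmetric] .
      qed
      finally show ?thesis .
    qed
    have mem: "weight_powr W0 s \<in> A_class n d \<B> ?r0"
      using mW0s AX by (auto simp: A_class_def intro: order.strict_trans1)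
    have NX: "N (enn2real (A_const n \<B> ?r0 (weight_powr W0 s))) \<le> N X"
    proof (rule mono_onD[OF N(2)])
      show "enn2real (A_const n \<B> ?r0 (weight_powr W0 s)) \<le> X" using enn2real_mono[OF AX] K0 by simp
    qed (use K0 in auto)
    have src: "wnorm n W0 (if \<pi> = 0 then \<infinity> else ereal (1 / \<pi>)) f \<le> ennreal (\<mu> * 16 powr q * 256)"
      unfolding W0_def
      unfolding wnorm_scaled[OF W(1) f less_imp_le[OF cp]]
      unfolding F_def[symmetric] c_def
    proof (rule source_bound[OF Fm H(1,4) Fg(1) pos s \<alpha> \<beta>_def \<pi> pq r_def r \<mu>(1) _ H(3) I12])
      fix x
      have "u x \<le> H1 x" using H(2)[of x] \<phi>1(2)[of x] by (simp add: h1_def)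
      then have "u x powr (r / p) \<le> H1 x powr (r / p)" using r pq by (intro powr_mono2) (auto simp: u_def)
      also have "u x powr (r / p) = F x / \<mu>" using r pq \<mu>(1) Fg by (simp add: u_def powr_powr)
      finally show "F x \<le> \<mu> * H1 x powr (r / p)" using \<mu>(1) by (simp add: field_simps)
    qed
    have "wnorm n W0 (if \<alpha> = 0 then \<infinity> else ereal (1 / \<alpha>)) Tf \<le> ennreal E"
    proof -
      have "wnorm n W0 (if \<alpha> = 0 then \<infinity> else ereal (1 / \<alpha>)) Tf
        \<le> ennreal (N (enn2real (A_const n \<B> ?r0 (weight_powr W0 s)))) * wnorm n W0 (if \<pi> = 0 then \<infinity> else ereal (1 / \<pi>)) f"
        by (rule hyp[OF mW0 mem])
      also have "\<dots> \<le> ennreal (N X) * ennreal (\<mu> * 16 powr q * 256)"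
        using NX src by (intro mult_mono ennreal_leI) auto
      finally show ?thesis using N(1)[OF K0] by (simp add: E_def ennreal_mult')
    qed
    then have tgt: "Lnorm (leb n) (if \<alpha> = 0 then \<infinity> else ereal (1 / \<alpha>)) (\<lambda>x. ennreal (H2 x powr \<alpha> * H1 x powr - \<beta> * g x)) \<le> ennreal E"
      unfolding W0_def
      unfolding wnorm_scaled[OF W(1) Tf less_imp_le[OF cp]]
      unfolding g_def[symmetric] c_def .
    have "h x \<le> H2 x" for x using H(5)[of x] \<phi>2(2)[of x] by (simp add: h2_def)
    then show ?thesis
      by (intro target_bound[OF gm H(1,4) Fg(2) pos s \<alpha> \<beta>_def E tgt _ I12])
  qed
  have "(\<integral>\<^sup>+x. ennreal ((g x powr s) powr r) \<partial>leb n) \<le> ennreal ((E powr s * 256) powr r)"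
    by (rule Lp_norm_by_duality[OF _ _ r _ main]) (use E in \<open>auto simp: r'_def\<close>)
  then have "(\<integral>\<^sup>+x. ennreal (g x powr q) \<partial>leb n) \<le> ennreal ((E powr s * 256) powr r)"
    using s by (simp add: powr_powr r_def)
  then have "ennpow (\<integral>\<^sup>+x. ennreal (g x powr q) \<partial>leb n) (1 / q) \<le> ennpow (ennreal ((E powr s * 256) powr r)) (1 / q)"
    using pq by (intro ennpow_mono) auto
  also have "\<dots> = ennreal ((E powr s * 256) powr (1 / s))" using pq s by (simp add: powr_powr r_def)
  also have "(E powr s * 256) powr (1 / s) = E * 256 powr (1 / s)" using E s by (simp add: powr_mult powr_powr)
  also have "ennreal (E * 256 powr (1 / s)) \<le> ennreal (65536 * 16 powr q * N X * \<mu>)"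
  proof (rule ennreal_leI)
    have "(256::real) powr (1 / s) \<le> 256 powr 1" using s by (intro powr_mono) auto
    then have "E * 256 powr (1 / s) \<le> E * 256" using E by (intro mult_left_mono) auto
    then show "E * 256 powr (1 / s) \<le> 65536 * 16 powr q * N X * \<mu>" by (simp add: E_def mult_ac)
  qed
  finally show ?thesis unfolding wnorm_def Lnorm_real using Fg(2) by (simp add: g_def[symmetric])
qed

theorem theorem1p10:
  shows "\<exists>(C1 :: nat \<Rightarrow> ereal \<Rightarrow> ereal \<Rightarrow> real \<Rightarrow> real \<Rightarrow> real)
          (C2 :: nat \<Rightarrow> ereal \<Rightarrow> ereal \<Rightarrow> real).
    (\<forall>d p0 q0 p q. 0 < C1 d p0 q0 p q) \<and> (\<forall>d p0 q0. 0 < C2 d p0 q0) \<and>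
    (\<forall>(n::nat) (d::nat) \<B> K D T (s::real) (p0::ereal) (q0::ereal) (r0::ereal) (N :: real \<Rightarrow> real).
       1 \<le> n \<and> 1 \<le> d \<and> matrix_Muckenhoupt_basis n \<B> K \<and> sublinear_operator n d D T \<and>
       1 \<le> s \<and> 1 \<le> p0 \<and> p0 \<le> q0 \<and> 1 / p0 - 1 / q0 = 1 / conj_exp (ereal s) \<and>
       r0 = q0 / ereal s \<and>
       (\<forall>c\<ge>0. 0 < N c) \<and> mono_on {0..} N \<and>
       (\<forall>W0. matrix_weight n d W0 \<and> weight_powr W0 s \<in> A_class n d \<B> r0 \<longrightarrow>
          (\<forall>f\<in>D. wnorm n W0 q0 (T f)
             \<le> ennreal (N (enn2real (A_const n \<B> r0 (weight_powr W0 s)))) * wnorm n W0 p0 f))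
       \<longrightarrow>
       (\<forall>(p::real) (q::real) (r::ereal) W.
          1 < p \<and> p \<le> q \<and> 1 / ereal p - 1 / ereal q = 1 / p0 - 1 / q0 \<and> r = ereal q / ereal s \<and>
          matrix_weight n d W \<and> weight_powr W s \<in> A_class n d \<B> r \<longrightarrow>
          (\<forall>f\<in>D. wnorm n W (ereal q) (T f)
             \<le> ennreal (C1 d p0 q0 p q *
                  N (C2 d p0 q0 *
                     K d (conj_exp r) (enn2real (A_const n \<B> (conj_exp r) (weight_powr W (- s))))
                       powr real_of_ereal (1 / r0) *
                     K d r (enn2real (A_const n \<B> r (weight_powr W s)))
                       powr real_of_ereal (1 / conj_exp r0)))
                * wnorm n W (ereal p) f)))"
proof (rule exI[of _ "\<lambda>d p0 q0 p q. 65536 * 16 powr q"], rule exI[of _ "\<lambda>d p0 q0. 8 * max 1 (real d) ^ 7"], intro conjI allI impI ballI)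
  fix d p0 q0 p q
  show "0 < 65536 * (16::real) powr q" by simp
  show "0 < 8 * max 1 (real d) ^ 7" by (intro mult_pos_pos zero_less_power) (auto simp: max_def)
next
  fix n d \<B> K D T and s :: real and p0 q0 r0 N and p q :: real and r W f
  assume H: "1 \<le> n \<and> 1 \<le> d \<and> matrix_Muckenhoupt_basis n \<B> K \<and> sublinear_operator n d D T \<and>
       1 \<le> s \<and> 1 \<le> p0 \<and> p0 \<le> q0 \<and> 1 / p0 - 1 / q0 = 1 / conj_exp (ereal s) \<and>
       r0 = q0 / ereal s \<and>
       (\<forall>c\<ge>0. 0 < N c) \<and> mono_on {0..} N \<and>
       (\<forall>W0. matrix_weight n d W0 \<and> weight_powr W0 s \<in> A_class n d \<B> r0 \<longrightarrow>
          (\<forall>f\<in>D. wnorm n W0 q0 (T f)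
             \<le> ennreal (N (enn2real (A_const n \<B> r0 (weight_powr W0 s)))) * wnorm n W0 p0 f))"
  assume G: "1 < p \<and> p \<le> q \<and> 1 / ereal p - 1 / ereal q = 1 / p0 - 1 / q0 \<and> r = ereal q / ereal s \<and>
          matrix_weight n d W \<and> weight_powr W s \<in> A_class n d \<B> r"
  assume f: "f \<in> D"
  have d: "1 \<le> d" and mb: "matrix_Muckenhoupt_basis n \<B> K" and sl: "sublinear_operator n d D T"
    and s: "1 \<le> s" and pq0: "1 \<le> p0" "p0 \<le> q0" "1 / p0 - 1 / q0 = 1 / conj_exp (ereal s)" "r0 = q0 / ereal s"
    and N: "\<And>c. 0 \<le> c \<Longrightarrow> 0 < N c" "mono_on {0..} N"
    and hyp: "\<And>W0 f. matrix_weight n d W0 \<Longrightarrow> weight_powr W0 s \<in> A_class n d \<B> r0 \<Longrightarrow> f \<in> D \<Longrightarrow>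
      wnorm n W0 q0 (T f) \<le> ennreal (N (enn2real (A_const n \<B> r0 (weight_powr W0 s)))) * wnorm n W0 p0 f"
    using H by auto
  have pq: "1 < p" "p \<le> q" "1 / ereal p - 1 / ereal q = 1 / p0 - 1 / q0" and r: "r = ereal (q / s)"
    and W: "matrix_weight n d W" "weight_powr W s \<in> A_class n d \<B> r"
    using G s by auto
  obtain \<alpha> \<pi> where e: "0 \<le> \<alpha>" "\<pi> = \<alpha> + 1 - 1 / s" "s * \<alpha> \<le> 1"
    "q0 = (if \<alpha> = 0 then \<infinity> else ereal (1 / \<alpha>))" "p0 = (if \<pi> = 0 then \<infinity> else ereal (1 / \<pi>))"
    "r0 = (if s * \<alpha> = 0 then \<infinity> else ereal (1 / (s * \<alpha>)))"
    "real_of_ereal (1 / r0) = s * \<alpha>" "real_of_ereal (1 / conj_exp r0) = 1 - s * \<alpha>"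
    "1 / p0 - 1 / q0 = ereal (1 - 1 / s)"
    by (rule exponent_data[OF s pq0])
  have pq3: "1 / p - 1 / q = 1 - 1 / s"
    using pq(3) unfolding e(9) using pq(1,2) by (simp add: one_ereal_def)
  have fv: "f \<in> vec_fun n d" and Tv: "T f \<in> vec_fun n d" using sl f by (auto simp: sublinear_operator_def)
  define X where "X = 8 * max 1 (real d) ^ 7 *
    K d (conj_exp r) (enn2real (A_const n \<B> (conj_exp r) (weight_powr W (- s)))) powr (s * \<alpha>) *
    K d r (enn2real (A_const n \<B> r (weight_powr W s))) powr (1 - s * \<alpha>)"
  have X0: "0 \<le> X" by (simp add: X_def)
  define C where "C = 65536 * 16 powr q * N X"
  have C: "0 < C" using N(1)[OF X0] by (simp add: C_def)
  have step: "wnorm n W (ereal q) (T f) \<le> ennreal (C * \<mu>)"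
    if "0 < \<mu>" "(\<integral>\<^sup>+x. ennreal (vnorm (W x *\<^sub>v f x) powr p) \<partial>leb n) \<le> ennreal (\<mu> powr p)" for \<mu>
    unfolding C_def
  proof (rule extrapolation_step[OF d mb s e(1,3,2) pq(1,2) pq3 W(1) W(2)[unfolded r] fv Tv N _ that])
    show "wnorm n W0 (if \<alpha> = 0 then \<infinity> else ereal (1 / \<alpha>)) (T f)
        \<le> ennreal (N (enn2real (A_const n \<B> (if s * \<alpha> = 0 then \<infinity> else ereal (1 / (s * \<alpha>))) (weight_powr W0 s)))) *
          wnorm n W0 (if \<pi> = 0 then \<infinity> else ereal (1 / \<pi>)) f"
      if "matrix_weight n d W0" "weight_powr W0 s \<in> A_class n d \<B> (if s * \<alpha> = 0 then \<infinity> else ereal (1 / (s * \<alpha>)))" for W0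
      using hyp[OF that(1) _ f] that(2) unfolding e(4,5,6)[symmetric] by blast
  qed (use d in \<open>simp_all add: X_def r\<close>)
  have wn: "wnorm n W (ereal p) f = ennpow (\<integral>\<^sup>+x. ennreal (vnorm (W x *\<^sub>v f x) powr p) \<partial>leb n) (1 / p)"
    by (simp add: wnorm_def Lnorm_real)
  have "wnorm n W (ereal q) (T f) \<le> ennreal C * wnorm n W (ereal p) f"
  proof (cases "wnorm n W (ereal p) f")
    case top
    then show ?thesis using C by (simp add: ennreal_mult_top)
  next
    case (real w)
    \<comment> \<open>All \<open>\<mu> > w\<close> are used instead of \<open>w\<close> itself,
      which may be 0.\<close>
    have bd: "wnorm n W (ereal q) (T f) \<le> ennreal (C * \<mu>)" if "w < \<mu>" for \<mu>
    proof (rule step)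
      show "0 < \<mu>" using that real by simp
      have "ennpow (ennpow (\<integral>\<^sup>+x. ennreal (vnorm (W x *\<^sub>v f x) powr p) \<partial>leb n) (1 / p)) p \<le> ennpow (ennreal \<mu>) p"
        unfolding wn[symmetric] real using that pq by (intro ennpow_mono ennreal_leI) auto
      then show "(\<integral>\<^sup>+x. ennreal (vnorm (W x *\<^sub>v f x) powr p) \<partial>leb n) \<le> ennreal (\<mu> powr p)"
        using pq that real by (simp add: ennpow_inverse)
    qed
    have "wnorm n W (ereal q) (T f) \<le> ennreal (C * w)"
    proof (rule ennreal_le_epsilon)
      fix \<epsilon> :: real assume \<epsilon>: "0 < \<epsilon>"
      have "wnorm n W (ereal q) (T f) \<le> ennreal (C * (w + \<epsilon> / C))" using \<epsilon> C by (intro bd) simp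
      also have "C * (w + \<epsilon> / C) = C * w + \<epsilon>" using C by (simp add: field_simps)
      also have "ennreal (C * w + \<epsilon>) = ennreal (C * w) + ennreal \<epsilon>" using C real \<epsilon> by simp
      finally show "wnorm n W (ereal q) (T f) \<le> ennreal (C * w) + ennreal \<epsilon>" .
    qed
    then show ?thesis using C real by (simp add: ennreal_mult)
  qed
  then show "wnorm n W (ereal q) (T f)
     \<le> ennreal (65536 * 16 powr q *
          N (8 * max 1 (real d) ^ 7 *
             K d (conj_exp r) (enn2real (A_const n \<B> (conj_exp r) (weight_powr W (- s))))
               powr real_of_ereal (1 / r0) *
             K d r (enn2real (A_const n \<B> r (weight_powr W s)))
               powr real_of_ereal (1 / conj_exp r0)))
        * wnorm n W (ereal p) f"
    unfolding e(7,8) C_def X_def .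
qed

end
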